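(* As the mesh $\delta$ of the partition $\Pi$ goes to $0$, both families $V_\Pi$ and $v_\Pi$ converge, uniformly on compact subsets of $\mathbb{R}^+\times\Delta(\Omega)$ and of $\mathbb{R}^+\times\Omega$ respectively, to some functions $V:\mathbb{R}^+\times\Delta(\Omega)\to\mathbb{R}$ and $v:\mathbb{R}^+\times\Omega\to\mathbb{R}$ with $$V(t,\zeta)=\sum_{\omega\in\Omega}\zeta(\omega)\,v(t,\omega).$$ $V$ is the viscosity solution on $\mathbb{R}^+\times\Delta(\Omega)$ of $$0=\frac{d}{dt}U(t,\zeta)+\mathrm{val}_{\mathbf{X}\times\mathbf{Y}}\Big[\sum_{\omega\in\Omega}\zeta(\omega)\,g(\omega,\mathbf{x}(\omega),\mathbf{y}(\omega))\,k(t)+\langle f(\zeta,\mathbf{x},\mathbf{y}),\nabla U(t,\zeta)\rangle\Big],$$ and $v$ is the viscosity solution on $\mathbb{R}^+\times\Omega$ of $$0=\frac{d}{dt}u(t,z)+\mathrm{val}_{X\times Y}\Big\{g(z,x,y)\,k(t)+\sum_{z'\in\Omega}q(x,y)[z,z']\,u(t,z')\Big\}.$$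
   Context: Data. $\Omega$ is a finite set; $I,J$ are compact metric spaces; $g:\Omega\times I\times J\to\mathbb{R}$ is continuous on $I\times J$; $k:\mathbb{R}^+\to\mathbb{R}^+$ is a Lipschitz continuous probability density on $\mathbb{R}^+=[0,+\infty)$; $q$ is a bounded transition rate, continuous on $I\times J$: $q(i,j)[\omega,\omega']\ge 0$ for $\omega'\neq\omega$ and $\sum_{\omega'}q(i,j)[\omega,\omega']=0$ for all $i,j,\omega$. For $h\ge0$, $P^h(i,j)=e^{h\,q(i,j)}$ is the associated transition matrix on $\Omega$. $X=\Delta(I)$ and $Y=\Delta(J)$ are the sets of regular Borel probabilities on $I,J$; functions of $(i,j)$ (such as $g$ and $q$) are extended bilinearly to $X\times Y$ by expectation. $\mathbf{X}=X^\Omega$, $\mathbf{Y}=Y^\Omega$. $\Delta(\Omega)$ is the set of probabilities on $\Omega$. $\mathrm{val}_{A\times B}$ denotes the value ($\sup_A\inf_B=\inf_B\sup_A$) of a zero-sum game, the player choosing in $A$ (Player 1) maximizing. Game $G_\Pi$. $\Pi=\{t_1=0<t_2<\dots<t_n<\dots\}$ is a partition of $\mathbb{R}^+$ (with $t_n\to\infty$), $\delta_n=t_{n+1}-t_n$, with mesh $\delta=\sup_n\delta_n$. A process $Z_t$ in $\Omega$ is controlled as follows: at each time $t_n$ both players observe $Z_{t_n}$ and simultaneously (and possibly at random) choose actions $(i_n,j_n)\in I\times J$, which are kept constant on $[t_n,t_{n+1})$; on this interval $Z$ is a continuous-time Markov chain with generator $q(i_n,j_n)$, and the payoff at time $t\in[t_n,t_{n+1})$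 is $g(Z_t,i_n,j_n)$. The total payoff is the expectation of $\int_0^{+\infty}(\text{payoff at time }t)\,k(t)\,dt$. For $t_n\in\Pi$ and $\omega\in\Omega$, $v_\Pi(t_n,\omega)$ is the value of the game starting at time $t_n$ from state $Z_{t_n}=\omega$, with the payoff integrated over $[t_n,+\infty)$; $v_\Pi(\cdot,\omega)$ is extended to $\mathbb{R}^+$ by linear interpolation between consecutive points of $\Pi$. For $\zeta\in\Delta(\Omega)$, $V_\Pi(t,\zeta)=\sum_{\omega}\zeta(\omega)v_\Pi(t,\omega)$. $f(\zeta,\mathbf{x},\mathbf{y})\in\mathbb{R}^\Omega$ is given by $f(\zeta,\mathbf{x},\mathbf{y})(z)=\sum_{\omega}\zeta(\omega)\,q(\mathbf{x}(\omega),\mathbf{y}(\omega))[\omega,z]$. Viscosity solutions. A continuous real function $u$ on $\mathbb{R}^+\times\Omega$ is a viscosity solution of $0=\frac{d}{dt}u(t,z)+\mathrm{val}_{X\times Y}\{g(z,x,y)k(t)+\sum_{z'}q(x,y)[z,z']u(t,z')\}$ if for every real function $\psi$ on $\mathbb{R}^+\times\Omega$, $\mathcal{C}^1$ (in $t$), such that $u-\psi$ has a strict maximum at $(\bar t,\bar z)$, one has $0\le\frac{d}{dt}\psi(\bar t,\bar z)+\mathrm{val}_{X\times Y}\{g(\bar z,x,y)k(\bar t)+\sum_{z'}q(x,y)[\bar z,z']\psi(\bar t,z')\}$, and the dual condition holds (strict minimum, reversed inequality). A continuous real function $U$ on $\mathbb{R}^+\times\Delta(\Omega)$ is a viscosity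 solution of $0=\frac{d}{dt}U(t,\zeta)+H(t,\zeta,\nabla U(t,\zeta))$ if for every $\mathcal{C}^1$ real function $\psi$ on $\mathbb{R}^+\times\Delta(\Omega)$ (restriction of a $\mathcal{C}^1$ function on a neighbourhood) such that $U-\psi$ has a strict maximum at $(\bar t,\bar\zeta)$, one has $0\le\frac{d}{dt}\psi(\bar t,\bar\zeta)+H(\bar t,\bar\zeta,\nabla\psi(\bar t,\bar\zeta))$, and the dual condition holds. "The viscosity solution" means the unique viscosity solution among functions $u$ such that for every $\varepsilon>0$ there is $T$ with $|u(t,\cdot)|\le\varepsilon$ for all $t\ge T$. *)

theory Defs
  imports "HOL-Probability.Probability"
begin

section \<open>Values of zero-sum games\<close>

text \<open>Every payoff to which \<open>game_val\<close> is applied below is bounded, so that the real-valued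
  suprema and infima are the genuine ones.\<close>

definition is_value :: "'a set \<Rightarrow> 'b set \<Rightarrow> ('a \<Rightarrow> 'b \<Rightarrow> real) \<Rightarrow> real \<Rightarrow> bool" where
  "is_value A B F c \<longleftrightarrow>
     (SUP a\<in>A. INF b\<in>B. F a b) = c \<and> (INF b\<in>B. SUP a\<in>A. F a b) = c"

definition game_val :: "'a set \<Rightarrow> 'b set \<Rightarrow> ('a \<Rightarrow> 'b \<Rightarrow> real) \<Rightarrow> real" where
  "game_val A B F = (THE c. is_value A B F c)"

section \<open>Mixed actions and transition probabilities\<close>

text \<open>Borel probability measures; on a compact metric space they are all regular.\<close>

definition Delta :: "'a::topological_space measure set" where
  "Delta = space (prob_algebra borel)"

definition mixed_ext ::
  "('i \<Rightarrow> 'j \<Rightarrow> 'a::{banach, second_countable_topology}) \<Rightarrow> 'i measure \<Rightarrow> 'j measure \<Rightarrow> 'a" where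
  "mixed_ext F x y = (\<integral>p. F (fst p) (snd p) \<partial>(x \<Otimes>\<^sub>M y))"

definition prob_simplex :: "(real^'w::finite) set" where
  "prob_simplex = {\<zeta>. (\<forall>\<omega>. 0 \<le> \<zeta> $ \<omega>) \<and> (\<Sum>\<omega>\<in>UNIV. \<zeta> $ \<omega>) = 1}"

definition transition_rate :: "('i \<Rightarrow> 'j \<Rightarrow> real^'w^'w::finite) \<Rightarrow> bool" where
  "transition_rate q \<longleftrightarrow>
     (\<forall>i j \<omega> \<omega>'. \<omega>' \<noteq> \<omega> \<longrightarrow> 0 \<le> q i j $ \<omega> $ \<omega>') \<and> (\<forall>i j \<omega>. (\<Sum>\<omega>'\<in>UNIV. q i j $ \<omega> $ \<omega>') = 0)"

text \<open>The matrix product is \<open>**\<close>; the operations \<open>*\<close> and \<open>^\<close> on \<open>real^'w^'w\<close> are entrywise.\<close>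

definition matrix_exp :: "real^'w^'w::finite \<Rightarrow> real^'w^'w" where
  "matrix_exp A = (\<Sum>n. (1 / fact n) *\<^sub>R (((**) A ^^ n) (mat 1)))"

text \<open>The law at time \<open>s + h\<close> of the Markov chain with generator \<open>q i j\<close> that is in state \<open>\<omega>\<close> at
  time \<open>s\<close>, i.e. row \<open>\<omega>\<close> of the matrix \<open>exp (h q(i,j))\<close>.\<close>

definition state_law :: "('i \<Rightarrow> 'j \<Rightarrow> real^'w^'w::finite) \<Rightarrow> real \<Rightarrow> 'i \<Rightarrow> 'j \<Rightarrow> 'w \<Rightarrow> 'w measure" where
  "state_law q h i j \<omega> = point_measure UNIV (\<lambda>z. ennreal (matrix_exp (h *\<^sub>R q i j) $ \<omega> $ z))"

section \<open>Partitions of the half-line\<close>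

text \<open>The partition points are numbered from \<open>0\<close>.\<close>

definition is_partition :: "(nat \<Rightarrow> real) \<Rightarrow> bool" where
  "is_partition \<pi> \<longleftrightarrow> \<pi> 0 = 0 \<and> strict_mono \<pi> \<and> filterlim \<pi> at_top sequentially"

definition mesh :: "(nat \<Rightarrow> real) \<Rightarrow> ereal" where
  "mesh \<pi> = (SUP n. ereal (\<pi> (Suc n) - \<pi> n))"

definition mesh_to_0 :: "(nat \<Rightarrow> real) filter" where
  "mesh_to_0 = inf (filtercomap mesh (nhds 0)) (principal {\<pi>. is_partition \<pi>})"

definition stage_at :: "(nat \<Rightarrow> real) \<Rightarrow> real \<Rightarrow> nat" where
  "stage_at \<pi> t = (THE n. \<pi> n \<le> t \<and> t < \<pi> (Suc n))"

section \<open>The game played on a partition\<close>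

text \<open>A play of the game that starts at time \<open>\<pi> n\<close> is the sequence, indexed by \<open>m\<close>, of the states
  \<open>Z\<close> at the times \<open>\<pi> (n + m)\<close> together with the actions chosen there. Strategies are behavioural
  and use perfect recall: at stage \<open>m\<close> the mixed action depends measurably on the states and
  actions of the stages before \<open>m\<close> and on the current state.\<close>

definition stage_space :: "('w \<times> 'i::topological_space \<times> 'j::topological_space) measure" where
  "stage_space = count_space UNIV \<Otimes>\<^sub>M (borel \<Otimes>\<^sub>M borel)"

type_synonym ('w, 'i, 'j, 'a) strategy =
  "nat \<Rightarrow> (nat \<Rightarrow> 'w \<times> 'i \<times> 'j) \<times> 'w \<Rightarrow> 'a measure"

definition strategies ::
  "('w, 'i::topological_space, 'j::topological_space, 'a::topological_space) strategy set" where
  "strategies = {\<sigma>. \<forall>m. \<sigma> m \<in>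
     (PiM {0..<m} (\<lambda>_. stage_space) \<Otimes>\<^sub>M count_space UNIV) \<rightarrow>\<^sub>M prob_algebra borel}"

definition next_state_law ::
  "(nat \<Rightarrow> real) \<Rightarrow> ('i \<Rightarrow> 'j \<Rightarrow> real^'w^'w::finite) \<Rightarrow> nat \<Rightarrow> 'w \<Rightarrow> nat \<Rightarrow>
     (nat \<Rightarrow> 'w \<times> 'i \<times> 'j) \<Rightarrow> 'w measure" where
  "next_state_law \<pi> q n \<omega> m h =
     (case m of 0 \<Rightarrow> return (count_space UNIV) \<omega>
      | Suc l \<Rightarrow> (case h l of (z, i, j) \<Rightarrow> state_law q (\<pi> (n + m) - \<pi> (n + l)) i j z))"

text \<open>Given the history before stage \<open>m\<close>, the current state is drawn, and then the two actions
  independently of each other.\<close>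

definition stage_kernel ::
  "(nat \<Rightarrow> real) \<Rightarrow> ('i::topological_space \<Rightarrow> 'j::topological_space \<Rightarrow> real^'w^'w::finite) \<Rightarrow> nat \<Rightarrow> 'w \<Rightarrow>
     ('w, 'i, 'j, 'i) strategy \<Rightarrow> ('w, 'i, 'j, 'j) strategy \<Rightarrow>
     nat \<Rightarrow> (nat \<Rightarrow> 'w \<times> 'i \<times> 'j) \<Rightarrow> ('w \<times> 'i \<times> 'j) measure" where
  "stage_kernel \<pi> q n \<omega> \<sigma> \<tau> m h =
     next_state_law \<pi> q n \<omega> m h \<bind>
       (\<lambda>z. distr (\<sigma> m (h, z) \<Otimes>\<^sub>M \<tau> m (h, z)) stage_space (Pair z))"

text \<open>The law of the infinite play, from the Ionescu-Tulcea theorem.\<close>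

definition play_law ::
  "(nat \<Rightarrow> real) \<Rightarrow> ('i::topological_space \<Rightarrow> 'j::topological_space \<Rightarrow> real^'w^'w::finite) \<Rightarrow> nat \<Rightarrow> 'w \<Rightarrow>
     ('w, 'i, 'j, 'i) strategy \<Rightarrow> ('w, 'i, 'j, 'j) strategy \<Rightarrow> (nat \<Rightarrow> 'w \<times> 'i \<times> 'j) measure" where
  "play_law \<pi> q n \<omega> \<sigma> \<tau> =
     projective_family.lim UNIV
       (Ionescu_Tulcea.CI (stage_kernel \<pi> q n \<omega> \<sigma> \<tau>) (\<lambda>_. stage_space)) (\<lambda>_. stage_space)"

text \<open>The expected payoff rate at time \<open>t\<close> given the states at the partition points and the
  actions: if \<open>t\<close> lies in \<open>[\<pi> N, \<pi> (N + 1))\<close>, the actions are those chosen at \<open>\<pi> N\<close>, and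
  \<open>Z\<close> has evolved for the time \<open>t - \<pi> N\<close> from the state observed at \<open>\<pi> N\<close>.\<close>

definition payoff_rate ::
  "('w::finite \<Rightarrow> 'i \<Rightarrow> 'j \<Rightarrow> real) \<Rightarrow> (nat \<Rightarrow> real) \<Rightarrow> ('i \<Rightarrow> 'j \<Rightarrow> real^'w^'w) \<Rightarrow> nat \<Rightarrow>
     (nat \<Rightarrow> 'w \<times> 'i \<times> 'j) \<Rightarrow> real \<Rightarrow> real" where
  "payoff_rate g \<pi> q n p t =
     (let N = stage_at \<pi> t in case p (N - n) of (z, i, j) \<Rightarrow>
        \<integral>z'. g z' i j \<partial>(state_law q (t - \<pi> N) i j z))"

definition expected_payoff ::
  "('w::finite \<Rightarrow> 'i::topological_space \<Rightarrow> 'j::topological_space \<Rightarrow> real) \<Rightarrow> (real \<Rightarrow> real) \<Rightarrow>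
     ('i \<Rightarrow> 'j \<Rightarrow> real^'w^'w) \<Rightarrow> (nat \<Rightarrow> real) \<Rightarrow> nat \<Rightarrow> 'w \<Rightarrow>
     ('w, 'i, 'j, 'i) strategy \<Rightarrow> ('w, 'i, 'j, 'j) strategy \<Rightarrow> real" where
  "expected_payoff g k q \<pi> n \<omega> \<sigma> \<tau> =
     (\<integral>p. (LINT t:{\<pi> n..}|lborel. payoff_rate g \<pi> q n p t * k t) \<partial>(play_law \<pi> q n \<omega> \<sigma> \<tau>))"

definition v_node ::
  "('w::finite \<Rightarrow> 'i::topological_space \<Rightarrow> 'j::topological_space \<Rightarrow> real) \<Rightarrow> (real \<Rightarrow> real) \<Rightarrow>
     ('i \<Rightarrow> 'j \<Rightarrow> real^'w^'w) \<Rightarrow> (nat \<Rightarrow> real) \<Rightarrow> nat \<Rightarrow> 'w \<Rightarrow> real" where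
  "v_node g k q \<pi> n \<omega> = game_val strategies strategies (expected_payoff g k q \<pi> n \<omega>)"

definition v_part ::
  "('w::finite \<Rightarrow> 'i::topological_space \<Rightarrow> 'j::topological_space \<Rightarrow> real) \<Rightarrow> (real \<Rightarrow> real) \<Rightarrow>
     ('i \<Rightarrow> 'j \<Rightarrow> real^'w^'w) \<Rightarrow> (nat \<Rightarrow> real) \<Rightarrow> real \<Rightarrow> 'w \<Rightarrow> real" where
  "v_part g k q \<pi> t \<omega> =
     (let n = stage_at \<pi> t in
        v_node g k q \<pi> n \<omega> + (t - \<pi> n) / (\<pi> (Suc n) - \<pi> n) *
          (v_node g k q \<pi> (Suc n) \<omega> - v_node g k q \<pi> n \<omega>))"

definition V_part ::
  "('w::finite \<Rightarrow> 'i::topological_space \<Rightarrow> 'j::topological_space \<Rightarrow> real) \<Rightarrow> (real \<Rightarrow> real) \<Rightarrow>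
     ('i \<Rightarrow> 'j \<Rightarrow> real^'w^'w) \<Rightarrow> (nat \<Rightarrow> real) \<Rightarrow> real \<Rightarrow> real^'w \<Rightarrow> real" where
  "V_part g k q \<pi> t \<zeta> = (\<Sum>\<omega>\<in>UNIV. \<zeta> $ \<omega> * v_part g k q \<pi> t \<omega>)"

section \<open>The Hamiltonians\<close>

definition state_hamiltonian ::
  "('w::finite \<Rightarrow> 'i::topological_space \<Rightarrow> 'j::topological_space \<Rightarrow> real) \<Rightarrow> (real \<Rightarrow> real) \<Rightarrow>
     ('i \<Rightarrow> 'j \<Rightarrow> real^'w^'w) \<Rightarrow> real \<Rightarrow> 'w \<Rightarrow> ('w \<Rightarrow> real) \<Rightarrow> real" where
  "state_hamiltonian g k q t z a =
     game_val Delta Delta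
       (\<lambda>x y. mixed_ext (g z) x y * k t + (\<Sum>z'\<in>UNIV. mixed_ext q x y $ z $ z' * a z'))"

definition drift ::
  "('i \<Rightarrow> 'j \<Rightarrow> real^'w^'w::finite) \<Rightarrow> real^'w \<Rightarrow> ('w \<Rightarrow> 'i measure) \<Rightarrow> ('w \<Rightarrow> 'j measure) \<Rightarrow> real^'w" where
  "drift q \<zeta> x y = (\<chi> z. \<Sum>\<omega>\<in>UNIV. \<zeta> $ \<omega> * mixed_ext q (x \<omega>) (y \<omega>) $ \<omega> $ z)"

definition simplex_hamiltonian ::
  "('w::finite \<Rightarrow> 'i::topological_space \<Rightarrow> 'j::topological_space \<Rightarrow> real) \<Rightarrow> (real \<Rightarrow> real) \<Rightarrow>
     ('i \<Rightarrow> 'j \<Rightarrow> real^'w^'w) \<Rightarrow> real \<Rightarrow> real^'w \<Rightarrow> real^'w \<Rightarrow> real" where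
  "simplex_hamiltonian g k q t \<zeta> a =
     game_val (UNIV \<rightarrow> Delta) (UNIV \<rightarrow> Delta)
       (\<lambda>x y. (\<Sum>\<omega>\<in>UNIV. \<zeta> $ \<omega> * mixed_ext (g \<omega>) (x \<omega>) (y \<omega>)) * k t + drift q \<zeta> x y \<bullet> a)"

section \<open>Viscosity solutions\<close>

definition strict_max_at :: "'a set \<Rightarrow> ('a \<Rightarrow> real) \<Rightarrow> 'a \<Rightarrow> bool" where
  "strict_max_at S F a \<longleftrightarrow> a \<in> S \<and> (\<forall>b\<in>S. b \<noteq> a \<longrightarrow> F b < F a)"

definition strict_min_at :: "'a set \<Rightarrow> ('a \<Rightarrow> real) \<Rightarrow> 'a \<Rightarrow> bool" where
  "strict_min_at S F a \<longleftrightarrow> a \<in> S \<and> (\<forall>b\<in>S. b \<noteq> a \<longrightarrow> F a < F b)"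

text \<open>\<open>D\<close> is the time derivative of \<open>\<psi>\<close>, one-sided at \<open>0\<close>.\<close>

definition C1_states :: "(real \<Rightarrow> 'w \<Rightarrow> real) \<Rightarrow> (real \<Rightarrow> 'w \<Rightarrow> real) \<Rightarrow> bool" where
  "C1_states \<psi> D \<longleftrightarrow>
     (\<forall>z. continuous_on {0..} (\<lambda>t. D t z) \<and>
       (\<forall>t\<ge>0. ((\<lambda>s. \<psi> s z) has_real_derivative D t z) (at t within {0..})))"

definition viscosity_solution_states ::
  "(real \<Rightarrow> 'w \<Rightarrow> ('w \<Rightarrow> real) \<Rightarrow> real) \<Rightarrow> (real \<Rightarrow> 'w \<Rightarrow> real) \<Rightarrow> bool" where
  "viscosity_solution_states H u \<longleftrightarrow>
     (\<forall>z. continuous_on {0..} (\<lambda>t. u t z)) \<and>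
     (\<forall>\<psi> D t z. C1_states \<psi> D \<and>
        strict_max_at ({0..} \<times> UNIV) (\<lambda>(s, w). u s w - \<psi> s w) (t, z) \<longrightarrow>
        0 \<le> D t z + H t z (\<psi> t)) \<and>
     (\<forall>\<psi> D t z. C1_states \<psi> D \<and>
        strict_min_at ({0..} \<times> UNIV) (\<lambda>(s, w). u s w - \<psi> s w) (t, z) \<longrightarrow>
        0 \<ge> D t z + H t z (\<psi> t))"

text \<open>\<open>D\<close> is the gradient of \<open>\<psi>\<close> in \<open>real \<times> (real^'w)\<close>: its first component is the time derivative,
  its second one the gradient in \<open>\<zeta>\<close>.\<close>

definition C1_simplex ::
  "(real \<times> (real^'w::finite) \<Rightarrow> real) \<Rightarrow> (real \<times> (real^'w) \<Rightarrow> real \<times> (real^'w)) \<Rightarrow> bool" where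
  "C1_simplex \<psi> D \<longleftrightarrow>
     (\<exists>N. open N \<and> {0..} \<times> prob_simplex \<subseteq> N \<and> continuous_on N D \<and> (\<forall>p\<in>N. GDERIV \<psi> p :> D p))"

definition viscosity_solution_simplex ::
  "(real \<Rightarrow> real^'w::finite \<Rightarrow> real^'w \<Rightarrow> real) \<Rightarrow> (real \<Rightarrow> real^'w \<Rightarrow> real) \<Rightarrow> bool" where
  "viscosity_solution_simplex H U \<longleftrightarrow>
     continuous_on ({0..} \<times> prob_simplex) (\<lambda>(t, \<zeta>). U t \<zeta>) \<and>
     (\<forall>\<psi> D t \<zeta>. C1_simplex \<psi> D \<and>
        strict_max_at ({0..} \<times> prob_simplex) (\<lambda>(s, \<xi>). U s \<xi> - \<psi> (s, \<xi>)) (t, \<zeta>) \<longrightarrow>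
        0 \<le> fst (D (t, \<zeta>)) + H t \<zeta> (snd (D (t, \<zeta>)))) \<and>
     (\<forall>\<psi> D t \<zeta>. C1_simplex \<psi> D \<and>
        strict_min_at ({0..} \<times> prob_simplex) (\<lambda>(s, \<xi>). U s \<xi> - \<psi> (s, \<xi>)) (t, \<zeta>) \<longrightarrow>
        0 \<ge> fst (D (t, \<zeta>)) + H t \<zeta> (snd (D (t, \<zeta>))))"

definition vanishes_at_infinity :: "'a set \<Rightarrow> (real \<Rightarrow> 'a \<Rightarrow> real) \<Rightarrow> bool" where
  "vanishes_at_infinity S u \<longleftrightarrow> (\<forall>\<epsilon>>0. \<exists>T\<ge>0. \<forall>t\<ge>T. \<forall>a\<in>S. \<bar>u t a\<bar> \<le> \<epsilon>)"

text \<open>\<open>u\<close> is the unique function on \<open>{0..} \<times> S\<close> with property \<open>P\<close> that vanishes at infinity;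
  values outside this domain are irrelevant.\<close>

definition the_vanishing_solution ::
  "'a set \<Rightarrow> ((real \<Rightarrow> 'a \<Rightarrow> real) \<Rightarrow> bool) \<Rightarrow> (real \<Rightarrow> 'a \<Rightarrow> real) \<Rightarrow> bool" where
  "the_vanishing_solution S P u \<longleftrightarrow>
     P u \<and> vanishes_at_infinity S u \<and>
     (\<forall>u'. P u' \<and> vanishes_at_infinity S u' \<longrightarrow> (\<forall>t\<ge>0. \<forall>a\<in>S. u' t a = u t a))"

end

theory Submission
  imports Defs
begin

text \<open>Because \<open>\<Omega>\<close> is finite, the Hamilton-Jacobi equation on \<open>{0..} \<times> \<Omega>\<close> is an ordinary
  differential equation for a vector with Lipschitz right-hand side, and it has a classical
  solution \<open>v\<close> that vanishes at infinity. Its off-diagonal rates being nonnegative, the Hamiltonian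
  is elliptic, so that classical solutions are viscosity solutions and a test function
  \<open>v + \<epsilon> exp (- t)\<close> plus a small strictifying term gives comparison with every other viscosity
  solution. The Hamiltonian on the simplex is the \<open>\<zeta>\<close>-average of those on \<open>\<Omega>\<close>; hence the same
  argument applies to \<open>V(t,\<zeta>) = \<Sum>\<omega>. \<zeta>(\<omega>) v(t,\<omega>)\<close>.

  The value of the game on a partition satisfies the backward recursion of a nonexpansive Shapley
  operator. One step of this operator agrees with one Euler step of the differential equation up to
  an error of second order in the step, and both values are at most \<open>M\<close> times the mass of \<open>k\<close>
  on the remaining half-line, which gives the convergence.\<close>

text \<open>The horizon is infinite and there is no discounting beyond the decay of the tail of
  \<open>k\<close>: neither the differential equation nor the recursion has a last time to start
  from, and the Shapley operator is nonexpansive without being a contraction. The tail mass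
  \<open>K t\<close> of \<open>k\<close> on \<open>{t..}\<close> takes over both roles. Payoffs,
  solution and game values stay below \<open>M * K\<close>, and cutting everything off at
  \<open>T\<close> costs a multiple of \<open>M * K T\<close>. The classical solution comes from an
  integrating factor \<open>exp (- lam * t)\<close>, with \<open>lam\<close> dominating the diagonal
  rates. The resulting integral operator is monotone, so its iterates from the lowest admissible
  function \<open>- M * K\<close> increase to a fixed point. Being C1, this solution serves itself
  as a test function, and comparison needs no doubling of variables. Optimal mixed actions never
  occur, only \<epsilon>-optimal ones. This keeps the minimax theorem elementary: empirical
  frequencies of replies on a finite net replace weak compactness of the set of measures.\<close>

definition approx_value :: "'a set \<Rightarrow> 'b set \<Rightarrow> ('a \<Rightarrow> 'b \<Rightarrow> real) \<Rightarrow> real \<Rightarrow> bool" where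
  "approx_value A B F c \<longleftrightarrow>
     (\<forall>\<epsilon>>0. \<exists>a\<in>A. \<forall>b\<in>B. c - \<epsilon> \<le> F a b) \<and> (\<forall>\<epsilon>>0. \<exists>b\<in>B. \<forall>a\<in>A. F a b \<le> c + \<epsilon>)"

text \<open>An \<open>e / 2\<close>-optimal choice of the first player in \<open>F\<close> is played
  against an \<open>e / 2\<close>-optimal choice of the second in \<open>F'\<close>. All later
  comparisons of values go through this form, which involves no supremum or infimum and hence no
  boundedness.\<close>

lemma approx_value_mono:
  assumes "approx_value A B F c" "approx_value A B F' c'"
    and le: "\<And>a b. a \<in> A \<Longrightarrow> b \<in> B \<Longrightarrow> F a b \<le> F' a b + d"
  shows "c \<le> c' + d"
proof (rule field_le_epsilon)
  fix e :: real assume "e > 0"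
  then have "e / 2 > 0" by simp
  with assms obtain a b where ab: "a \<in> A" "b \<in> B" "\<forall>b\<in>B. c - e / 2 \<le> F a b" "\<forall>a\<in>A. F' a b \<le> c' + e / 2"
    unfolding approx_value_def by meson
  then have "c - e / 2 \<le> F a b" "F' a b \<le> c' + e / 2" "F a b \<le> F' a b + d" using le by auto
  then show "c \<le> c' + d + e" by simp
qed

lemma approx_value_abs_diff_le:
  assumes "approx_value A B F c" "approx_value A B F' c'"
    and "\<And>a b. a \<in> A \<Longrightarrow> b \<in> B \<Longrightarrow> \<bar>F a b - F' a b\<bar> \<le> d"
  shows "\<bar>c - c'\<bar> \<le> d"
proof -
  have "F a b \<le> F' a b + d" "F' a b \<le> F a b + d" if "a \<in> A" "b \<in> B" for a b
    using assms(3)[OF that] by auto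
  then have "c \<le> c' + d" "c' \<le> c + d"
    using approx_value_mono assms(1,2) by blast+
  then show ?thesis by simp
qed

lemma approx_value_bounds:
  assumes "approx_value A B F c" and "\<And>a b. a \<in> A \<Longrightarrow> b \<in> B \<Longrightarrow> l \<le> F a b \<and> F a b \<le> u"
  shows "l \<le> c" "c \<le> u"
proof -
  \<comment> \<open>A constant game has its constant as value as soon as both players have a choice;
    the given approximate value of \<open>F\<close> guarantees that \<open>A\<close> and
    \<open>B\<close> are nonempty.\<close>
  have 1: "approx_value A B (\<lambda>_ _. x) x" for x
    using assms(1) unfolding approx_value_def by (metis add_increasing2 diff_left_mono diff_zero less_eq_real_def)
  show "l \<le> c" using approx_value_mono[OF 1 assms(1), of l 0] assms(2) by auto
  show "c \<le> u" using approx_value_mono[OF assms(1) 1, of u 0] assms(2) by auto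
qed

text \<open>The bound \<open>M\<close> makes the real suprema and infima genuine. \<epsilon>-optimal
  choices then squeeze both between \<open>c - e\<close> and \<open>c + e\<close>.\<close>

lemma approx_value_imp_is_value:
  assumes av: "approx_value A B F c" and bd: "\<And>a b. a \<in> A \<Longrightarrow> b \<in> B \<Longrightarrow> \<bar>F a b\<bar> \<le> M"
  shows "is_value A B F c"
proof -
  have ne: "A \<noteq> {}" "B \<noteq> {}" using av unfolding approx_value_def by (meson gt_ex bex_empty)+
  have bF: "- M \<le> F a b \<and> F a b \<le> M" if "a \<in> A" "b \<in> B" for a b using bd[OF that] by auto
  have bi: "bdd_below ((\<lambda>b. F a b) ` B)" if "a \<in> A" for a
    using bF[OF that] by (intro bdd_belowI2[of _ "-M"]) auto
  have bs: "bdd_above ((\<lambda>a. F a b) ` A)" if "b \<in> B" for b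
    using bF[OF _ that] by (intro bdd_aboveI2[of _ _ "M"]) auto
  have bsi: "bdd_above ((\<lambda>a. INF b\<in>B. F a b) ` A)"
  proof (rule bdd_aboveI2)
    fix a assume "a \<in> A"
    obtain b where "b \<in> B" using ne by auto
    then show "(INF b\<in>B. F a b) \<le> M"
      using cINF_lower[OF bi[OF \<open>a\<in>A\<close>] \<open>b \<in> B\<close>] bF[OF \<open>a\<in>A\<close> \<open>b\<in>B\<close>] by simp
  qed
  have bis: "bdd_below ((\<lambda>b. SUP a\<in>A. F a b) ` B)"
  proof (rule bdd_belowI2)
    fix b assume "b \<in> B"
    obtain a where "a \<in> A" using ne by auto
    then show "- M \<le> (SUP a\<in>A. F a b)"
      using cSUP_upper[OF \<open>a \<in> A\<close> bs[OF \<open>b\<in>B\<close>]] bF[OF \<open>a\<in>A\<close> \<open>b\<in>B\<close>] by simp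
  qed
  have 1: "(SUP a\<in>A. INF b\<in>B. F a b) \<le> (INF b\<in>B. SUP a\<in>A. F a b)"
    by (intro cSUP_least cINF_greatest ne order_trans[OF cINF_lower[OF bi] cSUP_upper[OF _ bs]])
  have 2: "c - e \<le> (SUP a\<in>A. INF b\<in>B. F a b)" if "e > 0" for e
  proof -
    obtain a where a: "a \<in> A" "\<forall>b\<in>B. c - e \<le> F a b" using av \<open>e > 0\<close> unfolding approx_value_def by meson
    then have "c - e \<le> (INF b\<in>B. F a b)" using ne by (intro cINF_greatest) auto
    also have "\<dots> \<le> (SUP a\<in>A. INF b\<in>B. F a b)" by (intro cSUP_upper a bsi)
    finally show ?thesis .
  qed
  have 3: "(INF b\<in>B. SUP a\<in>A. F a b) \<le> c + e" if "e > 0" for e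
  proof -
    obtain b where b: "b \<in> B" "\<forall>a\<in>A. F a b \<le> c + e" using av \<open>e > 0\<close> unfolding approx_value_def by meson
    have "(INF b\<in>B. SUP a\<in>A. F a b) \<le> (SUP a\<in>A. F a b)" by (intro cINF_lower b bis)
    also have "\<dots> \<le> c + e" using ne b by (intro cSUP_least) auto
    finally show ?thesis .
  qed
  have "c \<le> (SUP a\<in>A. INF b\<in>B. F a b)" by (rule field_le_epsilon) (use 2 in force)
  moreover have "(INF b\<in>B. SUP a\<in>A. F a b) \<le> c" by (rule field_le_epsilon) (use 3 in force)
  ultimately show ?thesis using 1 unfolding is_value_def by linarith
qed

lemma game_val_eqI:
  assumes "approx_value A B F c" and "\<And>a b. a \<in> A \<Longrightarrow> b \<in> B \<Longrightarrow> \<bar>F a b\<bar> \<le> M"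
  shows "game_val A B F = c"
  using approx_value_imp_is_value[OF assms] unfolding game_val_def is_value_def by (intro the_equality) auto

lemma approx_value_cong:
  assumes "\<And>a b. a \<in> A \<Longrightarrow> b \<in> B \<Longrightarrow> F a b = F' a b"
  shows "approx_value A B F c \<longleftrightarrow> approx_value A B F' c"
  using assms unfolding approx_value_def by simp

section \<open>The minimax theorem for continuous games on compact metric spaces\<close>

text \<open>Regret matching: the minimizing player weights the actions \<open>d\<close> proportionally to the positive
  part of the regret \<open>R t d\<close> for not having used \<open>d\<close> so far. The increments of \<open>R\<close> are then
  orthogonal to its positive part, so that \<open>R\<close> grows like the square root of the time.\<close>

lemma regret_matching:
  fixes F :: "'i \<Rightarrow> 'd \<Rightarrow> real"
  assumes D: "finite D" "D \<noteq> {}" and bd: "\<And>i d. d \<in> D \<Longrightarrow> \<bar>F i d\<bar> \<le> M" and "\<epsilon> > 0"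
    and best: "\<And>y. (\<And>d. d \<in> D \<Longrightarrow> 0 \<le> y d) \<Longrightarrow> sum y D = 1 \<Longrightarrow> \<exists>i. c \<le> (\<Sum>d\<in>D. y d * F i d)"
  shows "\<exists>T>0. \<exists>i. \<forall>d\<in>D. c - \<epsilon> \<le> (\<Sum>t<T. F (i t) d) / real T"
proof -
  define pos where "pos R d = max 0 (R d)" for R :: "'d \<Rightarrow> real" and d
  \<comment> \<open>If no regret is positive, any weights would do; the uniform ones keep
    \<open>Y\<close> a probability, and \<open>orth\<close> is then trivial because
    \<open>pos R\<close> vanishes on \<open>D\<close>.\<close>
  define Y where "Y R d = (if sum (pos R) D = 0 then 1 / real (card D) else pos R d / sum (pos R) D)" for R d
  define I where "I R = (SOME i. c \<le> (\<Sum>d\<in>D. Y R d * F i d))" for R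
  define r where "r R d = (\<Sum>d'\<in>D. Y R d' * F (I R) d') - F (I R) d" for R d
  define R where "R t = ((\<lambda>R d. R d + r R d) ^^ t) (\<lambda>_. 0)" for t
  have posnn: "0 \<le> pos R d" for R d by (simp add: pos_def)
  have sposnn: "0 \<le> sum (pos R) D" for R by (intro sum_nonneg posnn)
  have Y0: "0 \<le> Y R d" for R d by (simp add: Y_def posnn sposnn)
  have Y1: "sum (Y R) D = 1" for R
    using D by (cases "sum (pos R) D = 0") (simp_all add: Y_def flip: sum_divide_distrib)
  have I: "c \<le> (\<Sum>d\<in>D. Y R d * F (I R) d)" for R
    unfolding I_def by (rule someI_ex) (use best[of "Y R"] Y0 Y1 in blast)
  have avg: "\<bar>\<Sum>d'\<in>D. Y R d' * F i d'\<bar> \<le> M" for R i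
  proof -
    have "\<bar>\<Sum>d'\<in>D. Y R d' * F i d'\<bar> \<le> (\<Sum>d'\<in>D. \<bar>Y R d' * F i d'\<bar>)" by (rule sum_abs)
    also have "\<dots> \<le> (\<Sum>d'\<in>D. Y R d' * M)"
      by (intro sum_mono) (simp add: abs_mult Y0 bd mult_left_mono)
    also have "\<dots> = M" by (simp add: Y1 flip: sum_distrib_right)
    finally show ?thesis .
  qed
  have rb: "\<bar>r R d\<bar> \<le> 2 * M" if "d \<in> D" for R d
    using avg[of R "I R"] bd[OF that, of "I R"] by (simp add: r_def)
  have orth: "(\<Sum>d\<in>D. pos R d * r R d) = 0" for R
  proof (cases "sum (pos R) D = 0")
    case True
    then have "pos R d = 0" if "d \<in> D" for d using D posnn that by (simp add: sum_nonneg_eq_0_iff)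
    then show ?thesis by simp
  next
    case False
    then have *: "sum (pos R) D * Y R d = pos R d" for d by (simp add: Y_def)
    have "(\<Sum>d\<in>D. pos R d * r R d) = sum (pos R) D * (\<Sum>d\<in>D. Y R d * r R d)"
      unfolding sum_distrib_left by (intro sum.cong refl) (simp only: * flip: mult.assoc)
    also have "(\<Sum>d\<in>D. Y R d * r R d) = sum (Y R) D * (\<Sum>d\<in>D. Y R d * F (I R) d) - (\<Sum>d\<in>D. Y R d * F (I R) d)"
      by (simp add: r_def right_diff_distrib sum_subtractf sum_distrib_right)
    finally show ?thesis by (simp add: Y1)
  qed
  have RS: "R (Suc t) = (\<lambda>d. R t d + r (R t) d)" for t by (simp add: R_def)
  have pot: "(\<Sum>d\<in>D. (pos (R t) d)\<^sup>2) \<le> real t * (real (card D) * (2 * M)\<^sup>2)" for t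
  proof (induction t)
    case 0 then show ?case by (simp add: R_def pos_def)
  next
    case (Suc t)
    have 1: "(pos (R (Suc t)) d)\<^sup>2 \<le> (pos (R t) d)\<^sup>2 + 2 * (pos (R t) d * r (R t) d) + (2 * M)\<^sup>2" if "d \<in> D" for d
    proof -
      \<comment> \<open>If the new regret is nonpositive the left-hand side is 0; otherwise it is
        the square of \<open>R t d + r (R t) d\<close>, which is at most
        \<open>pos (R t) d + r (R t) d\<close>. Summed over \<open>d\<close>, the cross terms vanish
        by \<open>orth\<close>.\<close>
      have "(pos (R (Suc t)) d)\<^sup>2 \<le> (pos (R t) d + r (R t) d)\<^sup>2"
        by (cases "R t d + r (R t) d \<le> 0") (auto simp: pos_def RS intro: power_mono)
      also have "\<dots> = (pos (R t) d)\<^sup>2 + 2 * (pos (R t) d * r (R t) d) + (r (R t) d)\<^sup>2"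
        by (simp add: power2_eq_square algebra_simps)
      also have "(r (R t) d)\<^sup>2 \<le> (2 * M)\<^sup>2" using rb[OF that, of "R t"] by (metis abs_ge_zero power2_abs power_mono)
      finally show ?thesis by simp
    qed
    have "(\<Sum>d\<in>D. (pos (R (Suc t)) d)\<^sup>2) \<le> (\<Sum>d\<in>D. (pos (R t) d)\<^sup>2 + 2 * (pos (R t) d * r (R t) d) + (2 * M)\<^sup>2)"
      by (intro sum_mono 1)
    also have "\<dots> = (\<Sum>d\<in>D. (pos (R t) d)\<^sup>2) + real (card D) * (2 * M)\<^sup>2"
      by (simp add: sum.distrib orth flip: sum_distrib_left)
    also have "\<dots> \<le> real (Suc t) * (real (card D) * (2 * M)\<^sup>2)" using Suc by (simp add: algebra_simps)
    finally show ?case .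
  qed
  \<comment> \<open>In each round the mixed payoff is at least \<open>c\<close> by the choice of the
    reply \<open>I\<close>. So a small regret for \<open>d\<close> forces the replies to earn almost
    \<open>c\<close> per round against \<open>d\<close>.\<close>
  have Rlb: "real t * c - (\<Sum>s<t. F (I (R s)) d) \<le> R t d" for t d
  proof (induction t)
    case 0 then show ?case by (simp add: R_def)
  next
    case (Suc t) then show ?case using I[of "R t"] by (simp add: RS r_def algebra_simps)
  qed
  define B where "B = real (card D) * (2 * M)\<^sup>2"
  \<comment> \<open>Regrets are at most \<open>sqrt (T * B)\<close> after \<open>T\<close> rounds;
    this \<open>T\<close> brings that below \<open>T * \<epsilon>\<close>.\<close>
  obtain T where T: "B / \<epsilon>\<^sup>2 < real T" using reals_Archimedean2 by blast
  have B0: "0 \<le> B" by (simp add: B_def)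
  have Tpos: "T > 0" using T divide_nonneg_nonneg[OF B0 zero_le_power2[of \<epsilon>]] by (intro gr0I) auto
  show ?thesis
  proof (intro exI[of _ T] conjI Tpos exI[of _ "\<lambda>t. I (R t)"] ballI)
    fix d assume d: "d \<in> D"
    have "(pos (R T) d)\<^sup>2 \<le> (\<Sum>d\<in>D. (pos (R T) d)\<^sup>2)"
      using D d by (intro member_le_sum) auto
    also have "\<dots> \<le> real T * B" using pot[of T] by (simp add: B_def)
    also have "\<dots> \<le> real T * (real T * \<epsilon>\<^sup>2)"
      using T \<open>\<epsilon> > 0\<close> by (intro mult_left_mono) (auto simp: field_simps)
    also have "\<dots> = (real T * \<epsilon>)\<^sup>2" by (simp add: power2_eq_square)
    finally have "pos (R T) d \<le> real T * \<epsilon>" by (rule power2_le_imp_le) (use \<open>\<epsilon> > 0\<close> in simp)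
    then have "R T d \<le> real T * \<epsilon>" by (simp add: pos_def)
    then show "c - \<epsilon> \<le> (\<Sum>t<T. F (I (R t)) d) / real T"
      using Rlb[of T d] Tpos by (simp add: field_simps)
  qed
qed

section \<open>Finitely supported mixed actions; measurability and integration on compact action
  spaces\<close>

definition finite_mixture :: "'a set \<Rightarrow> ('a \<Rightarrow> real) \<Rightarrow> ('a \<Rightarrow> 'b::topological_space) \<Rightarrow> 'b measure" where
  "finite_mixture A p f = distr (point_measure A (\<lambda>a. ennreal (p a))) borel f"

lemma
  fixes f :: "'a \<Rightarrow> 'b::topological_space"
  assumes "finite A" "\<And>a. a \<in> A \<Longrightarrow> 0 \<le> p a" "sum p A = 1"
  shows finite_mixture_in_Delta: "finite_mixture A p f \<in> Delta"
    and integral_finite_mixture: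
      "h \<in> borel_measurable borel \<Longrightarrow> (\<integral>b. h b \<partial>finite_mixture A p f) = (\<Sum>a\<in>A. p a * (h (f a) :: real))"
proof -
  have m: "f \<in> measurable (point_measure A (\<lambda>a. ennreal (p a))) borel" by simp
  have "prob_space (point_measure A (\<lambda>a. ennreal (p a)))"
    using assms by (intro prob_spaceI) (simp add: space_point_measure emeasure_point_measure_finite sum_ennreal)
  then show "finite_mixture A p f \<in> Delta"
    unfolding finite_mixture_def Delta_def space_prob_algebra using m by (auto intro: prob_space.prob_space_distr)
  show "(\<integral>b. h b \<partial>finite_mixture A p f) = (\<Sum>a\<in>A. p a * h (f a))" if "h \<in> borel_measurable borel"
    unfolding finite_mixture_def
    using assms that m by (simp add: integral_distr lebesgue_integral_point_measure_finite)
qed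

lemma DeltaD:
  assumes "x \<in> Delta" shows "prob_space x" "sets x = sets borel" "space x = UNIV"
  using assms sets_eq_imp_space_eq[of x borel] by (auto simp: Delta_def space_prob_algebra)

lemma return_in_Delta: "return borel a \<in> Delta"
  by (simp add: Delta_def space_prob_algebra prob_space_return)

lemma compact_finite_net:
  assumes "compact (UNIV :: 'a::metric_space set)" "e > 0"
  shows "\<exists>D :: 'a::metric_space set. finite D \<and> D \<noteq> {} \<and> (\<forall>a. \<exists>d\<in>D. dist d a < e)"
proof -
  obtain D :: "'a set" where "finite D" "UNIV \<subseteq> (\<Union>x\<in>D. ball x e)"
    using compact_eq_totally_bounded[of "UNIV :: 'a set"] assms by auto
  then show ?thesis by (intro exI[of _ D]) (fastforce simp: subset_iff)
qed

text \<open>\<open>mixed_ext\<close> integrates over the product sigma-algebra, whereas continuity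
  gives measurability for the Borel sets of the product topology. No second countability is assumed
  of the action types; compactness supplies it, since the finite nets for the radii
  \<open>1 / (n + 1)\<close> yield countably many rectangles that exhaust every open set from
  inside.\<close>

lemma sets_borel_pair_compact:
  assumes cI: "compact (UNIV :: 'i::metric_space set)" and cJ: "compact (UNIV :: 'j::metric_space set)"
  shows "sets ((borel :: 'i measure) \<Otimes>\<^sub>M (borel :: 'j measure)) = sets borel"
proof
  show "sets ((borel :: 'i measure) \<Otimes>\<^sub>M (borel :: 'j measure)) \<subseteq> sets borel"
  proof -
    have "id \<in> measurable borel ((borel :: 'i measure) \<Otimes>\<^sub>M (borel :: 'j measure))"
      by (intro measurable_pair) (auto intro!: borel_measurable_continuous_onI continuous_intros simp: comp_def)
    from measurable_sets[OF this] show ?thesis by auto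
  qed
next
  have "\<exists>D :: 'i set. finite D \<and> (\<forall>a. \<exists>d\<in>D. dist d a < 1 / real (Suc n))" for n
    using compact_finite_net[OF cI, of "1 / real (Suc n)"] by auto
  then obtain DI where DI: "\<And>n. finite (DI n)" "\<And>n (a::'i). \<exists>d\<in>DI n. dist d a < 1 / real (Suc n)" by metis
  have "\<exists>D :: 'j set. finite D \<and> (\<forall>a. \<exists>d\<in>D. dist d a < 1 / real (Suc n))" for n
    using compact_finite_net[OF cJ, of "1 / real (Suc n)"] by auto
  then obtain DJ where DJ: "\<And>n. finite (DJ n)" "\<And>n (a::'j). \<exists>d\<in>DJ n. dist d a < 1 / real (Suc n)" by metis
  have op: "U \<in> sets (borel \<Otimes>\<^sub>M borel)" if "open U" for U :: "('i \<times> 'j) set"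
  proof -
    let ?R = "\<lambda>n a b. ball a (1 / real (Suc n)) \<times> ball b (1 / real (Suc n))"
    define S where "S = (\<Union>n. \<Union>a\<in>DI n. \<Union>b\<in>DJ n. if ?R n a b \<subseteq> U then ?R n a b else {})"
    have "S \<in> sets (borel \<Otimes>\<^sub>M borel)"
      unfolding S_def using DI(1) DJ(1)
      by (intro sets.countable_UN'' sets.finite_UN) (auto intro!: pair_measureI)
    moreover have "S = U"
    proof
      show "S \<subseteq> U" by (auto simp: S_def split: if_splits)
      show "U \<subseteq> S"
      proof
        fix p assume "p \<in> U"
        then obtain A B where AB: "open A" "open B" "p \<in> A \<times> B" "A \<times> B \<subseteq> U"
          using \<open>open U\<close> by (elim open_prod_elim)
        obtain eA where eA: "eA > 0" "ball (fst p) eA \<subseteq> A" using AB openE by (metis mem_Times_iff)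
        obtain eB where eB: "eB > 0" "ball (snd p) eB \<subseteq> B" using AB openE by (metis mem_Times_iff)
        \<comment> \<open>Half of the margin: a ball of this radius around a net point that contains
          a coordinate of \<open>p\<close> stays within twice the radius of that coordinate.\<close>
        obtain n where n: "1 / real (Suc n) < min eA eB / 2"
          using eA eB nat_approx_posE[of "min eA eB / 2"] by auto
        obtain a where a: "a \<in> DI n" "dist a (fst p) < 1 / real (Suc n)" using DI by blast
        obtain b where b: "b \<in> DJ n" "dist b (snd p) < 1 / real (Suc n)" using DJ by blast
        have "ball a (1 / real (Suc n)) \<subseteq> ball (fst p) eA"
        proof
          fix x assume "x \<in> ball a (1 / real (Suc n))"
          then show "x \<in> ball (fst p) eA" using a n dist_triangle3[of "fst p" x a] by auto
        qed
        moreover have "ball b (1 / real (Suc n)) \<subseteq> ball (snd p) eB"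
        proof
          fix x assume "x \<in> ball b (1 / real (Suc n))"
          then show "x \<in> ball (snd p) eB" using b n dist_triangle3[of "snd p" x b] by auto
        qed
        ultimately have "?R n a b \<subseteq> U" using eA eB AB by blast
        moreover have "p \<in> ?R n a b" using a b by (simp add: mem_Times_iff)
        ultimately show "p \<in> S" using a b unfolding S_def by (auto intro!: exI[of _ n])
      qed
    qed
    ultimately show ?thesis by simp
  qed
  have "id \<in> measurable ((borel :: 'i measure) \<Otimes>\<^sub>M (borel :: 'j measure)) borel"
    by (rule borel_measurableI) (use op in \<open>auto simp: space_pair_measure\<close>)
  from measurable_sets[OF this]
  show "sets borel \<subseteq> sets ((borel :: 'i measure) \<Otimes>\<^sub>M (borel :: 'j measure))"
    by (auto simp: space_pair_measure)
qed

lemma continuous_pair_measurable: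
  fixes F :: "'i::metric_space \<Rightarrow> 'j::metric_space \<Rightarrow> 'b::topological_space"
  assumes "compact (UNIV :: 'i set)" "compact (UNIV :: 'j set)" "continuous_on UNIV (\<lambda>(i, j). F i j)"
  shows "(\<lambda>p. F (fst p) (snd p)) \<in> borel_measurable (borel \<Otimes>\<^sub>M borel)"
  using borel_measurable_continuous_onI[OF assms(3)]
  by (simp add: split_beta' measurable_cong_sets[OF sets_borel_pair_compact[OF assms(1,2)]])

lemma continuous_compact_bounded:
  fixes F :: "'i::metric_space \<Rightarrow> 'j::metric_space \<Rightarrow> 'b::real_normed_vector"
  assumes "compact (UNIV :: 'i set)" "compact (UNIV :: 'j set)" "continuous_on UNIV (\<lambda>(i, j). F i j)"
  obtains M where "M \<ge> 0" "\<And>i j. norm (F i j) \<le> M"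
proof -
  have "compact ((UNIV :: 'i set) \<times> (UNIV :: 'j set))" by (intro compact_Times assms)
  then have "bounded ((\<lambda>(i, j). F i j) ` UNIV)"
    using assms(3) by (metis UNIV_Times_UNIV compact_continuous_image compact_imp_bounded)
  then obtain M where "\<And>i j. norm (F i j) \<le> M" by (auto simp: bounded_iff)
  then show ?thesis using that[of "max 0 M"] by (meson max.cobounded1 max.coboundedI2)
qed

lemma continuous_compact_uniform:
  fixes F :: "'i::metric_space \<Rightarrow> 'j::metric_space \<Rightarrow> 'b::metric_space"
  assumes "compact (UNIV :: 'i set)" "compact (UNIV :: 'j set)" "continuous_on UNIV (\<lambda>(i, j). F i j)" "e > 0"
  obtains d where "d > 0" "\<And>i j j'. dist j j' < d \<Longrightarrow> dist (F i j) (F i j') < e"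
proof -
  have "compact ((UNIV :: 'i set) \<times> (UNIV :: 'j set))" by (intro compact_Times assms)
  then have "uniformly_continuous_on UNIV (\<lambda>(i, j). F i j)"
    using assms(3) compact_uniformly_continuous by (metis UNIV_Times_UNIV)
  then obtain d where d: "d > 0" "\<And>p p'. dist p' p < d \<Longrightarrow> dist (case p' of (i, j) \<Rightarrow> F i j) (case p of (i, j) \<Rightarrow> F i j) < e"
    using \<open>e > 0\<close> unfolding uniformly_continuous_on_def by (meson UNIV_I)
  show ?thesis
  proof (rule that[OF d(1)])
    show "dist (F i j) (F i j') < e" if "dist j j' < d" for i j j'
      using d(2)[of "(i, j)" "(i, j')"] that by (simp add: dist_Pair_Pair)
  qed
qed

lemma
  fixes F :: "'i::topological_space \<Rightarrow> 'j::topological_space \<Rightarrow> 'b::{banach, second_countable_topology}"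
  assumes m: "(\<lambda>p. F (fst p) (snd p)) \<in> borel_measurable (borel \<Otimes>\<^sub>M borel)"
    and bd: "\<And>i j. norm (F i j) \<le> M" and x: "x \<in> Delta" and y: "y \<in> Delta"
  shows integrable_mixed: "integrable (x \<Otimes>\<^sub>M y) (\<lambda>p. F (fst p) (snd p))"
    and mixed_ext_fst: "mixed_ext F x y = (\<integral>i. \<integral>j. F i j \<partial>y \<partial>x)"
    and mixed_ext_snd: "mixed_ext F x y = (\<integral>j. \<integral>i. F i j \<partial>x \<partial>y)"
    and integrable_mixed_fst: "integrable x (\<lambda>i. \<integral>j. F i j \<partial>y)"
    and integrable_mixed_snd: "integrable y (\<lambda>j. \<integral>i. F i j \<partial>x)"
proof -
  interpret x: prob_space x by (rule DeltaD[OF x])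
  interpret y: prob_space y by (rule DeltaD[OF y])
  interpret xy: pair_prob_space x y ..
  have m': "(\<lambda>p. F (fst p) (snd p)) \<in> borel_measurable (x \<Otimes>\<^sub>M y)"
    using m by (simp add: measurable_cong_sets[OF sets_pair_measure_cong[OF DeltaD(2)[OF x] DeltaD(2)[OF y]]])
  show *: "integrable (x \<Otimes>\<^sub>M y) (\<lambda>p. F (fst p) (snd p))"
    by (intro xy.integrable_const_bound[of _ M] m') (simp add: bd)
  then have **: "integrable (x \<Otimes>\<^sub>M y) (\<lambda>(i, j). F i j)" by (simp add: split_beta')
  show "mixed_ext F x y = (\<integral>i. \<integral>j. F i j \<partial>y \<partial>x)"
    using xy.integral_fst'[OF *] by (simp add: mixed_ext_def)
  show "mixed_ext F x y = (\<integral>j. \<integral>i. F i j \<partial>x \<partial>y)"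
    using xy.integral_snd[OF **] by (simp add: mixed_ext_def split_beta')
  show "integrable x (\<lambda>i. \<integral>j. F i j \<partial>y)" using xy.integrable_fst'[OF *] by simp
  show "integrable y (\<lambda>j. \<integral>i. F i j \<partial>x)" using xy.integrable_snd[OF **] by simp
qed

lemma mixed_ext_bound:
  fixes F :: "'i::topological_space \<Rightarrow> 'j::topological_space \<Rightarrow> 'b::{banach, second_countable_topology}"
  assumes "(\<lambda>p. F (fst p) (snd p)) \<in> borel_measurable (borel \<Otimes>\<^sub>M borel)"
    and bd: "\<And>i j. norm (F i j) \<le> M" and x: "x \<in> Delta" and y: "y \<in> Delta"
  shows "norm (mixed_ext F x y) \<le> M"
proof -
  interpret x: prob_space x by (rule DeltaD[OF x])
  interpret y: prob_space y by (rule DeltaD[OF y])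
  interpret xy: pair_prob_space x y ..
  have "norm (mixed_ext F x y) \<le> (\<integral>p. norm (F (fst p) (snd p)) \<partial>(x \<Otimes>\<^sub>M y))"
    unfolding mixed_ext_def by (rule integral_norm_bound)
  also have "\<dots> \<le> (\<integral>p. M \<partial>(x \<Otimes>\<^sub>M y))"
    by (intro integral_mono integrable_norm integrable_mixed[OF assms]) (auto simp: bd)
  finally show ?thesis by (simp add: xy.prob_space)
qed

text \<open>\<open>c\<close> is the best level that the maximizing player can guarantee against pure
  actions, so its lower half holds by construction. If the other player could not hold the payoff
  below \<open>c + e\<close> with weights on a fine net, regret matching would produce a mixed
  action guaranteeing more than \<open>c\<close>.\<close>

lemma minimax_compact:
  fixes F :: "'i::metric_space \<Rightarrow> 'j::metric_space \<Rightarrow> real"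
  assumes cI: "compact (UNIV :: 'i set)" and cJ: "compact (UNIV :: 'j set)"
    and cont: "continuous_on UNIV (\<lambda>(i, j). F i j)"
  shows "\<exists>c. approx_value Delta Delta (mixed_ext F) c"
proof -
  obtain M where M: "\<And>i j. norm (F i j) \<le> M" by (rule continuous_compact_bounded[OF assms]) blast
  note meas = continuous_pair_measurable[OF assms]
  have mi: "(\<lambda>i. F i j) \<in> borel_measurable borel" for j
    by (intro borel_measurable_continuous_onI continuous_on_compose2[OF cont, of UNIV "\<lambda>i. (i, j)", simplified] continuous_intros)
  have mj: "(\<lambda>j. F i j) \<in> borel_measurable borel" for i
    by (intro borel_measurable_continuous_onI continuous_on_compose2[OF cont, of UNIV "\<lambda>j. (i, j)", simplified] continuous_intros)
  have intb: "\<bar>\<integral>i. F i j \<partial>x\<bar> \<le> M" if x: "x \<in> Delta" for x j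
  proof -
    interpret x: prob_space x by (rule DeltaD[OF x])
    have int: "integrable x (\<lambda>i. F i j)"
      using M mi by (intro x.integrable_const_bound[of _ M]) (auto simp: measurable_cong_sets[OF DeltaD(2)[OF x]])
    have "norm (\<integral>i. F i j \<partial>x) \<le> (\<integral>i. norm (F i j) \<partial>x)" by (rule integral_norm_bound)
    also have "\<dots> \<le> (\<integral>i. M \<partial>x)" using M by (intro integral_mono int integrable_norm) auto
    finally show ?thesis by (simp add: x.prob_space)
  qed
  define L where "L = {a. \<exists>x\<in>Delta. \<forall>j. a \<le> (\<integral>i. F i j \<partial>x)}"
  define c where "c = Sup L"
  have "return borel undefined \<in> (Delta :: 'i measure set)" by (rule return_in_Delta)
  then have ne: "-M \<in> L" using intb unfolding L_def mem_Collect_eq by (metis abs_le_D2 minus_le_iff)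
  have bdd: "bdd_above L"
  proof (rule bdd_aboveI)
    fix a assume "a \<in> L"
    then show "a \<le> M" unfolding L_def mem_Collect_eq using intb by (meson abs_le_D1 order_trans)
  qed
  have lower: "\<exists>x\<in>Delta. \<forall>y\<in>Delta. c - e \<le> mixed_ext F x y" if "e > 0" for e
  proof -
    have "c - e < Sup L" using that by (simp add: c_def)
    then obtain a where "a \<in> L" "c - e < a" using ne less_cSup_iff[OF _ bdd] by blast
    then obtain x where x: "x \<in> Delta" "\<And>j. c - e \<le> (\<integral>i. F i j \<partial>x)"
    unfolding L_def by (auto intro: order_trans[OF less_imp_le])
    have "c - e \<le> mixed_ext F x y" if y: "y \<in> Delta" for y
    proof -
      interpret y: prob_space y by (rule DeltaD[OF y])
      have "c - e = (\<integral>j. c - e \<partial>y)" by (simp add: y.prob_space)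
      also have "\<dots> \<le> (\<integral>j. \<integral>i. F i j \<partial>x \<partial>y)"
        by (intro integral_mono integrable_mixed_snd[OF meas M] x y) auto
      finally show ?thesis by (simp add: mixed_ext_snd[OF meas M x(1) y])
    qed
    then show ?thesis using x by blast
  qed
  have upper: "\<exists>y\<in>Delta. \<forall>x\<in>Delta. mixed_ext F x y \<le> c + e" if e: "e > 0" for e
  proof -
    obtain d where d: "d > 0" "\<And>i j j'. dist j j' < d \<Longrightarrow> dist (F i j) (F i j') < e / 4"
      using continuous_compact_uniform[OF assms, of "e/4"] e by auto
    obtain D :: "'j set" where D: "finite D" "D \<noteq> {}" "\<forall>j. \<exists>j'\<in>D. dist j' j < d"
      using compact_finite_net[OF cJ d(1)] by blast
    \<comment> \<open>The error budget: regret matching loses \<open>e / 4\<close>, and passing from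
      the net \<open>D\<close> to arbitrary actions loses another \<open>e / 4\<close>, so that a
      level strictly above \<open>c\<close> survives.\<close>
    have "\<exists>y. (\<forall>d\<in>D. 0 \<le> y d) \<and> sum y D = 1 \<and> (\<forall>i. (\<Sum>d\<in>D. y d * F i d) < c + e)"
    proof (rule ccontr)
      assume "\<not> ?thesis"
      then have "\<exists>i. c + e \<le> (\<Sum>d\<in>D. y d * F i d)" if "\<And>d. d \<in> D \<Longrightarrow> 0 \<le> y d" "sum y D = 1" for y
        using that by (metis linorder_not_le)
      then obtain T i where T: "T > 0" "\<forall>d\<in>D. c + e - e / 4 \<le> (\<Sum>t<T. F (i t) d) / real T"
        using regret_matching[OF D(1,2), of F M "e/4" "c + e"] M e by auto
      \<comment> \<open>The empirical distribution of the replies: each of the \<open>T\<close>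
        rounds has mass \<open>1 / T\<close>, so its payoff against \<open>j\<close> is the time
        average.\<close>
      define x where "x = finite_mixture {..<T} (\<lambda>_. 1 / real T) i"
      have x: "x \<in> Delta" unfolding x_def using T by (intro finite_mixture_in_Delta) auto
      have xi: "(\<integral>i. F i j \<partial>x) = (\<Sum>t<T. F (i t) j) / real T" for j
        unfolding x_def using T mi by (subst integral_finite_mixture) (auto simp: sum_divide_distrib)
      have "c + e / 4 \<le> (\<integral>i. F i j \<partial>x)" for j
      proof -
        obtain j' where j': "j' \<in> D" "dist j' j < d" using D by blast
        have "F (i t) j' \<le> F (i t) j + e / 4" for t
          using d(2)[OF j'(2), of "i t"] unfolding dist_real_def by linarith
        then have "(\<Sum>t<T. F (i t) j') \<le> (\<Sum>t<T. F (i t) j + e / 4)"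
          by (intro sum_mono)
        also have "\<dots> = (\<Sum>t<T. F (i t) j) + real T * (e / 4)" by (simp add: sum.distrib)
        finally have "(\<Sum>t<T. F (i t) j') \<le> (\<Sum>t<T. F (i t) j) + real T * (e / 4)" .
        then have "(\<Sum>t<T. F (i t) j') / real T \<le> (\<Sum>t<T. F (i t) j) / real T + e / 4"
          using T(1) by (simp add: field_simps)
        then show ?thesis using T(2) j'(1) xi e by fastforce
      qed
      then have "c + e / 4 \<in> L" using x unfolding L_def by blast
      then have "c + e / 4 \<le> c" unfolding c_def by (intro cSup_upper bdd)
      then show False using e by simp
    qed
    then obtain y where y: "\<And>d. d \<in> D \<Longrightarrow> 0 \<le> y d" "sum y D = 1" "\<And>i. (\<Sum>d\<in>D. y d * F i d) < c + e"
      by auto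
    define \<eta> where "\<eta> = finite_mixture D y id"
    have eta: "\<eta> \<in> Delta" unfolding \<eta>_def by (intro finite_mixture_in_Delta D y)
    have "mixed_ext F x \<eta> \<le> c + e" if x: "x \<in> Delta" for x
    proof -
      interpret x: prob_space x by (rule DeltaD[OF x])
      have "mixed_ext F x \<eta> = (\<integral>i. \<integral>j. F i j \<partial>\<eta> \<partial>x)" by (rule mixed_ext_fst[OF meas M x eta])
      also have "\<dots> \<le> (\<integral>i. c + e \<partial>x)"
        by (intro integral_mono integrable_mixed_fst[OF meas M x eta])
           (use y D mj less_imp_le[OF y(3)] in \<open>auto simp: \<eta>_def integral_finite_mixture\<close>)
      finally show ?thesis by (simp add: x.prob_space)
    qed
    then show ?thesis using eta by blast
  qed
  show ?thesis unfolding approx_value_def using lower upper by blast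
qed

section \<open>The exponential of a rate matrix\<close>

abbreviation matpow :: "real^'w^'w::finite \<Rightarrow> nat \<Rightarrow> real^'w^'w" where
  "matpow A n \<equiv> ((**) A ^^ n) (mat 1)"

text \<open>A bound on the operator norm for the maximum norm. It is submultiplicative and the
  identity has norm 1, so the estimates of the exponential below are free of the dimension.\<close>

definition row_bounded :: "real \<Rightarrow> real^'w^'w::finite \<Rightarrow> bool" where
  "row_bounded c A \<longleftrightarrow> (\<forall>\<omega>. (\<Sum>z\<in>UNIV. \<bar>A $ \<omega> $ z\<bar>) \<le> c)"

lemma row_bounded_nonneg: "row_bounded c A \<Longrightarrow> 0 \<le> c"
  unfolding row_bounded_def by (meson abs_ge_zero order_trans sum_nonneg)

lemma row_bounded_mult:
  assumes "row_bounded c A" "row_bounded d B"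
  shows "row_bounded (c * d) (A ** B)"
  unfolding row_bounded_def
proof
  fix \<omega>
  have "(\<Sum>z\<in>UNIV. \<bar>(A ** B) $ \<omega> $ z\<bar>) \<le> (\<Sum>z\<in>UNIV. \<Sum>l\<in>UNIV. \<bar>A $ \<omega> $ l\<bar> * \<bar>B $ l $ z\<bar>)"
    unfolding matrix_matrix_mult_def by (intro sum_mono) (auto simp: abs_mult intro!: sum_abs[THEN order_trans])
  also have "\<dots> = (\<Sum>l\<in>UNIV. \<bar>A $ \<omega> $ l\<bar> * (\<Sum>z\<in>UNIV. \<bar>B $ l $ z\<bar>))"
    by (subst sum.swap) (simp add: sum_distrib_left)
  also have "\<dots> \<le> (\<Sum>l\<in>UNIV. \<bar>A $ \<omega> $ l\<bar> * d)"
    using assms(2) by (intro sum_mono mult_left_mono) (auto simp: row_bounded_def)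
  also have "\<dots> \<le> c * d"
    using assms row_bounded_nonneg[OF assms(2)]
    by (simp add: row_bounded_def mult_right_mono flip: sum_distrib_right)
  finally show "(\<Sum>z\<in>UNIV. \<bar>(A ** B) $ \<omega> $ z\<bar>) \<le> c * d" .
qed

lemma row_bounded_matpow: "row_bounded c A \<Longrightarrow> row_bounded (c ^ n) (matpow A n)"
proof (induction n)
  case 0
  have "(\<Sum>z\<in>UNIV. \<bar>if \<omega> = z then 1 else 0\<bar> :: real) = (1 :: real)" for \<omega> :: 'a
  proof -
    have "(\<Sum>z\<in>UNIV. \<bar>if \<omega> = z then 1 else 0\<bar> :: real) = (\<Sum>z\<in>UNIV. if \<omega> = z then 1 else 0)"
      by (intro sum.cong) auto
    then show ?thesis by simp
  qed
  then show ?case by (simp add: row_bounded_def mat_def)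
next
  case (Suc n) then show ?case by (simp add: row_bounded_mult)
qed

lemma row_bounded_entry: "row_bounded c A \<Longrightarrow> \<bar>A $ \<omega> $ z\<bar> \<le> c"
proof -
  assume "row_bounded c A"
  moreover have "\<bar>A $ \<omega> $ z\<bar> \<le> (\<Sum>z\<in>UNIV. \<bar>A $ \<omega> $ z\<bar>)" by (rule member_le_sum) auto
  ultimately show ?thesis unfolding row_bounded_def by (meson order_trans)
qed

lemma row_bounded_norm: "row_bounded (real CARD('w) * norm A) (A :: real^'w^'w::finite)"
proof -
  have "\<bar>A $ \<omega> $ z\<bar> \<le> norm A" for \<omega> z
    by (rule order_trans[OF component_le_norm_cart Finite_Cartesian_Product.norm_nth_le])
  then show ?thesis unfolding row_bounded_def by (intro allI sum_bounded_above) auto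
qed

lemma matpow_entry_le: "row_bounded c A \<Longrightarrow> \<bar>matpow A n $ \<omega> $ z\<bar> \<le> c ^ n"
  by (rule row_bounded_entry[OF row_bounded_matpow])

lemma norm_matrix_le:
  fixes A :: "real^'w^'w::finite"
  assumes "\<And>\<omega> z. \<bar>A $ \<omega> $ z\<bar> \<le> c"
  shows "norm A \<le> real CARD('w) * (real CARD('w) * c)"
proof -
  have "norm A \<le> (\<Sum>\<omega>\<in>UNIV. norm (A $ \<omega>))" unfolding norm_vec_def by (rule L2_set_le_sum) auto
  also have "\<dots> \<le> (\<Sum>\<omega>\<in>UNIV. \<Sum>z\<in>UNIV. \<bar>A $ \<omega> $ z\<bar>)"
    by (intro sum_mono norm_le_l1_cart)
  also have "\<dots> \<le> (\<Sum>\<omega>\<in>(UNIV::'w set). \<Sum>z\<in>(UNIV::'w set). c)" by (intro sum_mono assms)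
  finally show ?thesis by simp
qed

lemma norm_exp_term_le:
  fixes A :: "real^'w^'w::finite"
  assumes "row_bounded c A"
  shows "norm ((1 / fact n) *\<^sub>R matpow A n) \<le> (real CARD('w))\<^sup>2 * (c ^ n / fact n)"
  using norm_matrix_le[OF matpow_entry_le[OF assms], of n]
  by (simp add: power2_eq_square field_simps)

lemma summable_exp_bound: "summable (\<lambda>n. K * (c ^ n / fact n :: real))"
  using summable_mult[OF summable_exp[of c], of K] by (simp add: field_simps)

lemma summable_matrix_exp: "summable (\<lambda>n. (1 / fact n) *\<^sub>R matpow A n)"
  using norm_exp_term_le[OF row_bounded_norm] summable_exp_bound by (rule summable_comparison_test'[rotated])

lemma matrix_exp_entry_sums:
  "(\<lambda>n. matpow A n $ \<omega> $ z / fact n) sums (matrix_exp A $ \<omega> $ z)"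
proof -
  have "bounded_linear (\<lambda>A :: real^'a^'a. A $ \<omega> $ z)"
    by (rule bounded_linear_compose[OF bounded_linear_vec_nth bounded_linear_vec_nth])
  from bounded_linear.sums[OF this summable_sums[OF summable_matrix_exp, of A]]
  show ?thesis by (simp add: matrix_exp_def)
qed

lemma sum_vec_mat1: "(\<Sum>z\<in>UNIV. (mat 1 :: real^'w^'w::finite) $ \<omega> $ z * a z) = a \<omega>"
  by (simp add: mat_def if_distrib[of "\<lambda>x. x * _"] cong: if_cong)

text \<open>\<open>A\<close> annihilates constant vectors, hence so does every positive power of
  \<open>A\<close>.\<close>

lemma matpow_row_sum:
  assumes "\<And>\<omega>. (\<Sum>z\<in>UNIV. A $ \<omega> $ z) = 0"
  shows "(\<Sum>z\<in>UNIV. matpow A n $ \<omega> $ z) = (if n = 0 then 1 else 0)"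
proof (induction n arbitrary: \<omega>)
  case 0 then show ?case using sum_vec_mat1[of \<omega> "\<lambda>_. 1"] by simp
next
  case (Suc n)
  have "(\<Sum>z\<in>UNIV. matpow A (Suc n) $ \<omega> $ z) = (\<Sum>z\<in>UNIV. \<Sum>l\<in>UNIV. A $ \<omega> $ l * matpow A n $ l $ z)"
    by (simp add: matrix_matrix_mult_def)
  also have "\<dots> = (\<Sum>l\<in>UNIV. A $ \<omega> $ l * (\<Sum>z\<in>UNIV. matpow A n $ l $ z))"
    by (subst sum.swap) (simp add: sum_distrib_left)
  also have "\<dots> = 0" using assms by (simp add: Suc flip: sum_distrib_right)
  finally show ?case by simp
qed

lemma matrix_exp_row_sum:
  assumes "\<And>\<omega>. (\<Sum>z\<in>UNIV. A $ \<omega> $ z) = 0"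
  shows "(\<Sum>z\<in>UNIV. matrix_exp A $ \<omega> $ z) = 1"
proof -
  have "(\<lambda>n. \<Sum>z\<in>UNIV. matpow A n $ \<omega> $ z / fact n) sums (\<Sum>z\<in>UNIV. matrix_exp A $ \<omega> $ z)"
    by (intro sums_sum matrix_exp_entry_sums)
  moreover have "(\<lambda>n. \<Sum>z\<in>UNIV. matpow A n $ \<omega> $ z / fact n) = (\<lambda>n. if n = 0 then 1 else 0)"
    by (simp add: fun_eq_iff matpow_row_sum[OF assms] flip: sum_divide_distrib)
  ultimately show ?thesis using sums_If_finite[of "\<lambda>n. n = 0" "\<lambda>_. 1 :: real"] sums_unique2 by fastforce
qed

text \<open>The matrix \<open>exp \<lambda> \<cdot> matrix_exp A = matrix_exp (A + \<lambda> I)\<close> is the sum of a series of nonnegative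
  matrices \<open>C k\<close> with \<open>(k + 1) C (k + 1) = (A + \<lambda> I) C k\<close>.\<close>

lemma matrix_exp_nonneg:
  fixes A :: "real^'w^'w::finite"
  assumes off: "\<And>\<omega> z. z \<noteq> \<omega> \<Longrightarrow> 0 \<le> A $ \<omega> $ z"
  shows "0 \<le> matrix_exp A $ \<omega> $ z"
proof -
  \<comment> \<open>Any number dominating the entries of \<open>A\<close> would do: it makes the
    diagonal of \<open>A + l I\<close> nonnegative, and the same number bounds the powers in
    \<open>sa\<close>.\<close>
  define l where "l = real CARD('w) * norm A"
  define a where "a \<omega> z i = matpow A i $ \<omega> $ z / fact i" for \<omega> z i
  define b where "b j = l ^ j / fact j" for j
  define C where "C k \<omega> z = (\<Sum>i\<le>k. a \<omega> z i * b (k - i))" for k \<omega> z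
  have diag: "0 \<le> A $ \<omega> $ \<omega> + l" for \<omega>
    using row_bounded_entry[OF row_bounded_norm, of A \<omega> \<omega>] by (simp add: l_def)
  have sa: "summable (\<lambda>i. norm (a \<omega> z i))" for \<omega> z
  proof (rule summable_comparison_test'[OF summable_exp_bound[of 1 l], of 0])
    show "norm (norm (a \<omega> z i)) \<le> 1 * (l ^ i / fact i)" for i
      using divide_right_mono[OF matpow_entry_le[OF row_bounded_norm[of A], folded l_def], of "fact i" i \<omega> z]
      by (simp add: a_def)
  qed
  have l0: "0 \<le> l" by (simp add: l_def)
  have sb: "summable (\<lambda>i. norm (b i))" using summable_exp_bound[of 1 l] l0 by (simp add: b_def)
  have bsum: "(\<Sum>j. b j) = exp l" by (simp add: b_def exp_def field_simps)
  have C_sums: "(\<lambda>k. C k \<omega> z) sums (matrix_exp A $ \<omega> $ z * exp l)" for \<omega> z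
    using Cauchy_product_sums[OF sa sb, of \<omega> z] matrix_exp_entry_sums[of A \<omega> z]
    by (simp add: C_def bsum sums_iff a_def)
  have aS: "real (Suc i) * a \<omega> z (Suc i) = (\<Sum>l\<in>UNIV. A $ \<omega> $ l * a l z i)" for i \<omega> z
  proof -
    have "real (Suc i) * a \<omega> z (Suc i) = matpow A (Suc i) $ \<omega> $ z / fact i"
      by (simp add: a_def del: of_nat_Suc funpow.simps)
    then show ?thesis by (simp add: a_def matrix_matrix_mult_def sum_divide_distrib)
  qed
  have bS: "real (Suc j) * b (Suc j) = l * b j" for j
    by (simp add: b_def field_simps del: of_nat_Suc)
  \<comment> \<open>The factor \<open>Suc k\<close> is split as \<open>i + (Suc k - i)\<close>. The
    first summand lowers the index of \<open>a\<close> by \<open>aS\<close>, the second that of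
    \<open>b\<close> by \<open>bS\<close>: a product rule for the coefficients of the Cauchy
    product.\<close>
  have rec: "real (Suc k) * C (Suc k) \<omega> z = (\<Sum>m\<in>UNIV. A $ \<omega> $ m * C k m z) + l * C k \<omega> z" for k \<omega> z
  proof -
    have "real (Suc k) * C (Suc k) \<omega> z =
        (\<Sum>i\<le>Suc k. real i * a \<omega> z i * b (Suc k - i)) + (\<Sum>i\<le>Suc k. a \<omega> z i * (real (Suc k - i) * b (Suc k - i)))"
      unfolding C_def sum_distrib_left sum.distrib[symmetric]
      by (intro sum.cong refl) (auto simp: of_nat_diff algebra_simps)
    also have "(\<Sum>i\<le>Suc k. real i * a \<omega> z i * b (Suc k - i)) = (\<Sum>i\<le>k. \<Sum>m\<in>UNIV. A $ \<omega> $ m * (a m z i * b (k - i)))"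
      unfolding sum.atMost_Suc_shift by (simp add: aS sum_distrib_right mult.assoc del: of_nat_Suc)
    also have "\<dots> = (\<Sum>m\<in>UNIV. A $ \<omega> $ m * C k m z)"
      unfolding C_def sum_distrib_left by (rule sum.swap)
    also have "(\<Sum>i\<le>Suc k. a \<omega> z i * (real (Suc k - i) * b (Suc k - i))) = (\<Sum>i\<le>k. a \<omega> z i * (l * b (k - i)))"
      unfolding sum.atMost_Suc
      by (simp only: diff_self_eq_0 of_nat_0 mult_zero_left mult_zero_right add_0_right)
         (intro sum.cong refl, simp only: atMost_iff Suc_diff_le bS)
    also have "\<dots> = l * C k \<omega> z" unfolding C_def sum_distrib_left by (intro sum.cong) auto
    finally show ?thesis .
  qed
  have C0: "0 \<le> C k \<omega> z" for k \<omega> z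
  proof (induction k arbitrary: \<omega> z)
    case 0 show ?case by (simp add: C_def a_def b_def mat_def)
  next
    case (Suc k)
    have "(\<Sum>m\<in>UNIV. A $ \<omega> $ m * C k m z) = A $ \<omega> $ \<omega> * C k \<omega> z + (\<Sum>m\<in>UNIV - {\<omega>}. A $ \<omega> $ m * C k m z)"
      by (rule sum.remove) auto
    moreover have "0 \<le> (\<Sum>m\<in>UNIV - {\<omega>}. A $ \<omega> $ m * C k m z)"
      by (intro sum_nonneg mult_nonneg_nonneg off Suc) auto
    moreover have "0 \<le> (A $ \<omega> $ \<omega> + l) * C k \<omega> z" by (intro mult_nonneg_nonneg diag Suc)
    ultimately have "0 \<le> real (Suc k) * C (Suc k) \<omega> z" unfolding rec by (simp add: algebra_simps)
    then show ?case by (simp add: zero_le_mult_iff del: of_nat_Suc)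
  qed
  have "0 \<le> matrix_exp A $ \<omega> $ z * exp l"
    using sums_le[OF _ sums_zero C_sums, of \<omega> z] C0 by simp
  then show ?thesis by (simp add: zero_le_mult_iff)
qed

text \<open>Since \<open>fact (n + N)\<close> is at least \<open>fact n\<close>, the factor
  \<open>c ^ N\<close> comes out of the tail and the rest sums to \<open>exp c\<close>. Only
  \<open>N = 1\<close> and \<open>N = 2\<close> are used; the lost factor \<open>1 / fact N\<close>
  does not affect the order of the error.\<close>

lemma matrix_exp_tail:
  assumes A: "row_bounded c A" and a: "\<And>z. \<bar>a z\<bar> \<le> d"
  shows "\<bar>\<Sum>z\<in>UNIV. (matrix_exp A $ \<omega> $ z - (\<Sum>n<N. matpow A n $ \<omega> $ z / fact n)) * a z\<bar> \<le> c ^ N * exp c * d"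
proof -
  have c: "0 \<le> c" by (rule row_bounded_nonneg[OF A])
  have d: "0 \<le> d" using a by (meson abs_ge_zero order_trans)
  have "(\<lambda>n. matpow A (n + N) $ \<omega> $ z / fact (n + N)) sums
      (matrix_exp A $ \<omega> $ z - (\<Sum>n<N. matpow A n $ \<omega> $ z / fact n))" for z
    using matrix_exp_entry_sums[of A \<omega> z] sums_iff_shift[of "\<lambda>n. matpow A n $ \<omega> $ z / fact n" N] by simp
  then have s: "(\<lambda>n. \<Sum>z\<in>UNIV. matpow A (n + N) $ \<omega> $ z / fact (n + N) * a z) sums
      (\<Sum>z\<in>UNIV. (matrix_exp A $ \<omega> $ z - (\<Sum>n<N. matpow A n $ \<omega> $ z / fact n)) * a z)"
    by (intro sums_sum sums_mult2)
  have e: "(\<lambda>n. c ^ N * (c ^ n / fact n) * d) sums (c ^ N * exp c * d)"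
    using sums_mult2[OF sums_mult[OF exp_converges[of c], of "c ^ N"], of d] by (simp add: field_simps)
  have "\<bar>\<Sum>z\<in>UNIV. matpow A (n + N) $ \<omega> $ z / fact (n + N) * a z\<bar> \<le> c ^ N * (c ^ n / fact n) * d" for n
  proof -
    have "\<bar>\<Sum>z\<in>UNIV. matpow A (n + N) $ \<omega> $ z / fact (n + N) * a z\<bar> \<le>
        (\<Sum>z\<in>UNIV. \<bar>matpow A (n + N) $ \<omega> $ z\<bar> * (d / fact (n + N)))"
      by (intro order_trans[OF sum_abs] sum_mono) (simp add: abs_mult a mult_left_mono divide_right_mono)
    also have "\<dots> \<le> c ^ (n + N) * (d / fact (n + N))"
      unfolding sum_distrib_right[symmetric]
      using row_bounded_matpow[OF A, of "n + N"] d by (intro mult_right_mono) (auto simp: row_bounded_def)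
    also have "\<dots> \<le> c ^ (n + N) * (d / fact n)"
      using c d by (intro mult_left_mono divide_left_mono fact_mono) auto
    finally show ?thesis by (simp add: power_add mult.commute mult.left_commute)
  qed
  then show ?thesis
    using norm_suminf_le[of "\<lambda>n. \<Sum>z\<in>UNIV. matpow A (n + N) $ \<omega> $ z / fact (n + N) * a z"
        "\<lambda>n. c ^ N * (c ^ n / fact n) * d"] s e
    by (simp add: sums_iff)
qed

lemma matrix_exp_first_order:
  assumes "row_bounded c A" "\<And>z. \<bar>a z\<bar> \<le> d"
  shows "\<bar>(\<Sum>z\<in>UNIV. matrix_exp A $ \<omega> $ z * a z) - a \<omega>\<bar> \<le> c * exp c * d"
  using matrix_exp_tail[where a = a and N = 1 and \<omega> = \<omega>, OF assms] by (simp add: left_diff_distrib sum_subtractf sum_vec_mat1)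

lemma matrix_exp_second_order:
  assumes "row_bounded c A" "\<And>z. \<bar>a z\<bar> \<le> d"
  shows "\<bar>(\<Sum>z\<in>UNIV. matrix_exp A $ \<omega> $ z * a z) - (a \<omega> + (\<Sum>z\<in>UNIV. A $ \<omega> $ z * a z))\<bar> \<le> c\<^sup>2 * exp c * d"
  using matrix_exp_tail[where a = a and N = 2 and \<omega> = \<omega>, OF assms]
  by (simp add: numeral_2_eq_2 left_diff_distrib distrib_right sum_subtractf sum.distrib sum_vec_mat1)

lemma continuous_on_matpow: "continuous_on S (\<lambda>A :: real^'w^'w::finite. matpow A n)"
proof (induction n)
  case (Suc n)
  then show ?case unfolding matrix_matrix_mult_def funpow.simps comp_def
    by (auto intro!: continuous_intros continuous_on_vec_lambda)
qed (simp add: continuous_on_const)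

lemma continuous_on_matrix_exp: "continuous_on S (matrix_exp :: real^'w^'w::finite \<Rightarrow> _)"
proof -
  have "isCont matrix_exp A" for A :: "real^'w^'w"
  proof -
    \<comment> \<open>The series converges uniformly on bounded sets only, so continuity is shown
      locally, on a ball around 0 that contains \<open>A\<close>.\<close>
    define r where "r = norm A + 1"
    let ?B = "ball 0 r :: (real^'w^'w) set"
    let ?c = "real CARD('w) * r"
    have rb: "row_bounded ?c B" if "B \<in> ?B" for B
      using row_bounded_norm[of B] that unfolding row_bounded_def
      by (smt (verit, best) mem_ball_0 mult_left_mono of_nat_0_le_iff)
    have "uniform_limit ?B (\<lambda>N B. \<Sum>n<N. (1 / fact n) *\<^sub>R matpow B n) (\<lambda>B. \<Sum>n. (1 / fact n) *\<^sub>R matpow B n) sequentially"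
      by (rule Weierstrass_m_test[OF norm_exp_term_le[OF rb] summable_exp_bound])
    then have "continuous_on ?B (\<lambda>B. \<Sum>n. (1 / fact n) *\<^sub>R matpow B n)"
      by (rule uniform_limit_theorem[rotated]) (auto intro!: always_eventually continuous_intros continuous_on_matpow)
    then have "continuous_on ?B matrix_exp" unfolding matrix_exp_def[abs_def] .
    moreover have "A \<in> ?B" by (simp add: r_def)
    ultimately show ?thesis by (simp add: continuous_on_eq_continuous_at)
  qed
  then show ?thesis by (simp add: continuous_at_imp_continuous_on)
qed

lemma transition_rateD:
  assumes "transition_rate q"
  shows "\<omega>' \<noteq> \<omega> \<Longrightarrow> 0 \<le> q i j $ \<omega> $ \<omega>'" "(\<Sum>\<omega>'\<in>UNIV. q i j $ \<omega> $ \<omega>') = 0"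
  using assms by (auto simp: transition_rate_def)

lemma transition_matrix_stochastic:
  assumes "transition_rate q" "0 \<le> h"
  shows "0 \<le> matrix_exp (h *\<^sub>R q i j) $ \<omega> $ z" "(\<Sum>z\<in>UNIV. matrix_exp (h *\<^sub>R q i j) $ \<omega> $ z) = 1"
  using transition_rateD[OF assms(1)] assms(2)
  by (auto intro!: matrix_exp_nonneg matrix_exp_row_sum simp flip: sum_distrib_left)

lemma
  assumes "transition_rate q" "0 \<le> h"
  shows prob_space_state_law: "prob_space (state_law q h i j \<omega>)"
    and integral_state_law:
      "(\<integral>z. (f z :: real) \<partial>state_law q h i j \<omega>) = (\<Sum>z\<in>UNIV. matrix_exp (h *\<^sub>R q i j) $ \<omega> $ z * f z)"
proof -
  show "prob_space (state_law q h i j \<omega>)"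
    unfolding state_law_def
    by (intro prob_spaceI)
       (simp add: space_point_measure emeasure_point_measure_finite sum_ennreal transition_matrix_stochastic[OF assms])
  show "(\<integral>z. f z \<partial>state_law q h i j \<omega>) = (\<Sum>z\<in>UNIV. matrix_exp (h *\<^sub>R q i j) $ \<omega> $ z * f z)"
    unfolding state_law_def
    by (subst lebesgue_integral_point_measure_finite) (auto simp: transition_matrix_stochastic[OF assms])
qed

section \<open>Classical solutions and comparison with viscosity solutions\<close>

definition subsolution_states ::
  "(real \<Rightarrow> 'w \<Rightarrow> ('w \<Rightarrow> real) \<Rightarrow> real) \<Rightarrow> (real \<Rightarrow> 'w \<Rightarrow> real) \<Rightarrow> bool" where
  "subsolution_states H u \<longleftrightarrow>
     (\<forall>\<psi> D t z. C1_states \<psi> D \<and>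
        strict_max_at ({0..} \<times> UNIV) (\<lambda>(s, w). u s w - \<psi> s w) (t, z) \<longrightarrow>
        0 \<le> D t z + H t z (\<psi> t))"

definition subsolution_simplex ::
  "(real \<Rightarrow> real^'w::finite \<Rightarrow> real^'w \<Rightarrow> real) \<Rightarrow> (real \<Rightarrow> real^'w \<Rightarrow> real) \<Rightarrow> bool" where
  "subsolution_simplex H U \<longleftrightarrow>
     (\<forall>\<psi> D t \<zeta>. C1_simplex \<psi> D \<and>
        strict_max_at ({0..} \<times> prob_simplex) (\<lambda>(s, \<xi>). U s \<xi> - \<psi> (s, \<xi>)) (t, \<zeta>) \<longrightarrow>
        0 \<le> fst (D (t, \<zeta>)) + H t \<zeta> (snd (D (t, \<zeta>))))"

text \<open>The Hamiltonian of the equation satisfied by \<open>- u\<close>. The condition at strict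
  minima of \<open>u - \<psi>\<close> becomes the one at strict maxima for \<open>- u\<close>, so a
  viscosity solution is a pair of subsolutions and only maxima have to be studied.\<close>

definition dual_states :: "(real \<Rightarrow> 'w \<Rightarrow> ('w \<Rightarrow> real) \<Rightarrow> real) \<Rightarrow> real \<Rightarrow> 'w \<Rightarrow> ('w \<Rightarrow> real) \<Rightarrow> real" where
  "dual_states H t z a = - H t z (\<lambda>w. - a w)"

definition dual_simplex ::
  "(real \<Rightarrow> real^'w::finite \<Rightarrow> real^'w \<Rightarrow> real) \<Rightarrow> real \<Rightarrow> real^'w \<Rightarrow> real^'w \<Rightarrow> real" where
  "dual_simplex H t \<zeta> a = - H t \<zeta> (- a)"

lemma C1_states_uminus: "C1_states (\<lambda>t z. - \<psi> t z) (\<lambda>t z. - D t z) \<longleftrightarrow> C1_states \<psi> D"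
proof -
  have "C1_states (\<lambda>t z. - \<phi> t z) (\<lambda>t z. - E t z)" if "C1_states \<phi> E" for \<phi> E :: "real \<Rightarrow> 'a \<Rightarrow> real"
    using that unfolding C1_states_def by (auto intro!: continuous_intros derivative_intros)
  from this[of \<psi> D] this[of "\<lambda>t z. - \<psi> t z" "\<lambda>t z. - D t z"] show ?thesis by auto
qed

lemma C1_simplex_uminus: "C1_simplex (\<lambda>p. - \<psi> p) (\<lambda>p. - D p) \<longleftrightarrow> C1_simplex \<psi> D"
proof -
  have "C1_simplex (\<lambda>p. - \<phi> p) (\<lambda>p. - E p)" if "C1_simplex \<phi> E" for \<phi> E
    using that unfolding C1_simplex_def by (auto intro!: continuous_intros GDERIV_minus)
  from this[of \<psi> D] this[of "\<lambda>p. - \<psi> p" "\<lambda>p. - D p"] show ?thesis by auto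
qed

lemma strict_max_at_uminus:
  "strict_max_at S (\<lambda>(s, w). - f s w - h s w) a \<longleftrightarrow> strict_min_at S (\<lambda>(s, w). (f s w + h s w :: real)) a"
proof -
  have "(- f s w - h s w < - f s' w' - h s' w') = (f s' w' + h s' w' < f s w + h s w)" for s w s' w'
    by auto
  then show ?thesis unfolding strict_max_at_def strict_min_at_def split_beta by simp
qed

lemma viscosity_solution_states_iff:
  "viscosity_solution_states H u \<longleftrightarrow>
     (\<forall>z. continuous_on {0..} (\<lambda>t. u t z)) \<and> subsolution_states H u \<and>
     subsolution_states (dual_states H) (\<lambda>t z. - u t z)"
proof -
  \<comment> \<open>Negation is a bijection of the pairs of test function and derivative; the
    substitution is applied to the clause about minima alone.\<close>
  have all: "(\<forall>\<psi> D. P \<psi> D) \<longleftrightarrow> (\<forall>\<psi> D. P (\<lambda>t z. - \<psi> t z) (\<lambda>t z. - D t z))"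
    for P :: "(real \<Rightarrow> 'a \<Rightarrow> real) \<Rightarrow> (real \<Rightarrow> 'a \<Rightarrow> real) \<Rightarrow> bool"
  proof (intro iffI allI)
    fix \<psi> D assume "\<forall>\<psi> D. P (\<lambda>t z. - \<psi> t z) (\<lambda>t z. - D t z)"
    from this[rule_format, of "\<lambda>t z. - \<psi> t z" "\<lambda>t z. - D t z"] show "P \<psi> D" by simp
  qed simp
  show ?thesis
    unfolding viscosity_solution_states_def subsolution_states_def
    by (subst (2) all) (simp add: C1_states_uminus strict_max_at_uminus dual_states_def)
qed

lemma viscosity_solution_simplex_iff:
  "viscosity_solution_simplex H U \<longleftrightarrow>
     continuous_on ({0..} \<times> prob_simplex) (\<lambda>(t, \<zeta>). U t \<zeta>) \<and> subsolution_simplex H U \<and>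
     subsolution_simplex (dual_simplex H) (\<lambda>t \<zeta>. - U t \<zeta>)"
proof -
  have all: "(\<forall>\<psi> D. P \<psi> D) \<longleftrightarrow> (\<forall>\<psi> D. P (\<lambda>p. - \<psi> p) (\<lambda>p. - D p))"
    for P :: "(real \<times> (real^'a) \<Rightarrow> real) \<Rightarrow> (real \<times> (real^'a) \<Rightarrow> real \<times> (real^'a)) \<Rightarrow> bool"
  proof (intro iffI allI)
    fix \<psi> D assume "\<forall>\<psi> D. P (\<lambda>p. - \<psi> p) (\<lambda>p. - D p)"
    from this[rule_format, of "\<lambda>p. - \<psi> p" "\<lambda>p. - D p"] show "P \<psi> D" by simp
  qed simp
  show ?thesis
    unfolding viscosity_solution_simplex_def subsolution_simplex_def
    by (subst (2) all) (simp add: C1_simplex_uminus strict_max_at_uminus dual_simplex_def)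
qed

text \<open>The maximum principle in the form in which it is used: where \<open>a - b\<close> is
  largest at \<open>z\<close>, a generator applied to \<open>a - b\<close> is nonpositive at
  \<open>z\<close>. At a maximum of \<open>u - \<psi>\<close> this is the comparison between
  \<open>u\<close> and \<open>\<psi>\<close>.\<close>

definition elliptic_states :: "(real \<Rightarrow> 'w \<Rightarrow> ('w \<Rightarrow> real) \<Rightarrow> real) \<Rightarrow> bool" where
  "elliptic_states H \<longleftrightarrow> (\<forall>t z a b. (\<forall>w. a w - b w \<le> a z - b z) \<longrightarrow> H t z a \<le> H t z b)"

text \<open>The hypothesis says that \<open>a - b\<close> lies in the normal cone of the simplex at
  \<open>\<zeta>\<close>. At a maximum over the simplex, gradients agree only up to this cone, since
  the simplex has empty interior and \<open>\<zeta>\<close> may lie on its relative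
  boundary.\<close>

definition elliptic_simplex :: "(real \<Rightarrow> real^'w::finite \<Rightarrow> real^'w \<Rightarrow> real) \<Rightarrow> bool" where
  "elliptic_simplex H \<longleftrightarrow> (\<forall>t. \<forall>\<zeta>\<in>prob_simplex. \<forall>a b.
     (\<forall>\<xi>\<in>prob_simplex. (\<xi> - \<zeta>) \<bullet> (a - b) \<le> 0) \<longrightarrow> H t \<zeta> a \<le> H t \<zeta> b)"

lemma elliptic_dual_states: "elliptic_states H \<Longrightarrow> elliptic_states (dual_states H)"
  unfolding elliptic_states_def dual_states_def
  by (intro allI impI) (simp add: algebra_simps)

lemma elliptic_dual_simplex: "elliptic_simplex H \<Longrightarrow> elliptic_simplex (dual_simplex H)"
  unfolding elliptic_simplex_def dual_simplex_def
  by (intro allI ballI impI) (simp add: algebra_simps)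

lemma elliptic_states_shift: "elliptic_states H \<Longrightarrow> H t z (\<lambda>w. a w + c) = H t z a"
  unfolding elliptic_states_def by (intro order_antisym) (auto simp: algebra_simps)

text \<open>At a maximum the time derivative of \<open>v - \<psi>\<close> cannot be positive, or the
  difference would grow to the right. Only later times are compared, so time 0 needs no separate
  case. The maximum over the states at the fixed time is what ellipticity asks for.\<close>

lemma classical_subsolution_states:
  assumes der: "\<And>t z. 0 \<le> t \<Longrightarrow> ((\<lambda>s. v s z) has_real_derivative - H t z (v t)) (at t within {0..})"
    and H: "elliptic_states H"
  shows "subsolution_states H v"
  unfolding subsolution_states_def
proof (intro allI impI, elim conjE)
  fix \<psi> D t z assume C: "C1_states \<psi> D"
    and s: "strict_max_at ({0..} \<times> UNIV) (\<lambda>(s, w). v s w - \<psi> s w) (t, z)"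
  have t: "0 \<le> t" and mx: "\<And>s w. 0 \<le> s \<Longrightarrow> v s w - \<psi> s w \<le> v t z - \<psi> t z"
    using s unfolding strict_max_at_def by (fastforce, smt (verit) UNIV_I atLeast_iff case_prod_conv mem_Sigma_iff)
  have d: "((\<lambda>s. v s z - \<psi> s z) has_real_derivative - H t z (v t) - D t z) (at t within {0..})"
    using C t unfolding C1_states_def by (intro derivative_intros der) auto
  have "- H t z (v t) - D t z \<le> 0"
  proof (rule ccontr)
    assume "\<not> ?thesis"
    then obtain e where "e > 0" "\<And>h. 0 < h \<Longrightarrow> t + h \<in> {0..} \<Longrightarrow> h < e \<Longrightarrow> v t z - \<psi> t z < v (t + h) z - \<psi> (t + h) z"
      using has_real_derivative_pos_inc_right[OF d] by auto
    from this(1) this(2)[of "e / 2"] mx[of "t + e / 2" z] t show False by auto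
  qed
  moreover have "H t z (v t) \<le> H t z (\<psi> t)"
    using H mx[OF t] unfolding elliptic_states_def by blast
  ultimately show "0 \<le> D t z + H t z (\<psi> t)" by simp
qed

text \<open>The point \<open>p0\<close> lies above the level \<open>c\<close> that bounds the tail,
  so the maximum over a compact strip containing \<open>p0\<close> is global.\<close>

lemma attains_max_half_line:
  fixes F :: "real \<times> 'a::metric_space \<Rightarrow> real"
  assumes S: "compact S" and F: "continuous_on ({0..} \<times> S) F"
    and p: "p0 \<in> {0..} \<times> S" "c < F p0" and tail: "\<And>t a. T \<le> t \<Longrightarrow> a \<in> S \<Longrightarrow> F (t, a) \<le> c"
  shows "\<exists>p\<in>{0..} \<times> S. \<forall>p'\<in>{0::real..} \<times> S. F p' \<le> F p"
proof -
  let ?T = "max T (fst p0)"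
  have K: "compact ({0..?T} \<times> S)" by (intro compact_Times S compact_Icc)
  have p0: "p0 \<in> {0..?T} \<times> S" using p by (auto simp: mem_Times_iff)
  have "continuous_on ({0..?T} \<times> S) F" by (rule continuous_on_subset[OF F]) auto
  then obtain m where m: "m \<in> {0..?T} \<times> S" "\<And>p'. p' \<in> {0..?T} \<times> S \<Longrightarrow> F p' \<le> F m"
    using continuous_attains_sup[OF K, of F] p0 by blast
  show ?thesis
  proof (intro bexI[of _ m] ballI)
    fix p' :: "real \<times> 'a" assume p': "p' \<in> {0..} \<times> S"
    show "F p' \<le> F m"
    proof (cases "fst p' \<le> ?T")
      case True then show ?thesis using p' by (intro m(2)) (auto simp: mem_Times_iff)
    next
      case False
      then have "F p' \<le> c" using p' tail[of "fst p'" "snd p'"] by (auto simp: mem_Times_iff)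
      then show ?thesis using p(2) m(2)[OF p0] by linarith
    qed
  qed (use m in auto)
qed

lemma vanishes_at_infinity_uminus: "vanishes_at_infinity S u \<Longrightarrow> vanishes_at_infinity S (\<lambda>t a. - u t a)"
  unfolding vanishes_at_infinity_def by simp

lemma vanishing_diff_tail:
  assumes "vanishes_at_infinity S u" "vanishes_at_infinity S v" "0 < e"
  shows "\<exists>T. \<forall>t\<ge>T. \<forall>a\<in>S. u t a - v t a - e * exp (- t) \<le> e / 2"
proof -
  have "0 < e / 4" using assms(3) by simp
  then obtain T1 T2 where T: "\<forall>t\<ge>T1. \<forall>a\<in>S. \<bar>u t a\<bar> \<le> e / 4" "\<forall>t\<ge>T2. \<forall>a\<in>S. \<bar>v t a\<bar> \<le> e / 4"
    using assms(1,2) unfolding vanishes_at_infinity_def by meson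
  show ?thesis
  proof (intro exI[of _ "max T1 T2"] allI impI ballI)
    fix t a assume "max T1 T2 \<le> t" "a \<in> S"
    then have "\<bar>u t a\<bar> \<le> e / 4" "\<bar>v t a\<bar> \<le> e / 4" using T by auto
    moreover have "0 \<le> e * exp (- t)" using assms(3) by simp
    ultimately show "u t a - v t a - e * exp (- t) \<le> e / 2" by linarith
  qed
qed

text \<open>The test function is \<open>v\<close> plus the strictly decreasing function \<open>\<epsilon> exp (- s)\<close>, which turns
  the inequality of a subsolution into a contradiction, plus a term that makes the maximum strict.\<close>

lemma comparison_states:
  fixes v :: "real \<Rightarrow> 'w::finite \<Rightarrow> real"
  assumes der: "\<And>t z. 0 \<le> t \<Longrightarrow> ((\<lambda>s. v s z) has_real_derivative - H t z (v t)) (at t within {0..})"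
    and Hc: "\<And>z. continuous_on {0..} (\<lambda>t. H t z (v t))"
    and H: "elliptic_states H"
    and lip: "\<And>t z a b d. (\<And>w. \<bar>a w - b w\<bar> \<le> d) \<Longrightarrow> H t z a \<le> H t z b + C * d"
    and u: "subsolution_states H u" "\<And>z. continuous_on {0..} (\<lambda>t. u t z)"
    and van: "vanishes_at_infinity UNIV u" "vanishes_at_infinity UNIV v"
    and t0: "0 \<le> t0"
  shows "u t0 z0 \<le> v t0 z0"
proof (rule ccontr)
  assume "\<not> u t0 z0 \<le> v t0 z0"
  \<comment> \<open>Half of the excess: after subtracting \<open>e * exp (- t0)\<close> at least
    \<open>e\<close> remains at \<open>(t0, z0)\<close>, whereas the tail of the difference stays
    below \<open>e / 2\<close>.\<close>
  define e where "e = (u t0 z0 - v t0 z0) / 2"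
  have e: "e > 0" using \<open>\<not> _\<close> by (simp add: e_def)
  define F where "F z p = u (fst p) z - v (fst p) z - e * exp (- fst p)" for z and p :: "real \<times> real"
  have vc: "continuous_on {0..} (\<lambda>t. v t z)" for z
    using der by (intro DERIV_continuous_on) auto
  have F0: "F z0 (t0, 0) \<ge> e"
  proof -
    have "u t0 z0 - v t0 z0 = 2 * e" by (simp add: e_def)
    then show ?thesis using t0 e mult_left_mono[of "exp (-t0)" 1 e] by (simp add: F_def)
  qed
  obtain T where tail: "\<And>z t a. T \<le> t \<Longrightarrow> F z (t, a) \<le> e / 2"
    using vanishing_diff_tail[OF van e] by (auto simp: F_def)
  have Fc: "continuous_on ({0..} \<times> {0}) (F z)" for z
    unfolding F_def
    by (intro continuous_intros continuous_on_compose2[OF u(2)] continuous_on_compose2[OF vc]) auto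
  \<comment> \<open>In a state where \<open>F\<close> never exceeds the tail level a maximum over
    the half-line need not exist. Such states cannot compete, as \<open>F z0\<close> reaches
    \<open>e\<close>; one of the finitely many others carries the global maximum.\<close>
  define Z where "Z = {z. \<exists>t\<ge>0. e / 2 < F z (t, 0)}"
  have "\<exists>t\<ge>0. \<forall>s\<ge>0. F z (s, 0) \<le> F z (t, 0)" if z: "z \<in> Z" for z
  proof -
    obtain t where t: "t \<ge> 0" "e / 2 < F z (t, 0)" using z unfolding Z_def by auto
    have "\<exists>p\<in>{0..} \<times> {0}. \<forall>p'\<in>{0..} \<times> {0}. F z p' \<le> F z p"
      using t by (intro attains_max_half_line[OF _ Fc, of "(t, 0)" "e / 2" _ T] tail) auto
    then show ?thesis by force
  qed
  then obtain \<tau> where \<tau>: "\<And>z. z \<in> Z \<Longrightarrow> \<tau> z \<ge> 0" "\<And>z s. z \<in> Z \<Longrightarrow> s \<ge> 0 \<Longrightarrow> F z (s, 0) \<le> F z (\<tau> z, 0)"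
    by metis
  have z0: "z0 \<in> Z" using F0 e t0 unfolding Z_def by (intro CollectI exI[of _ t0]) auto
  obtain zb where zb: "zb \<in> Z" "\<And>z. z \<in> Z \<Longrightarrow> F z (\<tau> z, 0) \<le> F zb (\<tau> zb, 0)"
  proof -
    let ?m = "Max ((\<lambda>z. F z (\<tau> z, 0)) ` Z)"
    have "?m \<in> (\<lambda>z. F z (\<tau> z, 0)) ` Z" using z0 by (intro Max_in) auto
    then obtain zb where "zb \<in> Z" "?m = F zb (\<tau> zb, 0)" by blast
    moreover have "F z (\<tau> z, 0) \<le> ?m" if "z \<in> Z" for z using that by (intro Max_ge) auto
    ultimately show ?thesis using that[of zb] by simp
  qed
  define tb where "tb = \<tau> zb"
  have tb: "tb \<ge> 0" using \<tau> zb by (simp add: tb_def)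
  have mx: "F z (s, 0) \<le> F zb (tb, 0)" if "s \<ge> 0" for z s
  proof (cases "z \<in> Z")
    case True then show ?thesis using \<tau>(2)[OF True that] zb(2)[OF True] by (simp add: tb_def)
  next
    case False
    then have "F z (s, 0) \<le> e / 2" using that unfolding Z_def by force
    also have "\<dots> < F z0 (t0, 0)" using F0 e by simp
    also have "\<dots> \<le> F zb (tb, 0)" using \<tau>(2)[OF z0 t0] zb(2)[OF z0] by (simp add: tb_def)
    finally show ?thesis by simp
  qed
  have main: "e * exp (- tb) \<le> C * \<kappa>" if \<kappa>: "\<kappa> > 0" for \<kappa>
  proof -
    \<comment> \<open>The square makes the maximum strict in time and has derivative 0 at
      \<open>tb\<close>. States have no such smooth penalty, so the others are lifted by the
      constant \<open>\<kappa>\<close>, at a cost of at most \<open>C * \<kappa>\<close> in the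
      Hamiltonian.\<close>
    define \<psi> where "\<psi> s w = v s w + e * exp (- s) + (\<kappa> * (s - tb)\<^sup>2 + (if w = zb then 0 else \<kappa>))" for s w
    define D where "D s w = - H s w (v s) - e * exp (- s) + \<kappa> * (2 * (s - tb))" for s w
    have "C1_states \<psi> D"
      unfolding C1_states_def
    proof (intro allI conjI impI)
      show "continuous_on {0..} (\<lambda>t. D t z)" for z unfolding D_def by (intro continuous_intros Hc)
      show "((\<lambda>s. \<psi> s z) has_real_derivative D t z) (at t within {0..})" if "0 \<le> t" for t z
        unfolding D_def \<psi>_def by (auto intro!: derivative_eq_intros der that)
    qed
    moreover have "strict_max_at ({0..} \<times> UNIV) (\<lambda>(s, w). u s w - \<psi> s w) (tb, zb)"
      unfolding strict_max_at_def
    proof (intro conjI ballI impI)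
      fix p assume p: "p \<in> {0..} \<times> (UNIV :: 'w set)" "p \<noteq> (tb, zb)"
      obtain s w where sw: "p = (s, w)" by force
      have "F w (s, 0) \<le> F zb (tb, 0)" using p sw by (intro mx) auto
      moreover have "0 < \<kappa> * (s - tb)\<^sup>2 + (if w = zb then 0 else \<kappa>)"
        using p sw \<kappa> by (auto intro!: add_nonneg_pos)
      ultimately show "(case p of (s, w) \<Rightarrow> u s w - \<psi> s w) < (case (tb, zb) of (s, w) \<Rightarrow> u s w - \<psi> s w)"
        unfolding sw F_def \<psi>_def by simp
    qed (use tb in auto)
    ultimately have "0 \<le> D tb zb + H tb zb (\<psi> tb)" using u(1) unfolding subsolution_states_def by blast
    also have "H tb zb (\<psi> tb) \<le> H tb zb (\<lambda>w. v tb w + e * exp (- tb)) + C * \<kappa>"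
      using \<kappa> by (intro lip) (auto simp: \<psi>_def)
    also have "H tb zb (\<lambda>w. v tb w + e * exp (- tb)) = H tb zb (v tb)" by (rule elliptic_states_shift[OF H])
    finally show ?thesis by (simp add: D_def)
  qed
  define x where "x = e * exp (- tb)"
  \<comment> \<open>Small enough for \<open>C * \<kappa>\<close> to be at most half of
    \<open>x\<close>; \<open>\<bar>C\<bar> + 1\<close> covers every sign of \<open>C\<close> and
    avoids a division by 0.\<close>
  define \<kappa> where "\<kappa> = x / (2 * (\<bar>C\<bar> + 1))"
  have x: "0 < x" using e by (simp add: x_def)
  then have \<kappa>: "0 < \<kappa>" by (simp add: \<kappa>_def)
  have "x \<le> C * \<kappa>" using main[OF \<kappa>] by (simp add: x_def)
  also have "\<dots> \<le> (\<bar>C\<bar> + 1) * \<kappa>" using \<kappa> by (intro mult_right_mono) auto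
  also have "\<dots> = x / 2" unfolding \<kappa>_def by (simp add: field_simps)
  finally show False using x by simp
qed

section \<open>First-order conditions and comparison on the simplex\<close>

lemma GDERIV_max_convex:
  fixes f :: "'a::real_inner \<Rightarrow> real"
  assumes "convex S" "p \<in> S" "x \<in> S" "GDERIV f p :> c" "\<And>x. x \<in> S \<Longrightarrow> f x \<le> f p"
  shows "(x - p) \<bullet> c \<le> 0"
proof (rule ccontr)
  assume n: "\<not> ?thesis"
  have "((\<lambda>s. f (p + s *\<^sub>R (x - p))) has_derivative (\<lambda>s. (s *\<^sub>R (x - p)) \<bullet> c)) (at 0)"
  proof -
    have "((\<lambda>s. p + s *\<^sub>R (x - p)) has_derivative (\<lambda>s. s *\<^sub>R (x - p))) (at 0)"
      by (auto intro!: derivative_eq_intros)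
    moreover have "(f has_derivative (\<lambda>h. h \<bullet> c)) (at (p + 0 *\<^sub>R (x - p)))"
      using assms(4) by (simp add: gderiv_def)
    ultimately show ?thesis using diff_chain_at by (fastforce simp: comp_def)
  qed
  then have "((\<lambda>s. f (p + s *\<^sub>R (x - p))) has_real_derivative ((x - p) \<bullet> c)) (at 0)"
    by (simp add: has_field_derivative_def mult_commute_abs)
  from DERIV_pos_inc_right[OF this] n obtain d where d: "d > 0" "\<And>h. 0 < h \<Longrightarrow> h < d \<Longrightarrow> f p < f (p + h *\<^sub>R (x - p))"
    by auto
  define h where "h = min 1 (d / 2)"
  have h: "0 < h" "h < d" "h \<le> 1" using d by (auto simp: h_def)
  have "p + h *\<^sub>R (x - p) = (1 - h) *\<^sub>R p + h *\<^sub>R x" by (simp add: algebra_simps)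
  then have "p + h *\<^sub>R (x - p) \<in> S" using assms(1-3) h by (simp add: convex_def)
  with assms(5) d(2)[OF h(1,2)] show False by force
qed

lemma convex_prob_simplex: "convex (prob_simplex :: (real^'w::finite) set)"
  by (rule convexI) (auto simp: prob_simplex_def sum.distrib simp flip: sum_distrib_left)

lemma compact_prob_simplex: "compact (prob_simplex :: (real^'w::finite) set)"
proof -
  have "closed (prob_simplex :: (real^'w::finite) set)"
    unfolding prob_simplex_def
    by (intro closed_Collect_conj closed_Collect_all closed_Collect_le closed_Collect_eq continuous_intros)
  moreover have "norm \<zeta> \<le> 1" if "\<zeta> \<in> prob_simplex" for \<zeta> :: "real^'w"
    using norm_le_l1_cart[of \<zeta>] that by (simp add: prob_simplex_def)
  then have "bounded (prob_simplex :: (real^'w::finite) set)" by (auto simp: bounded_iff)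
  ultimately show ?thesis by (simp add: compact_eq_bounded_closed)
qed

lemma GDERIV_bilinear_extension:
  assumes "\<And>z. ((\<lambda>s. v s z) has_real_derivative v' z) (at t)"
  shows "GDERIV (\<lambda>p. \<Sum>\<omega>\<in>UNIV. snd p $ \<omega> * v (fst p) \<omega>) (t, \<zeta>) :>
           ((\<Sum>\<omega>\<in>UNIV. \<zeta> $ \<omega> * v' \<omega>), (\<chi> \<omega>. v t \<omega>))"
proof -
  have "((\<lambda>p. v (fst p) z) has_derivative (\<lambda>h. fst h * v' z)) (at (t, \<zeta>))" for z
  proof -
    have "(fst has_derivative fst) (at (t, \<zeta>))"
      by (rule has_derivative_fst[OF has_derivative_ident])
    moreover have "((\<lambda>s. v s z) has_derivative (\<lambda>h. h * v' z)) (at (fst (t, \<zeta>)))"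
      using assms[of z] by (simp add: has_field_derivative_def mult_commute_abs)
    ultimately show ?thesis using diff_chain_at by (fastforce simp: comp_def)
  qed
  then have "((\<lambda>p. \<Sum>\<omega>\<in>UNIV. snd p $ \<omega> * v (fst p) \<omega>) has_derivative
     (\<lambda>h. \<Sum>\<omega>\<in>UNIV. \<zeta> $ \<omega> * (fst h * v' \<omega>) + snd h $ \<omega> * v t \<omega>)) (at (t, \<zeta>))"
    by (auto intro!: derivative_eq_intros bounded_linear.has_derivative[OF bounded_linear_vec_nth])
  then show ?thesis
    unfolding gderiv_def
    by (rule has_derivative_eq_rhs) (simp add: fun_eq_iff inner_vec_def sum.distrib sum_distrib_left algebra_simps)
qed

text \<open>The first-order condition at a maximum over the convex set
  \<open>{0..} \<times> prob_simplex\<close> is tested in two ways: the point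
  \<open>(t + 1, \<zeta>)\<close> gives the sign of the time derivative, and the points
  \<open>(t, \<xi>)\<close> give the normal cone condition of
  \<open>elliptic_simplex\<close>.\<close>

lemma classical_subsolution_simplex:
  fixes v :: "real \<Rightarrow> 'w::finite \<Rightarrow> real"
  assumes der: "\<And>t z. 0 \<le> t \<Longrightarrow> ((\<lambda>s. v s z) has_real_derivative v' t z) (at t)"
    and eq: "\<And>t \<zeta>. 0 \<le> t \<Longrightarrow> \<zeta> \<in> prob_simplex \<Longrightarrow> (\<Sum>\<omega>\<in>UNIV. \<zeta> $ \<omega> * v' t \<omega>) + H t \<zeta> (\<chi> \<omega>. v t \<omega>) = 0"
    and H: "elliptic_simplex H"
  shows "subsolution_simplex H (\<lambda>t \<zeta>. \<Sum>\<omega>\<in>UNIV. \<zeta> $ \<omega> * v t \<omega>)"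
  unfolding subsolution_simplex_def
proof (intro allI impI, elim conjE)
  fix \<psi> D t \<zeta> assume C: "C1_simplex \<psi> D"
    and s: "strict_max_at ({0..} \<times> prob_simplex) (\<lambda>(s, \<xi>). (\<Sum>\<omega>\<in>UNIV. \<xi> $ \<omega> * v s \<omega>) - \<psi> (s, \<xi>)) (t, \<zeta>)"
  let ?S = "{0..} \<times> prob_simplex :: (real \<times> (real^'w)) set"
  let ?f = "\<lambda>p. (\<Sum>\<omega>\<in>UNIV. snd p $ \<omega> * v (fst p) \<omega>) - \<psi> p"
  let ?V = "((\<Sum>\<omega>\<in>UNIV. \<zeta> $ \<omega> * v' t \<omega>), (\<chi> \<omega>. v t \<omega>))"
  have tz: "(t, \<zeta>) \<in> ?S" using s by (simp add: strict_max_at_def)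
  then have t: "0 \<le> t" "\<zeta> \<in> prob_simplex" by auto
  have mx: "?f p \<le> ?f (t, \<zeta>)" if "p \<in> ?S" for p
    using s that unfolding strict_max_at_def by (cases "p = (t, \<zeta>)") (auto simp: split_beta intro: less_imp_le)
  have g: "GDERIV ?f (t, \<zeta>) :> ?V - D (t, \<zeta>)"
    using C tz der[OF t(1)] unfolding C1_simplex_def
    by (intro GDERIV_diff GDERIV_bilinear_extension) auto
  have cv: "convex ?S" by (intro convex_Times convex_prob_simplex) simp
  have le: "(x - (t, \<zeta>)) \<bullet> (?V - D (t, \<zeta>)) \<le> 0" if "x \<in> ?S" for x
    by (rule GDERIV_max_convex[OF cv tz that g mx])
  have "fst ?V - fst (D (t, \<zeta>)) \<le> 0"
    using le[of "(t + 1, \<zeta>)"] t by (simp add: inner_prod_def)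
  moreover have "(\<xi> - \<zeta>) \<bullet> ((\<chi> \<omega>. v t \<omega>) - snd (D (t, \<zeta>))) \<le> 0" if "\<xi> \<in> prob_simplex" for \<xi>
    using le[of "(t, \<xi>)"] t that by (simp add: inner_prod_def)
  then have "H t \<zeta> (\<chi> \<omega>. v t \<omega>) \<le> H t \<zeta> (snd (D (t, \<zeta>)))"
    using H t unfolding elliptic_simplex_def by blast
  ultimately show "0 \<le> fst (D (t, \<zeta>)) + H t \<zeta> (snd (D (t, \<zeta>)))" using eq[OF t] by simp
qed

text \<open>Here the strictifying term is the squared distance to the maximum point. Its gradient
  vanishes there, so the Hamiltonian is evaluated exactly at the gradient of the bilinear extension
  of \<open>v\<close>, and \<open>eq\<close> leaves \<open>0 \<le> - e * exp (- tb)\<close>.\<close>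

lemma comparison_simplex:
  fixes v :: "real \<Rightarrow> 'w::finite \<Rightarrow> real" and U :: "real \<Rightarrow> real^'w \<Rightarrow> real"
  assumes der: "\<And>t z. ((\<lambda>s. v s z) has_real_derivative v' t z) (at t)"
    and cont: "\<And>z. continuous_on UNIV (\<lambda>t. v' t z)"
    and eq: "\<And>t \<zeta>. 0 \<le> t \<Longrightarrow> \<zeta> \<in> prob_simplex \<Longrightarrow> (\<Sum>\<omega>\<in>UNIV. \<zeta> $ \<omega> * v' t \<omega>) + H t \<zeta> (\<chi> \<omega>. v t \<omega>) = 0"
    and U: "subsolution_simplex H U" "continuous_on ({0..} \<times> prob_simplex) (\<lambda>(t, \<zeta>). U t \<zeta>)"
    and van: "vanishes_at_infinity prob_simplex U"
      "vanishes_at_infinity prob_simplex (\<lambda>t \<zeta>. \<Sum>\<omega>\<in>UNIV. \<zeta> $ \<omega> * v t \<omega>)"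
    and t0: "0 \<le> t0" "\<zeta>0 \<in> prob_simplex"
  shows "U t0 \<zeta>0 \<le> (\<Sum>\<omega>\<in>UNIV. \<zeta>0 $ \<omega> * v t0 \<omega>)"
proof (rule ccontr)
  let ?V = "\<lambda>t \<zeta>. \<Sum>\<omega>\<in>UNIV. \<zeta> $ \<omega> * v t \<omega>"
  let ?S = "{0..} \<times> prob_simplex :: (real \<times> (real^'w)) set"
  assume "\<not> U t0 \<zeta>0 \<le> ?V t0 \<zeta>0"
  define e where "e = (U t0 \<zeta>0 - ?V t0 \<zeta>0) / 2"
  have e: "e > 0" using \<open>\<not> _\<close> by (simp add: e_def)
  define F where "F p = U (fst p) (snd p) - ?V (fst p) (snd p) - e * exp (- fst p)" for p
  have vc: "continuous_on UNIV (\<lambda>t. v t z)" for z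
    by (rule DERIV_continuous_on[OF has_field_derivative_at_within[OF der]])
  have F0: "F (t0, \<zeta>0) \<ge> e"
  proof -
    have "U t0 \<zeta>0 - ?V t0 \<zeta>0 = 2 * e" by (simp add: e_def)
    then show ?thesis using t0 e mult_left_mono[of "exp (-t0)" 1 e] by (simp add: F_def)
  qed
  obtain T where tail: "\<And>t a. T \<le> t \<Longrightarrow> a \<in> prob_simplex \<Longrightarrow> F (t, a) \<le> e / 2"
    using vanishing_diff_tail[OF van e] by (auto simp: F_def)
  have Fc: "continuous_on ?S F"
  proof -
    have "continuous_on ?S (\<lambda>p. U (fst p) (snd p))" using U(2) by (simp add: split_beta')
    then show ?thesis
      unfolding F_def by (intro continuous_intros continuous_on_compose2[OF vc]) auto
  qed
  have "\<exists>p\<in>?S. \<forall>p'\<in>?S. F p' \<le> F p"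
    using t0 F0 e
    by (intro attains_max_half_line[OF compact_prob_simplex Fc, of "(t0, \<zeta>0)" "e / 2" T] tail) auto
  then obtain tb \<zeta>b where m: "(tb, \<zeta>b) \<in> ?S" "\<And>p. p \<in> ?S \<Longrightarrow> F p \<le> F (tb, \<zeta>b)"
    by (metis surj_pair)
  define \<psi> where "\<psi> p = (\<Sum>\<omega>\<in>UNIV. snd p $ \<omega> * v (fst p) \<omega>) + (e * exp (- fst p) + (p - (tb, \<zeta>b)) \<bullet> (p - (tb, \<zeta>b)))"
    for p
  define D where "D p = ((\<Sum>\<omega>\<in>UNIV. snd p $ \<omega> * v' (fst p) \<omega>), (\<chi> \<omega>. v (fst p) \<omega>)) +
      ((- e * exp (- fst p), 0) + 2 *\<^sub>R (p - (tb, \<zeta>b)))" for p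
  have "C1_simplex \<psi> D"
    unfolding C1_simplex_def
  proof (intro exI[of _ UNIV] conjI ballI)
    show "continuous_on UNIV D"
      unfolding D_def
      by (intro continuous_intros continuous_on_vec_lambda continuous_on_compose2[OF vc] continuous_on_compose2[OF cont]) auto
    fix p :: "real \<times> (real^'w)"
    have "GDERIV (\<lambda>p. e * exp (- fst p) + (p - (tb, \<zeta>b)) \<bullet> (p - (tb, \<zeta>b))) p :>
        (- e * exp (- fst p), 0) + 2 *\<^sub>R (p - (tb, \<zeta>b))"
      unfolding gderiv_def
      by (auto intro!: derivative_eq_intros simp: fun_eq_iff inner_prod_def inner_commute algebra_simps)
    from GDERIV_add[OF GDERIV_bilinear_extension[of v "v' (fst p)" "fst p" "snd p", OF der, unfolded prod.collapse] this]
    show "GDERIV \<psi> p :> D p"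
      unfolding \<psi>_def[abs_def] D_def by simp
  qed auto
  moreover have "strict_max_at ?S (\<lambda>(s, w). U s w - \<psi> (s, w)) (tb, \<zeta>b)"
    unfolding strict_max_at_def
  proof (intro conjI ballI impI)
    fix p assume p: "p \<in> ?S" "p \<noteq> (tb, \<zeta>b)"
    have "0 < (p - (tb, \<zeta>b)) \<bullet> (p - (tb, \<zeta>b))" using p by simp
    with m(2)[OF p(1)] show "(case p of (s, w) \<Rightarrow> U s w - \<psi> (s, w)) < (case (tb, \<zeta>b) of (s, w) \<Rightarrow> U s w - \<psi> (s, w))"
      unfolding F_def \<psi>_def split_beta prod.collapse fst_conv snd_conv diff_self inner_zero_left by linarith
  qed (use m in auto)
  ultimately have "0 \<le> fst (D (tb, \<zeta>b)) + H tb \<zeta>b (snd (D (tb, \<zeta>b)))"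
    using U(1) unfolding subsolution_simplex_def by blast
  then have "0 \<le> - e * exp (- tb)" using eq[of tb \<zeta>b] m(1) by (simp add: D_def)
  then show False using mult_pos_pos[OF e exp_gt_zero[of "- tb"]] by simp
qed

section \<open>Integrals over half-lines\<close>

lemma half_line_integral_split:
  fixes f :: "real \<Rightarrow> real"
  assumes f: "set_integrable lborel {a..} f" and "a \<le> t"
  shows "(LINT s:{t..}|lborel. f s) = (LINT s:{a..}|lborel. f s) - integral {a..t} f"
proof -
  have 1: "set_integrable lborel {a..t} f" "set_integrable lborel {t..} f"
    using f \<open>a \<le> t\<close> by (auto intro: set_integrable_subset)
  have "(LINT s:{a..}|lborel. f s) = (LINT s:{a..t} \<union> {t..}|lborel. f s)"
  proof -
    have "{a..} = {a..t} \<union> {t..}" using \<open>a \<le> t\<close> by auto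
    then show ?thesis by simp
  qed
  also have "\<dots> = (LINT s:{a..t}|lborel. f s) + (LINT s:{t..}|lborel. f s)"
    using AE_lborel_singleton[of t] by (intro set_integral_Un_AE 1) auto
  finally show ?thesis using set_borel_integral_eq_integral(2)[OF 1(1)] by simp
qed

lemma half_line_integral_continuous:
  fixes f :: "real \<Rightarrow> real"
  assumes f: "\<And>a. set_integrable lborel {a..} f"
  shows "continuous_on UNIV (\<lambda>t. LINT s:{t..}|lborel. f s)"
proof -
  have "isCont (\<lambda>t. LINT s:{t..}|lborel. f s) t" for t
  proof -
    have "f integrable_on {t - 1..t + 1}"
      by (rule set_borel_integral_eq_integral(1)) (rule set_integrable_subset[OF f[of "t - 1"]], auto)
    then have "continuous_on {t - 1..t + 1} (\<lambda>s. (LINT s:{t - 1..}|lborel. f s) - integral {t - 1..s} f)"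
      by (intro continuous_intros indefinite_integral_continuous_1)
    then have "continuous_on {t - 1..t + 1} (\<lambda>t. LINT s:{t..}|lborel. f s)"
      by (rule continuous_on_eq) (auto intro: half_line_integral_split[OF f[of "t - 1"], symmetric])
    then show ?thesis by (rule continuous_on_interior) (simp add: interior_atLeastAtMost_real)
  qed
  then show ?thesis by (simp add: continuous_at_imp_continuous_on)
qed

text \<open>With base point \<open>t - 1\<close> the tail integral is a constant minus an indefinite
  integral on a full neighbourhood of \<open>t\<close>, which gives a two-sided derivative.\<close>

lemma half_line_integral_deriv:
  fixes f :: "real \<Rightarrow> real"
  assumes f: "\<And>a. set_integrable lborel {a..} f" and c: "continuous_on UNIV f"
  shows "((\<lambda>t. LINT s:{t..}|lborel. f s) has_real_derivative - f t) (at t)"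
proof -
  have "((\<lambda>s. (LINT s:{t - 1..}|lborel. f s) - integral {t - 1..s} f) has_real_derivative 0 - f t)
      (at t within {t - 1..t + 1})"
    by (intro derivative_intros integral_has_real_derivative continuous_on_subset[OF c]) auto
  then have 1: "((\<lambda>s. (LINT s:{t - 1..}|lborel. f s) - integral {t - 1..s} f) has_real_derivative - f t) (at t)"
    by (simp add: at_within_Icc_at)
  have 2: "\<forall>\<^sub>F s in nhds t. (LINT s:{t - 1..}|lborel. f s) - integral {t - 1..s} f = (LINT s:{s..}|lborel. f s)"
    by (rule eventually_mono[OF eventually_nhds_in_open[of "{t - 1<..}"]])
       (auto intro: half_line_integral_split[OF f[of "t - 1"], symmetric])
  show ?thesis using 1 unfolding DERIV_cong_ev[OF refl 2 refl] .
qed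

lemma half_line_integral_tendsto_0:
  fixes f :: "real \<Rightarrow> real"
  assumes f: "set_integrable lborel {a..} f"
  shows "((\<lambda>t. LINT s:{t..}|lborel. f s) \<longlongrightarrow> 0) at_top"
proof -
  have "((\<lambda>b. (LINT s:{a..}|lborel. f s) - (LINT s:{a..b}|lborel. f s)) \<longlongrightarrow>
      (LINT s:{a..}|lborel. f s) - (LINT s:{a..}|lborel. f s)) at_top"
    by (intro tendsto_intros tendsto_set_lebesgue_integral_at_top f) auto
  then have *: "((\<lambda>b. (LINT s:{a..}|lborel. f s) - (LINT s:{a..b}|lborel. f s)) \<longlongrightarrow> 0) at_top" by simp
  show ?thesis
  proof (rule Lim_transform_eventually[OF *])
    show "\<forall>\<^sub>F b in at_top. (LINT s:{a..}|lborel. f s) - (LINT s:{a..b}|lborel. f s) = (LINT s:{b..}|lborel. f s)"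
      using eventually_ge_at_top[of a]
    proof eventually_elim
      case (elim b)
      have "set_integrable lborel {a..b} f" by (rule set_integrable_subset[OF f]) auto
      then show ?case
        using half_line_integral_split[OF f elim] set_borel_integral_eq_integral(2) by metis
    qed
  qed
qed

section \<open>The value of the one-shot game\<close>

abbreviation cont2 :: "('i::topological_space \<Rightarrow> 'j::topological_space \<Rightarrow> 'b::topological_space) \<Rightarrow> bool" where
  "cont2 F \<equiv> continuous_on UNIV (\<lambda>(i, j). F i j)"

lemma cont2_lift: "continuous_on UNIV h \<Longrightarrow> cont2 F \<Longrightarrow> cont2 (\<lambda>i j. h (F i j))"
  using continuous_on_compose2[of UNIV h UNIV "\<lambda>(i, j). F i j"] by (simp add: split_beta)

definition cval :: "('i::topological_space \<Rightarrow> 'j::topological_space \<Rightarrow> real) \<Rightarrow> real" where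
  "cval F = game_val Delta Delta (mixed_ext F)"

locale compact_actions =
  fixes TI :: "'i::metric_space itself" and TJ :: "'j::metric_space itself"
  assumes compact_I: "compact (UNIV :: 'i set)" and compact_J: "compact (UNIV :: 'j set)"
begin

lemma cont2_measurable:
  fixes F :: "'i \<Rightarrow> 'j \<Rightarrow> 'b::topological_space"
  shows "cont2 F \<Longrightarrow> (\<lambda>p. F (fst p) (snd p)) \<in> borel_measurable (borel \<Otimes>\<^sub>M borel)"
  by (rule continuous_pair_measurable[OF compact_I compact_J])

lemma cont2_bounded:
  fixes F :: "'i \<Rightarrow> 'j \<Rightarrow> 'b::real_normed_vector"
  assumes "cont2 F" shows "\<exists>M\<ge>0. \<forall>i j. norm (F i j) \<le> M"
  using continuous_compact_bounded[OF compact_I compact_J assms] by metis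

lemma cont2_integrable:
  fixes F :: "'i \<Rightarrow> 'j \<Rightarrow> 'b::{banach, second_countable_topology}"
  assumes "cont2 F" "x \<in> Delta" "y \<in> Delta"
  shows "integrable (x \<Otimes>\<^sub>M y) (\<lambda>p. F (fst p) (snd p))"
  using cont2_bounded[OF assms(1)] integrable_mixed[OF cont2_measurable[OF assms(1)] _ assms(2,3)] by blast

lemma cval_approx:
  fixes F :: "'i \<Rightarrow> 'j \<Rightarrow> real"
  assumes "cont2 F" shows "approx_value Delta Delta (mixed_ext F) (cval F)"
proof -
  obtain c where c: "approx_value Delta Delta (mixed_ext F) c"
    using minimax_compact[OF compact_I compact_J assms] by blast
  obtain M where "\<And>i j. norm (F i j) \<le> M" using cont2_bounded[OF assms] by blast
  then have "game_val Delta Delta (mixed_ext F) = c"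
    using mixed_ext_bound[OF cont2_measurable[OF assms]] by (intro game_val_eqI[OF c, of M]) fastforce
  with c show ?thesis by (simp add: cval_def)
qed

lemma approx_value_unique: "approx_value A B F c \<Longrightarrow> approx_value A B F c' \<Longrightarrow> c = c'"
  using approx_value_abs_diff_le[of A B F c F c' 0] by simp

lemma mixed_ext_affine:
  fixes F :: "'i \<Rightarrow> 'j \<Rightarrow> real"
  assumes F: "cont2 F" and x: "x \<in> Delta" and y: "y \<in> Delta"
  shows "mixed_ext (\<lambda>i j. c + h * F i j) x y = c + h * mixed_ext F x y"
proof -
  interpret x: prob_space x by (rule DeltaD[OF x])
  interpret y: prob_space y by (rule DeltaD[OF y])
  interpret xy: pair_prob_space x y ..
  show ?thesis unfolding mixed_ext_def using cont2_integrable[OF F x y] by (simp add: xy.prob_space)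
qed

lemma cval_affine:
  fixes F :: "'i \<Rightarrow> 'j \<Rightarrow> real"
  assumes F: "cont2 F" and "0 < h"
  shows "cval (\<lambda>i j. c + h * F i j) = c + h * cval F"
proof (rule approx_value_unique[OF cval_approx])
  show "cont2 (\<lambda>i j. c + h * F i j)" by (rule cont2_lift[OF _ F]) (intro continuous_intros)
  have *: "approx_value Delta Delta (mixed_ext F) (cval F)" by (rule cval_approx[OF F])
  show "approx_value Delta Delta (mixed_ext (\<lambda>i j. c + h * F i j)) (c + h * cval F)"
    unfolding approx_value_def
  proof (intro conjI allI impI)
    fix e :: real assume "e > 0"
    then have "e / h > 0" using \<open>0 < h\<close> by simp
    with * obtain x where x: "x \<in> Delta" "\<And>y. y \<in> Delta \<Longrightarrow> cval F - e / h \<le> mixed_ext F x y"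
      unfolding approx_value_def by meson
    show "\<exists>a\<in>Delta. \<forall>b\<in>Delta. c + h * cval F - e \<le> mixed_ext (\<lambda>i j. c + h * F i j) a b"
      using x \<open>0 < h\<close> by (intro bexI[of _ x] ballI) (auto simp: mixed_ext_affine[OF F] field_simps)
    from * \<open>e / h > 0\<close> obtain y where y: "y \<in> Delta" "\<And>x. x \<in> Delta \<Longrightarrow> mixed_ext F x y \<le> cval F + e / h"
      unfolding approx_value_def by meson
    show "\<exists>b\<in>Delta. \<forall>a\<in>Delta. mixed_ext (\<lambda>i j. c + h * F i j) a b \<le> c + h * cval F + e"
      using y \<open>0 < h\<close> by (intro bexI[of _ y] ballI) (auto simp: mixed_ext_affine[OF F] field_simps)
  qed
qed

lemma cval_mono:
  fixes F F' :: "'i \<Rightarrow> 'j \<Rightarrow> real"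
  assumes F: "cont2 F" and F': "cont2 F'" and le: "\<And>i j. F i j \<le> F' i j + d"
  shows "cval F \<le> cval F' + d"
proof (rule approx_value_mono[OF cval_approx[OF F] cval_approx[OF F']])
  fix x :: "'i measure" and y :: "'j measure" assume xy: "x \<in> Delta" "y \<in> Delta"
  have "cont2 (\<lambda>i j. d + 1 * F' i j)" by (rule cont2_lift[OF _ F']) (intro continuous_intros)
  then have "mixed_ext F x y \<le> mixed_ext (\<lambda>i j. d + 1 * F' i j) x y"
    unfolding mixed_ext_def using le by (intro integral_mono cont2_integrable F xy) (auto simp: add.commute)
  then show "mixed_ext F x y \<le> mixed_ext F' x y + d"
    using mixed_ext_affine[OF F' xy, of d 1] by simp
qed

lemma cval_abs_diff_le:
  fixes F F' :: "'i \<Rightarrow> 'j \<Rightarrow> real"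
  assumes "cont2 F" "cont2 F'" and le: "\<And>i j. \<bar>F i j - F' i j\<bar> \<le> d"
  shows "\<bar>cval F - cval F'\<bar> \<le> d"
proof -
  have "F i j \<le> F' i j + d" "F' i j \<le> F i j + d" for i j using le[of i j] by auto
  then have "cval F \<le> cval F' + d" "cval F' \<le> cval F + d" by (intro cval_mono assms(1,2); simp)+
  then show ?thesis by simp
qed

lemma cval_abs_le:
  fixes F :: "'i \<Rightarrow> 'j \<Rightarrow> real"
  assumes F: "cont2 F" and le: "\<And>i j. \<bar>F i j\<bar> \<le> d"
  shows "\<bar>cval F\<bar> \<le> d"
proof -
  have "\<bar>mixed_ext F x y\<bar> \<le> d" if "x \<in> Delta" "y \<in> Delta" for x y
    using mixed_ext_bound[OF cont2_measurable[OF F] _ that, of d] le by simp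
  then have "- d \<le> mixed_ext F x y \<and> mixed_ext F x y \<le> d" if "x \<in> Delta" "y \<in> Delta" for x y
    using that by (simp add: abs_le_iff minus_le_iff)
  from approx_value_bounds[OF cval_approx[OF F] this] show ?thesis by (simp add: abs_le_iff minus_le_iff)
qed

end

text \<open>The payoff decouples over the states: the summand of \<open>\<omega>\<close> depends on
  \<open>x \<omega>\<close> and \<open>y \<omega>\<close> only. Choices that are
  \<open>e\<close>-optimal state by state are therefore \<open>e\<close>-optimal together, the
  weights having sum 1.\<close>

lemma approx_value_product:
  fixes c :: "'w::finite \<Rightarrow> real"
  assumes v: "\<And>\<omega>. approx_value A B (F \<omega>) (c \<omega>)" and \<zeta>: "\<And>\<omega>. 0 \<le> \<zeta> \<omega>" "(\<Sum>\<omega>\<in>UNIV. \<zeta> \<omega>) = 1"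
  shows "approx_value (UNIV \<rightarrow> A) (UNIV \<rightarrow> B) (\<lambda>x y. \<Sum>\<omega>\<in>UNIV. \<zeta> \<omega> * F \<omega> (x \<omega>) (y \<omega>)) (\<Sum>\<omega>\<in>UNIV. \<zeta> \<omega> * c \<omega>)"
  unfolding approx_value_def
proof (intro conjI allI impI)
  fix e :: real assume "e > 0"
  have eq: "(\<Sum>\<omega>\<in>UNIV. \<zeta> \<omega> * (c \<omega> + d)) = (\<Sum>\<omega>\<in>UNIV. \<zeta> \<omega> * c \<omega>) + d" for d
    using \<zeta>(2) by (simp add: algebra_simps sum.distrib flip: sum_distrib_left)
  have "\<forall>\<omega>. \<exists>a. a \<in> A \<and> (\<forall>b\<in>B. c \<omega> - e \<le> F \<omega> a b)" using v \<open>e > 0\<close> unfolding approx_value_def by blast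
  then obtain x where x: "\<And>\<omega>. x \<omega> \<in> A" "\<And>\<omega> b. b \<in> B \<Longrightarrow> c \<omega> - e \<le> F \<omega> (x \<omega>) b" by metis
  show "\<exists>a\<in>(UNIV :: 'w set) \<rightarrow> A. \<forall>b\<in>UNIV \<rightarrow> B. (\<Sum>\<omega>\<in>UNIV. \<zeta> \<omega> * c \<omega>) - e \<le> (\<Sum>\<omega>\<in>UNIV. \<zeta> \<omega> * F \<omega> (a \<omega>) (b \<omega>))"
  proof (intro bexI[of _ x] ballI)
    fix y :: "'w \<Rightarrow> _" assume "y \<in> UNIV \<rightarrow> B"
    then have "(\<Sum>\<omega>\<in>UNIV. \<zeta> \<omega> * (c \<omega> + (- e))) \<le> (\<Sum>\<omega>\<in>UNIV. \<zeta> \<omega> * F \<omega> (x \<omega>) (y \<omega>))"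
      using x(2) \<zeta>(1) by (intro sum_mono mult_left_mono) auto
    then show "(\<Sum>\<omega>\<in>UNIV. \<zeta> \<omega> * c \<omega>) - e \<le> (\<Sum>\<omega>\<in>UNIV. \<zeta> \<omega> * F \<omega> (x \<omega>) (y \<omega>))" unfolding eq by simp
  qed (use x in auto)
  have "\<forall>\<omega>. \<exists>b. b \<in> B \<and> (\<forall>a\<in>A. F \<omega> a b \<le> c \<omega> + e)" using v \<open>e > 0\<close> unfolding approx_value_def by blast
  then obtain y where y: "\<And>\<omega>. y \<omega> \<in> B" "\<And>\<omega> a. a \<in> A \<Longrightarrow> F \<omega> a (y \<omega>) \<le> c \<omega> + e" by metis
  show "\<exists>b\<in>(UNIV :: 'w set) \<rightarrow> B. \<forall>a\<in>UNIV \<rightarrow> A. (\<Sum>\<omega>\<in>UNIV. \<zeta> \<omega> * F \<omega> (a \<omega>) (b \<omega>)) \<le> (\<Sum>\<omega>\<in>UNIV. \<zeta> \<omega> * c \<omega>) + e"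
  proof (intro bexI[of _ y] ballI)
    fix x :: "'w \<Rightarrow> _" assume "x \<in> UNIV \<rightarrow> A"
    then have "(\<Sum>\<omega>\<in>UNIV. \<zeta> \<omega> * F \<omega> (x \<omega>) (y \<omega>)) \<le> (\<Sum>\<omega>\<in>UNIV. \<zeta> \<omega> * (c \<omega> + e))"
      using y(2) \<zeta>(1) by (intro sum_mono mult_left_mono) auto
    then show "(\<Sum>\<omega>\<in>UNIV. \<zeta> \<omega> * F \<omega> (x \<omega>) (y \<omega>)) \<le> (\<Sum>\<omega>\<in>UNIV. \<zeta> \<omega> * c \<omega>) + e" unfolding eq .
  qed (use y in auto)
qed

section \<open>The Hamiltonians and the limit equation\<close>

locale markov_game = compact_actions TI TJ
  for TI :: "'i::metric_space itself" and TJ :: "'j::metric_space itself" +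
  fixes g :: "'w::finite \<Rightarrow> 'i \<Rightarrow> 'j \<Rightarrow> real" and k :: "real \<Rightarrow> real" and q :: "'i \<Rightarrow> 'j \<Rightarrow> real^'w^'w"
    and M lam L :: real
  assumes g_cont: "\<And>\<omega>. cont2 (g \<omega>)"
    and k_nonneg: "\<And>t. t \<ge> 0 \<Longrightarrow> k t \<ge> 0" and k_lipschitz: "L-lipschitz_on {0..} k"
    and k_integrable: "set_integrable lborel {0..} k"
    and q_rate: "transition_rate q" and q_cont: "cont2 q"
    and g_bound: "\<And>\<omega> i j. \<bar>g \<omega> i j\<bar> \<le> M"
    and q_bound: "\<And>i j. row_bounded lam (q i j)" and lam_pos: "0 < lam"
begin

lemma M_nonneg: "0 \<le> M"
  using g_bound by (meson abs_ge_zero order_trans)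

text \<open>The weight \<kappa> stands for \<open>k t\<close>. Keeping it apart from the time lets
  the same Hamiltonian be used with the extended density \<open>kk\<close> and compared at two
  different times.\<close>

definition Lag :: "real \<Rightarrow> 'w \<Rightarrow> ('w \<Rightarrow> real) \<Rightarrow> 'i \<Rightarrow> 'j \<Rightarrow> real" where
  "Lag \<kappa> z a i j = g z i j * \<kappa> + (\<Sum>z'\<in>UNIV. q i j $ z $ z' * a z')"

definition Ham :: "real \<Rightarrow> 'w \<Rightarrow> ('w \<Rightarrow> real) \<Rightarrow> real" where
  "Ham \<kappa> z a = cval (Lag \<kappa> z a)"

lemma g_cont': "continuous_on UNIV (\<lambda>p. g z (fst p) (snd p))"
  using g_cont[of z] by (simp add: split_beta')

lemma q_cont': "continuous_on UNIV (\<lambda>p. q (fst p) (snd p) $ z $ z')"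
  using q_cont by (intro continuous_intros) (simp add: split_beta')

lemma Lag_cont: "cont2 (Lag \<kappa> z a)"
  unfolding Lag_def[abs_def] split_beta' by (intro continuous_intros g_cont' q_cont')

lemma mixed_ext_Lag:
  assumes x: "x \<in> Delta" and y: "y \<in> Delta"
  shows "mixed_ext (g z) x y * \<kappa> + (\<Sum>z'\<in>UNIV. mixed_ext q x y $ z $ z' * a z') = mixed_ext (Lag \<kappa> z a) x y"
proof -
  have ig: "integrable (x \<Otimes>\<^sub>M y) (\<lambda>p. g z (fst p) (snd p))" by (rule cont2_integrable[OF g_cont x y])
  have iq: "integrable (x \<Otimes>\<^sub>M y) (\<lambda>p. q (fst p) (snd p))" by (rule cont2_integrable[OF q_cont x y])
  have bl: "bounded_linear (\<lambda>A :: real^'w^'w. A $ z $ z')" for z'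
    by (rule bounded_linear_compose[OF bounded_linear_vec_nth bounded_linear_vec_nth])
  have e: "mixed_ext q x y $ z $ z' = (\<integral>p. q (fst p) (snd p) $ z $ z' \<partial>(x \<Otimes>\<^sub>M y))" for z'
    unfolding mixed_ext_def by (rule integral_bounded_linear[OF bl iq, symmetric])
  have i: "integrable (x \<Otimes>\<^sub>M y) (\<lambda>p. q (fst p) (snd p) $ z $ z')" for z'
    by (rule integrable_bounded_linear[OF bl iq])
  show ?thesis unfolding e unfolding Lag_def mixed_ext_def using ig i by simp
qed

lemma state_hamiltonian_eq: "state_hamiltonian g k q t z a = Ham (k t) z a"
proof -
  obtain B where B: "\<And>i j. norm (Lag (k t) z a i j) \<le> B" using cont2_bounded[OF Lag_cont] by blast
  show ?thesis
    unfolding state_hamiltonian_def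
  proof (rule game_val_eqI)
    show "approx_value Delta Delta (\<lambda>x y. mixed_ext (g z) x y * k t + (\<Sum>z'\<in>UNIV. mixed_ext q x y $ z $ z' * a z')) (Ham (k t) z a)"
      using cval_approx[OF Lag_cont] unfolding Ham_def
      by (subst approx_value_cong[OF mixed_ext_Lag])
    show "\<bar>mixed_ext (g z) x y * k t + (\<Sum>z'\<in>UNIV. mixed_ext q x y $ z $ z' * a z')\<bar> \<le> B"
      if "x \<in> Delta" "y \<in> Delta" for x y
      using mixed_ext_bound[OF cont2_measurable[OF Lag_cont] B that] by (simp add: mixed_ext_Lag that)
  qed
qed

lemma simplex_hamiltonian_eq:
  assumes \<zeta>: "\<zeta> \<in> prob_simplex"
  shows "simplex_hamiltonian g k q t \<zeta> a = (\<Sum>\<omega>\<in>UNIV. \<zeta> $ \<omega> * Ham (k t) \<omega> (\<lambda>z. a $ z))"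
proof -
  have z: "0 \<le> \<zeta> $ \<omega>" "(\<Sum>\<omega>\<in>UNIV. \<zeta> $ \<omega>) = 1" for \<omega> using \<zeta> by (auto simp: prob_simplex_def)
  let ?F = "\<lambda>x y. \<Sum>\<omega>\<in>UNIV. \<zeta> $ \<omega> * mixed_ext (Lag (k t) \<omega> (\<lambda>z. a $ z)) (x \<omega>) (y \<omega>)"
  have eq: "(\<Sum>\<omega>\<in>UNIV. \<zeta> $ \<omega> * mixed_ext (g \<omega>) (x \<omega>) (y \<omega>)) * k t + drift q \<zeta> x y \<bullet> a = ?F x y"
    if "x \<in> UNIV \<rightarrow> Delta" "y \<in> UNIV \<rightarrow> Delta" for x y
  proof -
    have "drift q \<zeta> x y \<bullet> a = (\<Sum>z\<in>UNIV. \<Sum>\<omega>\<in>UNIV. \<zeta> $ \<omega> * mixed_ext q (x \<omega>) (y \<omega>) $ \<omega> $ z * a $ z)"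
      by (simp add: drift_def inner_vec_def sum_distrib_right)
    also have "\<dots> = (\<Sum>\<omega>\<in>UNIV. \<zeta> $ \<omega> * (\<Sum>z\<in>UNIV. mixed_ext q (x \<omega>) (y \<omega>) $ \<omega> $ z * a $ z))"
      by (subst sum.swap) (simp add: sum_distrib_left mult.assoc)
    finally show ?thesis
      using that
      by (simp add: Pi_iff sum_distrib_right mult.assoc flip: mixed_ext_Lag)
         (simp add: distrib_left sum.distrib)
  qed
  have "\<exists>B. \<forall>i j. norm (Lag (k t) \<omega> (\<lambda>z. a $ z) i j) \<le> B" for \<omega> using cont2_bounded[OF Lag_cont] by blast
  then obtain B where B: "\<And>\<omega> i j. norm (Lag (k t) \<omega> (\<lambda>z. a $ z) i j) \<le> B \<omega>" by metis
  show ?thesis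
    unfolding simplex_hamiltonian_def
  proof (rule game_val_eqI)
    show "approx_value (UNIV \<rightarrow> Delta) (UNIV \<rightarrow> Delta)
      (\<lambda>x y. (\<Sum>\<omega>\<in>UNIV. \<zeta> $ \<omega> * mixed_ext (g \<omega>) (x \<omega>) (y \<omega>)) * k t + drift q \<zeta> x y \<bullet> a)
      (\<Sum>\<omega>\<in>UNIV. \<zeta> $ \<omega> * Ham (k t) \<omega> (\<lambda>z. a $ z))"
      using approx_value_product[OF cval_approx[OF Lag_cont] z] unfolding Ham_def
      by (subst approx_value_cong[OF eq])
    show "\<bar>(\<Sum>\<omega>\<in>UNIV. \<zeta> $ \<omega> * mixed_ext (g \<omega>) (x \<omega>) (y \<omega>)) * k t + drift q \<zeta> x y \<bullet> a\<bar> \<le> (\<Sum>\<omega>\<in>UNIV. \<zeta> $ \<omega> * B \<omega>)"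
      if xy: "x \<in> UNIV \<rightarrow> Delta" "y \<in> UNIV \<rightarrow> Delta" for x y
    proof -
      have "\<bar>mixed_ext (Lag (k t) \<omega> (\<lambda>z. a $ z)) (x \<omega>) (y \<omega>)\<bar> \<le> B \<omega>" for \<omega>
        using mixed_ext_bound[OF cont2_measurable[OF Lag_cont] B, of "x \<omega>" "y \<omega>"] xy by (simp add: Pi_iff)
      then show ?thesis
        unfolding eq[OF xy] using z
        by (intro order_trans[OF sum_abs] sum_mono) (simp add: abs_mult mult_left_mono)
    qed
  qed
qed

text \<open>\<open>R i j / lam\<close> is a stochastic matrix; this makes \<open>Gen\<close>, in contrast to \<open>Ham\<close>, monotone.\<close>

definition R :: "'i \<Rightarrow> 'j \<Rightarrow> 'w \<Rightarrow> 'w \<Rightarrow> real" where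
  "R i j z z' = q i j $ z $ z' + (if z' = z then lam else 0)"

definition Gen :: "real \<Rightarrow> 'w \<Rightarrow> ('w \<Rightarrow> real) \<Rightarrow> real" where
  "Gen \<kappa> z a = cval (\<lambda>i j. g z i j * \<kappa> + (\<Sum>z'\<in>UNIV. R i j z z' * a z'))"

lemma R_nonneg: "0 \<le> R i j z z'"
  using transition_rateD(1)[OF q_rate, of z' z i j] row_bounded_entry[OF q_bound, of i j z z]
  by (auto simp: R_def)

lemma R_sum: "(\<Sum>z'\<in>UNIV. R i j z z') = lam"
  using transition_rateD(2)[OF q_rate, of i j z] by (simp add: R_def sum.distrib)

lemma R_expand: "(\<Sum>z'\<in>UNIV. R i j z z' * a z') = (\<Sum>z'\<in>UNIV. q i j $ z $ z' * a z') + lam * a z"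
proof -
  have "(\<Sum>z'\<in>UNIV. (if z' = z then lam else 0) * a z') = lam * a z"
    by (simp add: if_distrib[of "\<lambda>x. x * _"] cong: if_cong)
  then show ?thesis by (simp add: R_def distrib_right sum.distrib)
qed

lemma Gen_cont2: "cont2 (\<lambda>i j. g z i j * \<kappa> + (\<Sum>z'\<in>UNIV. R i j z z' * a z'))"
  unfolding R_def split_beta' by (intro continuous_intros g_cont' q_cont')

text \<open>The added term \<open>lam * a z\<close> does not depend on the actions, so it passes out
  of the value.\<close>

lemma Gen_eq: "Gen \<kappa> z a = Ham \<kappa> z a + lam * a z"
proof -
  have "(\<lambda>i j. g z i j * \<kappa> + (\<Sum>z'\<in>UNIV. R i j z z' * a z')) = (\<lambda>i j. lam * a z + 1 * Lag \<kappa> z a i j)"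
    by (simp add: fun_eq_iff Lag_def R_expand)
  then show ?thesis using cval_affine[OF Lag_cont[of \<kappa> z a], of 1 "lam * a z"] by (simp add: Gen_def Ham_def)
qed

lemma R_sum_abs: "(\<And>w. \<bar>a w\<bar> \<le> d) \<Longrightarrow> \<bar>\<Sum>z'\<in>UNIV. R i j z z' * a z'\<bar> \<le> lam * d"
proof -
  assume d: "\<And>w. \<bar>a w\<bar> \<le> d"
  have "\<bar>\<Sum>z'\<in>UNIV. R i j z z' * a z'\<bar> \<le> (\<Sum>z'\<in>UNIV. R i j z z' * d)"
    by (intro order_trans[OF sum_abs] sum_mono) (simp add: abs_mult R_nonneg mult_left_mono d)
  then show ?thesis by (simp add: R_sum flip: sum_distrib_right)
qed

lemma Gen_mono: "(\<And>w. a w \<le> b w) \<Longrightarrow> Gen \<kappa> z a \<le> Gen \<kappa> z b"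
  using cval_mono[OF Gen_cont2[of z \<kappa> a] Gen_cont2[of z \<kappa> b], of 0]
  unfolding Gen_def by (simp add: sum_mono mult_left_mono R_nonneg)

lemma Gen_lipschitz:
  assumes "\<And>w. \<bar>a w - b w\<bar> \<le> d"
  shows "\<bar>Gen \<kappa> z a - Gen \<kappa>' z b\<bar> \<le> M * \<bar>\<kappa> - \<kappa>'\<bar> + lam * d"
  unfolding Gen_def
proof (rule cval_abs_diff_le[OF Gen_cont2 Gen_cont2])
  fix i j
  have "\<bar>g z i j * (\<kappa> - \<kappa>')\<bar> \<le> M * \<bar>\<kappa> - \<kappa>'\<bar>"
    by (simp add: abs_mult mult_right_mono g_bound)
  moreover have "\<bar>\<Sum>z'\<in>UNIV. R i j z z' * (a z' - b z')\<bar> \<le> lam * d" by (rule R_sum_abs) (rule assms)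
  ultimately show "\<bar>g z i j * \<kappa> + (\<Sum>z'\<in>UNIV. R i j z z' * a z') - (g z i j * \<kappa>' + (\<Sum>z'\<in>UNIV. R i j z z' * b z'))\<bar>
      \<le> M * \<bar>\<kappa> - \<kappa>'\<bar> + lam * d"
    by (simp add: right_diff_distrib sum_subtractf)
qed

lemma Gen_bound:
  assumes "\<And>w. \<bar>a w\<bar> \<le> d"
  shows "\<bar>Gen \<kappa> z a\<bar> \<le> M * \<bar>\<kappa>\<bar> + lam * d"
  unfolding Gen_def
proof (rule cval_abs_le[OF Gen_cont2])
  fix i j
  have "\<bar>g z i j * \<kappa>\<bar> \<le> M * \<bar>\<kappa>\<bar>"
    by (simp add: abs_mult mult_right_mono g_bound)
  with R_sum_abs[of a d i j z, OF assms]
  show "\<bar>g z i j * \<kappa> + (\<Sum>z'\<in>UNIV. R i j z z' * a z')\<bar> \<le> M * \<bar>\<kappa>\<bar> + lam * d" by linarith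
qed

lemma Ham_lipschitz:
  assumes "\<And>w. \<bar>a w - b w\<bar> \<le> d"
  shows "\<bar>Ham \<kappa> z a - Ham \<kappa>' z b\<bar> \<le> M * \<bar>\<kappa> - \<kappa>'\<bar> + 2 * lam * d"
proof -
  have "\<bar>lam * (a z - b z)\<bar> \<le> lam * d" using assms[of z] lam_pos by (simp add: abs_mult)
  with Gen_lipschitz[where a = a and b = b and \<kappa> = \<kappa> and z = z and \<kappa>' = \<kappa>', OF assms] show ?thesis
    unfolding Gen_eq by (simp add: right_diff_distrib abs_le_iff)
qed

text \<open>A row of \<open>R\<close> has nonnegative entries with sum \<open>lam\<close>, so
  applied to \<open>a - b\<close> it gives at most \<open>lam * (a z - b z)\<close>; by
  \<open>R_expand\<close> this is exactly the diagonal correction.\<close>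

lemma Ham_elliptic:
  assumes "\<And>w. a w - b w \<le> a z - b z"
  shows "Ham \<kappa> z a \<le> Ham \<kappa> z b"
proof -
  have "Lag \<kappa> z a i j \<le> Lag \<kappa> z b i j + 0" for i j
  proof -
    have "(\<Sum>z'\<in>UNIV. R i j z z' * (a z' - b z')) \<le> (\<Sum>z'\<in>UNIV. R i j z z' * (a z - b z))"
      by (intro sum_mono mult_left_mono assms R_nonneg)
    also have "\<dots> = lam * (a z - b z)" by (simp add: R_sum flip: sum_distrib_right)
    finally show ?thesis unfolding R_expand Lag_def by (simp add: right_diff_distrib sum_subtractf)
  qed
  then show ?thesis unfolding Ham_def using cval_mono[OF Lag_cont Lag_cont] by fastforce
qed

lemma elliptic_states_hamiltonian: "elliptic_states (state_hamiltonian g k q)"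
  unfolding elliptic_states_def state_hamiltonian_eq using Ham_elliptic by blast

lemma elliptic_simplex_hamiltonian: "elliptic_simplex (simplex_hamiltonian g k q)"
  unfolding elliptic_simplex_def
proof (intro allI ballI impI)
  fix t \<zeta> and a b :: "real^'w"
  assume \<zeta>: "\<zeta> \<in> prob_simplex" and le: "\<forall>\<xi>\<in>prob_simplex. (\<xi> - \<zeta>) \<bullet> (a - b) \<le> 0"
  have "\<zeta> $ \<omega> * Ham (k t) \<omega> (\<lambda>z. a $ z) \<le> \<zeta> $ \<omega> * Ham (k t) \<omega> (\<lambda>z. b $ z)" for \<omega>
  proof (cases "\<zeta> $ \<omega> = 0")
    case False
    then have pos: "0 < \<zeta> $ \<omega>" using \<zeta> by (simp add: prob_simplex_def less_le)
    have "a $ z - b $ z \<le> a $ \<omega> - b $ \<omega>" for z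
    proof -
      \<comment> \<open>All the mass at \<open>\<omega>\<close> is moved to \<open>z\<close>. This
        keeps the point in the simplex, and the normal cone condition turns into a comparison of two
        coordinates, multiplied by the positive weight of \<open>\<omega>\<close>.\<close>
      let ?\<xi> = "\<zeta> + \<zeta> $ \<omega> *\<^sub>R (axis z 1 - axis \<omega> 1)"
      have "?\<xi> \<in> prob_simplex"
        using \<zeta> pos by (auto simp: prob_simplex_def axis_def sum.distrib sum_subtractf simp flip: sum_distrib_left)
      with le have "(?\<xi> - \<zeta>) \<bullet> (a - b) \<le> 0" by blast
      also have "(?\<xi> - \<zeta>) \<bullet> (a - b) = \<zeta> $ \<omega> * ((a $ z - b $ z) - (a $ \<omega> - b $ \<omega>))"
        by (simp add: inner_diff_left inner_axis' algebra_simps)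
      finally show ?thesis using pos by (simp add: mult_le_0_iff)
    qed
    then show ?thesis using pos by (intro mult_left_mono Ham_elliptic) auto
  qed simp
  then show "simplex_hamiltonian g k q t \<zeta> a \<le> simplex_hamiltonian g k q t \<zeta> b"
    unfolding simplex_hamiltonian_eq[OF \<zeta>] by (intro sum_mono)
qed

section \<open>The tail mass of the density and the construction of the classical solution\<close>

text \<open>The density is extended to negative times so that \<open>sol\<close> below has a two-sided derivative at \<open>0\<close>,
  as the test functions of \<open>C1_simplex\<close> must.\<close>

definition kk :: "real \<Rightarrow> real" where "kk t = k (max 0 t)"

definition K :: "real \<Rightarrow> real" where "K t = (LINT s:{t..}|lborel. kk s)"

lemma k_cont: "continuous_on {0..} k"
  using k_lipschitz by (rule lipschitz_on_continuous_on)

lemma kk_cont: "continuous_on UNIV kk"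
  unfolding kk_def by (intro continuous_on_compose2[OF k_cont] continuous_intros) auto

lemma kk_nonneg: "0 \<le> kk t"
  by (simp add: kk_def k_nonneg)

lemma kk_integrable: "set_integrable lborel {a..} kk"
proof -
  have "set_integrable lborel {0..} kk"
  proof -
    have "set_integrable lborel {0..} kk \<longleftrightarrow> set_integrable lborel {0..} k"
      by (intro set_integrable_cong) (auto simp: kk_def)
    then show ?thesis using k_integrable by simp
  qed
  moreover have "set_integrable lborel {a..0} kk"
    by (intro borel_integrable_atLeastAtMost' continuous_on_subset[OF kk_cont]) auto
  ultimately have "set_integrable lborel ({a..0} \<union> {0..}) kk"
    by (intro set_integrable_Un) auto
  then show ?thesis by (rule set_integrable_subset) auto
qed

lemma K_deriv: "(K has_real_derivative - kk t) (at t)"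
  unfolding K_def[abs_def] by (rule half_line_integral_deriv[OF kk_integrable kk_cont])

lemma K_cont: "continuous_on UNIV K"
  unfolding K_def[abs_def] by (rule half_line_integral_continuous[OF kk_integrable])

lemma K_tendsto_0: "(K \<longlongrightarrow> 0) at_top"
  unfolding K_def[abs_def] by (rule half_line_integral_tendsto_0[OF kk_integrable[of 0]])

lemma K_nonneg: "0 \<le> K t"
  unfolding K_def set_lebesgue_integral_def by (intro integral_nonneg_AE) (simp add: kk_nonneg)

lemma K_antimono: "s \<le> t \<Longrightarrow> K t \<le> K s"
  by (rule DERIV_nonpos_imp_nonincreasing[of s t K]) (use K_deriv kk_nonneg in \<open>auto intro!: exI[of _ "- kk _"]\<close>)

definition maj :: "real \<Rightarrow> real" where "maj s = exp (- lam * s) * (kk s + lam * K s)"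

lemma maj_cont: "continuous_on UNIV maj"
  unfolding maj_def by (intro continuous_intros kk_cont K_cont)

lemma maj_nonneg: "0 \<le> maj s"
  using lam_pos by (simp add: maj_def kk_nonneg K_nonneg)

text \<open>\<open>- exp (- lam s) K s\<close> is a primitive of \<open>maj\<close>, so that \<open>K\<close> is a fixed point of the linear
  counterpart of the operator \<open>iter\<close> below.\<close>

lemma maj_integral:
  shows maj_integrable: "set_integrable lborel {t..} maj"
    and maj_LINT: "(LINT s:{t..}|lborel. maj s) = exp (- lam * t) * K t"
proof -
  have m: "maj \<in> borel_measurable borel" by (rule borel_measurable_continuous_onI[OF maj_cont])
  have "((\<lambda>s. - (exp (- lam * s) * K s)) \<longlongrightarrow> - (0 * 0)) at_top"
  proof (intro tendsto_intros K_tendsto_0)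
    have "filterlim (\<lambda>s. - lam * s) at_bot at_top"
      using lam_pos by (intro filterlim_tendsto_neg_mult_at_bot[OF tendsto_const] filterlim_ident) auto
    then show "((\<lambda>s. exp (- lam * s)) \<longlongrightarrow> 0) at_top"
      by (rule filterlim_compose[OF exp_at_bot])
  qed
  then have lim: "((\<lambda>s. - (exp (- lam * s) * K s)) \<longlongrightarrow> 0) at_top" by simp
  have *: "(\<integral>\<^sup>+s. ennreal (maj s) * indicator {t..} s \<partial>lborel) = 0 - - (exp (- lam * t) * K t)"
    by (rule nn_integral_FTC_atLeast[OF m _ maj_nonneg lim])
       (auto intro!: derivative_eq_intros K_deriv simp: maj_def algebra_simps)
  have nn: "(\<integral>\<^sup>+s. ennreal (indicator {t..} s *\<^sub>R maj s) \<partial>lborel) = exp (- lam * t) * K t"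
  proof -
    have "(\<integral>\<^sup>+s. ennreal (indicator {t..} s *\<^sub>R maj s) \<partial>lborel) = (\<integral>\<^sup>+s. ennreal (maj s) * indicator {t..} s \<partial>lborel)"
      by (intro nn_integral_cong) (auto simp: indicator_def)
    with * show ?thesis by simp
  qed
  have "has_bochner_integral lborel (\<lambda>s. indicator {t..} s *\<^sub>R maj s) (exp (- lam * t) * K t)"
    using m nn by (intro has_bochner_integral_nn_integral) (auto simp: maj_nonneg K_nonneg)
  then show "set_integrable lborel {t..} maj" "(LINT s:{t..}|lborel. maj s) = exp (- lam * t) * K t"
    unfolding set_integrable_def set_lebesgue_integral_def by (auto simp: has_bochner_integral_iff)
qed

definition integrand :: "(real \<Rightarrow> 'w \<Rightarrow> real) \<Rightarrow> 'w \<Rightarrow> real \<Rightarrow> real" where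
  "integrand w z s = exp (- lam * s) * Gen (kk s) z (w s)"

text \<open>The integral form of \<open>u' = lam * u - Gen\<close>, which is the equation for
  \<open>Ham\<close>, with integrating factor \<open>exp (- lam * t)\<close> and no contribution
  from infinity. As \<open>Gen\<close> is monotone, so is \<open>iter\<close>; monotone iteration
  thus replaces a contraction argument.\<close>

definition iter :: "(real \<Rightarrow> 'w \<Rightarrow> real) \<Rightarrow> real \<Rightarrow> 'w \<Rightarrow> real" where
  "iter w t z = exp (lam * t) * (LINT s:{t..}|lborel. integrand w z s)"

lemma integrand_bound:
  assumes "\<And>z. \<bar>w s z\<bar> \<le> M * K s" shows "\<bar>integrand w z s\<bar> \<le> M * maj s"
proof -
  have "\<bar>integrand w z s\<bar> \<le> exp (- lam * s) * (M * \<bar>kk s\<bar> + lam * (M * K s))"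
    unfolding integrand_def abs_mult by (simp add: Gen_bound[where a = "w s", OF assms])
  then show ?thesis by (simp add: maj_def kk_nonneg algebra_simps)
qed

lemma integrand_integrable:
  assumes "\<And>s z. \<bar>w s z\<bar> \<le> M * K s" "integrand w z \<in> borel_measurable borel"
  shows "set_integrable lborel {t..} (integrand w z)"
proof (rule set_integrable_bound)
  show "set_integrable lborel {t..} (\<lambda>s. M * maj s)" by (intro set_integrable_mult_right maj_integrable)
  show "set_borel_measurable lborel {t..} (integrand w z)" using assms(2) by (simp add: set_borel_measurable_def)
  show "AE s in lborel. s \<in> {t..} \<longrightarrow> norm (integrand w z s) \<le> norm (M * maj s)"
    by (intro AE_I2 impI) (simp add: order_trans[OF integrand_bound[of w, OF assms(1)] abs_ge_self])
qed

lemma iter_bound: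
  assumes "\<And>s z. \<bar>w s z\<bar> \<le> M * K s" "\<And>z. integrand w z \<in> borel_measurable borel"
  shows "\<bar>iter w t z\<bar> \<le> M * K t"
proof -
  have "norm (LINT s:{t..}|lborel. integrand w z s) \<le> (LINT s:{t..}|lborel. norm (integrand w z s))"
    by (rule set_integral_norm_bound[OF integrand_integrable[OF assms]])
  also have "\<dots> \<le> (LINT s:{t..}|lborel. M * maj s)"
    by (intro set_integral_mono set_integrable_norm integrand_integrable assms set_integrable_mult_right maj_integrable)
       (simp add: integrand_bound[of w, OF assms(1)])
  finally have "\<bar>LINT s:{t..}|lborel. integrand w z s\<bar> \<le> M * (exp (- lam * t) * K t)"
    by (simp add: maj_LINT)
  then have "\<bar>iter w t z\<bar> \<le> exp (lam * t) * (M * (exp (- lam * t) * K t))"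
    unfolding iter_def abs_mult by simp
  also have "\<dots> = M * K t" by (simp add: exp_minus)
  finally show ?thesis .
qed

lemma integrand_cont:
  assumes "\<And>z. continuous_on UNIV (\<lambda>s. w s z)"
  shows "continuous_on UNIV (integrand w z)"
proof -
  have "isCont (\<lambda>s. Gen (kk s) z (w s)) s" for s
    unfolding isCont_def
  proof (rule LIM_zero_cancel, rule Lim_null_comparison)
    have "\<bar>w r y - w s y\<bar> \<le> (\<Sum>y\<in>UNIV. \<bar>w r y - w s y\<bar>)" for r y by (rule member_le_sum) auto
    then show "\<forall>\<^sub>F r in at s. norm (Gen (kk r) z (w r) - Gen (kk s) z (w s)) \<le>
        M * \<bar>kk r - kk s\<bar> + lam * (\<Sum>y\<in>UNIV. \<bar>w r y - w s y\<bar>)"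
      by (auto intro!: always_eventually Gen_lipschitz)
    have "(kk \<longlongrightarrow> kk s) (at s)" "((\<lambda>s. w s y) \<longlongrightarrow> w s y) (at s)" for y
      using kk_cont assms[of y] by (auto simp: continuous_on_eq_continuous_at isCont_def)
    then have "((\<lambda>r. M * \<bar>kk r - kk s\<bar> + lam * (\<Sum>y\<in>UNIV. \<bar>w r y - w s y\<bar>)) \<longlongrightarrow>
        M * \<bar>kk s - kk s\<bar> + lam * (\<Sum>y\<in>UNIV. \<bar>w s y - w s y\<bar>)) (at s)"
      by (intro tendsto_intros)
    then show "((\<lambda>r. M * \<bar>kk r - kk s\<bar> + lam * (\<Sum>y\<in>UNIV. \<bar>w r y - w s y\<bar>)) \<longlongrightarrow> 0) (at s)" by simp
  qed
  then show ?thesis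
    unfolding integrand_def[abs_def] by (intro continuous_intros) (simp add: continuous_at_imp_continuous_on)
qed

lemma iter_cont:
  assumes "\<And>s z. \<bar>w s z\<bar> \<le> M * K s" "\<And>z. integrand w z \<in> borel_measurable borel"
  shows "continuous_on UNIV (\<lambda>t. iter w t z)"
  unfolding iter_def
  by (intro continuous_intros half_line_integral_continuous integrand_integrable assms)

lemma iter_mono:
  assumes "\<And>s z. \<bar>w s z\<bar> \<le> M * K s" "\<And>z. integrand w z \<in> borel_measurable borel"
    and "\<And>s z. \<bar>w' s z\<bar> \<le> M * K s" "\<And>z. integrand w' z \<in> borel_measurable borel"
    and "\<And>s z. w s z \<le> w' s z"
  shows "iter w t z \<le> iter w' t z"
  unfolding iter_def
  by (intro mult_left_mono set_integral_mono integrand_integrable assms)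
     (auto simp: integrand_def intro!: Gen_mono assms)

definition approx_sol :: "nat \<Rightarrow> real \<Rightarrow> 'w \<Rightarrow> real" where
  "approx_sol m = (iter ^^ m) (\<lambda>t z. - M * K t)"

lemma approx_sol_props:
  "(\<forall>t z. \<bar>approx_sol m t z\<bar> \<le> M * K t) \<and> (\<forall>z. continuous_on UNIV (\<lambda>t. approx_sol m t z))"
proof (induction m)
  case 0 show ?case
    by (auto simp: approx_sol_def abs_mult M_nonneg K_nonneg intro!: continuous_intros K_cont)
next
  case (Suc m)
  then have "integrand (approx_sol m) z \<in> borel_measurable borel" for z
    by (intro borel_measurable_continuous_onI integrand_cont) auto
  with Suc show ?case
    using iter_bound[of "approx_sol m"] iter_cont[of "approx_sol m"] by (auto simp: approx_sol_def)
qed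

lemma approx_sol_meas: "integrand (approx_sol m) z \<in> borel_measurable borel"
  using approx_sol_props[of m] by (intro borel_measurable_continuous_onI integrand_cont) auto

text \<open>The start \<open>- M * K\<close> is the least function within the bound that
  \<open>iter\<close> preserves, so the first iterate lies above it; monotonicity propagates
  this.\<close>

lemma approx_sol_incseq: "approx_sol m t z \<le> approx_sol (Suc m) t z"
proof (induction m arbitrary: t z)
  case 0
  show ?case using approx_sol_props[of "Suc 0"] by (auto simp: approx_sol_def abs_le_iff minus_le_iff)
next
  case (Suc m)
  then have "iter (approx_sol m) t z \<le> iter (approx_sol (Suc m)) t z"
    using approx_sol_props by (intro iter_mono approx_sol_meas) auto
  then show ?case by (simp add: approx_sol_def)
qed

definition sol :: "real \<Rightarrow> 'w \<Rightarrow> real" where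
  "sol t z = lim (\<lambda>m. approx_sol m t z)"

lemma sol_lim: "(\<lambda>m. approx_sol m t z) \<longlonglongrightarrow> sol t z"
proof -
  have "incseq (\<lambda>m. approx_sol m t z)" by (intro incseq_SucI approx_sol_incseq)
  moreover have "\<bar>approx_sol m t z\<bar> \<le> M * K t" for m using approx_sol_props by blast
  then have "approx_sol m t z \<le> M * K t" for m by (simp add: abs_le_iff)
  ultimately have "convergent (\<lambda>m. approx_sol m t z)"
    using incseq_convergent unfolding convergent_def by metis
  then show ?thesis unfolding sol_def by (simp add: convergent_LIMSEQ_iff)
qed

lemma sol_bound: "\<bar>sol t z\<bar> \<le> M * K t"
  using approx_sol_props by (intro LIMSEQ_le_const2[OF tendsto_rabs[OF sol_lim]]) auto

lemma integrand_lim: "(\<lambda>m. integrand (approx_sol m) z s) \<longlonglongrightarrow> integrand sol z s"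
  unfolding integrand_def
proof (intro tendsto_intros, rule LIM_zero_cancel, rule Lim_null_comparison)
  have "\<bar>approx_sol m s y - sol s y\<bar> \<le> (\<Sum>y\<in>UNIV. \<bar>approx_sol m s y - sol s y\<bar>)" for m y by (rule member_le_sum) auto
  from Gen_lipschitz[where \<kappa> = "kk s" and \<kappa>' = "kk s" and z = z, OF this]
  show "\<forall>\<^sub>F m in sequentially. norm (Gen (kk s) z (approx_sol m s) - Gen (kk s) z (sol s)) \<le>
      lam * (\<Sum>y\<in>UNIV. \<bar>approx_sol m s y - sol s y\<bar>)"
    by (auto intro!: always_eventually)
  have "(\<lambda>m. lam * (\<Sum>y\<in>UNIV. \<bar>approx_sol m s y - sol s y\<bar>)) \<longlonglongrightarrow> lam * (\<Sum>y\<in>UNIV. \<bar>sol s y - sol s y\<bar>)"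
    by (intro tendsto_intros sol_lim)
  then show "(\<lambda>m. lam * (\<Sum>y\<in>UNIV. \<bar>approx_sol m s y - sol s y\<bar>)) \<longlonglongrightarrow> 0" by simp
qed

lemma sol_meas: "integrand sol z \<in> borel_measurable borel"
  by (rule borel_measurable_LIMSEQ_real[OF integrand_lim approx_sol_meas])

lemma sol_fixed_point: "sol t z = iter sol t z"
proof -
  have "(\<lambda>m. LINT s:{t..}|lborel. integrand (approx_sol m) z s) \<longlonglongrightarrow> (LINT s:{t..}|lborel. integrand sol z s)"
    unfolding set_lebesgue_integral_def
  proof (rule integral_dominated_convergence[where w = "\<lambda>s. indicator {t..} s *\<^sub>R (M * maj s)"])
    show "(\<lambda>s. indicat_real {t..} s *\<^sub>R integrand sol z s) \<in> borel_measurable lborel"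
      "(\<lambda>s. indicat_real {t..} s *\<^sub>R integrand (approx_sol m) z s) \<in> borel_measurable lborel" for m
      using sol_meas approx_sol_meas by auto
    show "integrable lborel (\<lambda>s. indicat_real {t..} s *\<^sub>R (M * maj s))"
      using set_integrable_mult_right[OF maj_integrable[of t], of M] by (simp add: set_integrable_def)
    show "AE s in lborel. (\<lambda>m. indicat_real {t..} s *\<^sub>R integrand (approx_sol m) z s) \<longlonglongrightarrow> indicat_real {t..} s *\<^sub>R integrand sol z s"
      by (intro AE_I2 tendsto_intros integrand_lim)
    show "AE s in lborel. norm (indicat_real {t..} s *\<^sub>R integrand (approx_sol m) z s) \<le> indicat_real {t..} s *\<^sub>R (M * maj s)" for m
      using integrand_bound[of "approx_sol m"] approx_sol_props[of m]
      by (intro AE_I2) (simp add: abs_mult mult_left_mono)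
  qed
  then have "(\<lambda>m. iter (approx_sol m) t z) \<longlonglongrightarrow> iter sol t z"
    unfolding iter_def by (intro tendsto_intros)
  moreover have "(\<lambda>m. iter (approx_sol m) t z) \<longlonglongrightarrow> sol t z"
    using LIMSEQ_Suc[OF sol_lim[of t z]] by (simp add: approx_sol_def)
  ultimately show ?thesis using LIMSEQ_unique by blast
qed

text \<open>As a pointwise limit, \<open>sol\<close> was so far only known to give a measurable
  integrand, which is why the estimates on \<open>iter\<close> ask for no more. Continuity comes
  from the fixed point equation, and differentiability then from continuity.\<close>

lemma sol_cont: "continuous_on UNIV (\<lambda>t. sol t z)"
  using iter_cont[OF sol_bound sol_meas] by (simp flip: sol_fixed_point)

lemma sol_deriv: "((\<lambda>t. sol t z) has_real_derivative - Ham (kk t) z (sol t)) (at t)"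
proof -
  have "((\<lambda>t. iter sol t z) has_real_derivative
      exp (lam * t) * (- integrand sol z t) + (lam * exp (lam * t)) * (LINT s:{t..}|lborel. integrand sol z s)) (at t)"
    unfolding iter_def
    by (auto intro!: derivative_eq_intros half_line_integral_deriv integrand_integrable sol_bound sol_meas integrand_cont sol_cont)
  also have "exp (lam * t) * (- integrand sol z t) = - Gen (kk t) z (sol t)"
    by (simp add: integrand_def exp_minus)
  also have "(lam * exp (lam * t)) * (LINT s:{t..}|lborel. integrand sol z s) = lam * sol t z"
    by (simp add: sol_fixed_point[of t z] iter_def)
  finally show ?thesis by (simp add: Gen_eq flip: sol_fixed_point)
qed

lemma sol_vanishes: "vanishes_at_infinity UNIV sol"
  unfolding vanishes_at_infinity_def
proof (intro allI impI)
  fix e :: real assume "e > 0"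
  have "((\<lambda>t. M * K t) \<longlongrightarrow> M * 0) at_top" by (intro tendsto_intros K_tendsto_0)
  then have "eventually (\<lambda>t. M * K t < e) at_top" using \<open>e > 0\<close> by (simp add: order_tendstoD(2))
  then obtain T where "\<And>t. t \<ge> T \<Longrightarrow> M * K t < e" by (auto simp: eventually_at_top_linorder)
  then show "\<exists>T\<ge>0. \<forall>t\<ge>T. \<forall>a\<in>UNIV. \<bar>sol t a\<bar> \<le> e"
    by (intro exI[of _ "max 0 T"]) (auto intro: order_trans[OF sol_bound] less_imp_le)
qed

end

section \<open>Stage payoffs and the Shapley operator\<close>

context markov_game
begin

abbreviation tm :: "real \<Rightarrow> 'i \<Rightarrow> 'j \<Rightarrow> 'w \<Rightarrow> 'w \<Rightarrow> real" where
  "tm h i j z z' \<equiv> matrix_exp (h *\<^sub>R q i j) $ z $ z'"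

definition flow :: "real \<Rightarrow> 'w \<Rightarrow> 'i \<Rightarrow> 'j \<Rightarrow> real" where
  "flow h z i j = (\<Sum>z'\<in>UNIV. tm h i j z z' * g z' i j)"

lemmas tm_stochastic = transition_matrix_stochastic[OF q_rate]

lemma tm_avg_le:
  assumes "0 \<le> h" "\<And>w. \<bar>a w\<bar> \<le> d" shows "\<bar>\<Sum>z'\<in>UNIV. tm h i j z z' * a z'\<bar> \<le> d"
proof -
  have "\<bar>\<Sum>z'\<in>UNIV. tm h i j z z' * a z'\<bar> \<le> (\<Sum>z'\<in>UNIV. tm h i j z z' * d)"
    by (intro order_trans[OF sum_abs] sum_mono) (simp add: abs_mult tm_stochastic assms mult_left_mono)
  then show ?thesis using assms(1) by (simp add: tm_stochastic flip: sum_distrib_right)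
qed

lemma flow_bound: "0 \<le> h \<Longrightarrow> \<bar>flow h z i j\<bar> \<le> M"
  unfolding flow_def by (intro tm_avg_le g_bound)

lemma tm_cont: "continuous_on UNIV (\<lambda>p. tm (fst p) (fst (snd p)) (snd (snd p)) z z')"
proof -
  have "continuous_on UNIV (\<lambda>p :: real \<times> 'i \<times> 'j. q (fst (snd p)) (snd (snd p)))"
    by (rule continuous_on_compose2[of UNIV "\<lambda>p. q (fst p) (snd p)" UNIV snd])
       (use q_cont in \<open>auto simp: split_beta' intro!: continuous_intros\<close>)
  then have "continuous_on UNIV (\<lambda>p :: real \<times> 'i \<times> 'j. matrix_exp (fst p *\<^sub>R q (fst (snd p)) (snd (snd p))))"
    by (intro continuous_on_compose2[OF continuous_on_matrix_exp[of UNIV]] continuous_intros) auto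
  then show ?thesis by (intro continuous_intros)
qed

lemma tm_cont2: "cont2 (\<lambda>i j. tm h i j z z')"
  using continuous_on_compose2[OF tm_cont, of UNIV "\<lambda>p. (h, fst p, snd p)"]
  by (simp add: split_beta' continuous_intros)

lemma flow_cont: "continuous_on UNIV (\<lambda>p. flow (fst p) z (fst (snd p)) (snd (snd p)))"
  unfolding flow_def
  by (intro continuous_intros tm_cont continuous_on_compose2[OF g_cont'])  auto

lemma flow_cont_time: "continuous_on UNIV (\<lambda>t. flow (t - c) z i j)"
  using continuous_on_compose2[OF flow_cont, of UNIV "\<lambda>t. (t - c, i, j)"] by (simp add: continuous_intros)

lemma flow_cont2: "continuous_on UNIV (\<lambda>p. flow h z (fst p) (snd p))"
  using continuous_on_compose2[OF flow_cont, of UNIV "\<lambda>p. (h, fst p, snd p)"] by (simp add: continuous_intros)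

end

locale partition_game = markov_game TI TJ g k q M lam L
  for TI :: "'i::metric_space itself" and TJ :: "'j::metric_space itself"
    and g :: "'w::finite \<Rightarrow> 'i \<Rightarrow> 'j \<Rightarrow> real" and k q M lam L +
  fixes \<pi> :: "nat \<Rightarrow> real"
  assumes partition: "is_partition \<pi>"
begin

lemma pi_0: "\<pi> 0 = 0" and pi_strict: "strict_mono \<pi>" and pi_lim: "filterlim \<pi> at_top sequentially"
  using partition by (auto simp: is_partition_def)

lemma pi_mono: "m \<le> n \<Longrightarrow> \<pi> m \<le> \<pi> n"
  using pi_strict by (simp add: strict_mono_less_eq)

lemma pi_nonneg: "0 \<le> \<pi> n"
  using pi_mono[of 0 n] by (simp add: pi_0)

lemma pi_less_Suc: "\<pi> n < \<pi> (Suc n)"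
  using pi_strict by (simp add: strict_mono_Suc_iff)

lemma stage_at_eqI: "\<pi> n \<le> t \<Longrightarrow> t < \<pi> (Suc n) \<Longrightarrow> stage_at \<pi> t = n"
  unfolding stage_at_def
proof (rule the_equality)
  fix m assume a: "\<pi> n \<le> t" "t < \<pi> (Suc n)" "\<pi> m \<le> t \<and> t < \<pi> (Suc m)"
  then have "\<pi> n < \<pi> (Suc m)" "\<pi> m < \<pi> (Suc n)" by auto
  then show "m = n" using strict_mono_less[OF pi_strict] by (metis less_Suc_eq not_less_eq)
qed simp

lemma stage_at:
  assumes "0 \<le> t"
  shows "\<pi> (stage_at \<pi> t) \<le> t" "t < \<pi> (Suc (stage_at \<pi> t))"
proof -
  have "\<exists>m. t < \<pi> m"
    using filterlim_at_top_dense[THEN iffD1, OF pi_lim] by (meson eventually_sequentially order_refl)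
  define m where "m = (LEAST m. t < \<pi> m)"
  have m: "t < \<pi> m" "\<And>l. l < m \<Longrightarrow> \<pi> l \<le> t"
    unfolding m_def using \<open>\<exists>m. t < \<pi> m\<close> not_less_Least by (auto intro: LeastI_ex simp: not_less[symmetric])
  have "m \<noteq> 0" using m(1) assms by (intro notI) (simp add: pi_0)
  then obtain n where "m = Suc n" by (meson not0_implies_Suc)
  then have n: "\<pi> n \<le> t" "t < \<pi> (Suc n)" using m by auto
  then show "\<pi> (stage_at \<pi> t) \<le> t" "t < \<pi> (Suc (stage_at \<pi> t))" using stage_at_eqI[OF n] by auto
qed

lemma interval_split:
  assumes "set_integrable lborel {\<pi> n..} f"
  shows "(LINT t:{\<pi> n..}|lborel. f t) = (LINT t:{\<pi> n..<\<pi> (Suc n)}|lborel. f t) + (LINT t:{\<pi> (Suc n)..}|lborel. (f t :: real))"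
proof -
  have "{\<pi> n..} = {\<pi> n..<\<pi> (Suc n)} \<union> {\<pi> (Suc n)..}" using pi_less_Suc[of n] by auto
  then have "(LINT t:{\<pi> n..}|lborel. f t) = (LINT t:{\<pi> n..<\<pi> (Suc n)} \<union> {\<pi> (Suc n)..}|lborel. f t)" by simp
  also have "\<dots> = (LINT t:{\<pi> n..<\<pi> (Suc n)}|lborel. f t) + (LINT t:{\<pi> (Suc n)..}|lborel. f t)"
    using pi_less_Suc[of n] by (intro set_integral_Un) (auto intro: set_integrable_subset[OF assms])
  finally show ?thesis .
qed

lemma K_step: "(LINT t:{\<pi> n..<\<pi> (Suc n)}|lborel. kk t) = K (\<pi> n) - K (\<pi> (Suc n))"
  using interval_split[OF kk_integrable, of n] by (simp add: K_def)

lemma K_pi_lim: "(\<lambda>n. K (\<pi> (n + m))) \<longlonglongrightarrow> 0"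
  by (rule LIMSEQ_ignore_initial_segment) (rule filterlim_compose[OF K_tendsto_0 pi_lim])

definition rew :: "nat \<Rightarrow> 'w \<Rightarrow> 'i \<Rightarrow> 'j \<Rightarrow> real" where
  "rew n z i j = (LINT t:{\<pi> n..<\<pi> (Suc n)}|lborel. flow (t - \<pi> n) z i j * kk t)"

lemma flow_kk_integrable: "set_integrable lborel {\<pi> n..<\<pi> (Suc n)} (\<lambda>t. flow (t - \<pi> n) z i j * kk t)"
proof (rule set_integrable_subset)
  show "set_integrable lborel {\<pi> n..\<pi> (Suc n)} (\<lambda>t. flow (t - \<pi> n) z i j * kk t)"
    by (intro borel_integrable_atLeastAtMost' continuous_intros
        continuous_on_subset[OF flow_cont_time] continuous_on_subset[OF kk_cont]) auto
qed auto

lemma kk_integrable': "set_integrable lborel {\<pi> n..<\<pi> (Suc n)} kk"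
  by (rule set_integrable_subset[OF kk_integrable[of "\<pi> n"]]) auto

lemma flow_kk_bound: "\<pi> n \<le> t \<Longrightarrow> \<bar>flow (t - \<pi> n) z i j * kk t\<bar> \<le> M * kk t"
  by (simp add: abs_mult kk_nonneg mult_right_mono flow_bound)

lemma rew_bound: "\<bar>rew n z i j\<bar> \<le> M * (K (\<pi> n) - K (\<pi> (Suc n)))"
proof -
  have "norm (rew n z i j) \<le> (LINT t:{\<pi> n..<\<pi> (Suc n)}|lborel. norm (flow (t - \<pi> n) z i j * kk t))"
    unfolding rew_def by (rule set_integral_norm_bound[OF flow_kk_integrable])
  also have "\<dots> \<le> (LINT t:{\<pi> n..<\<pi> (Suc n)}|lborel. M * kk t)"
    by (intro set_integral_mono set_integrable_norm flow_kk_integrable set_integrable_mult_right kk_integrable')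
       (simp only: real_norm_def, rule flow_kk_bound, simp)
  finally show ?thesis by (simp add: K_step)
qed

lemma rew_cont2: "cont2 (rew n z)"
proof -
  let ?A = "{\<pi> n..<\<pi> (Suc n)}"
  let ?f = "\<lambda>p t. indicat_real ?A t *\<^sub>R (flow (t - \<pi> n) z (fst p) (snd p) * kk t)"
  have "isCont (\<lambda>p. rew n z (fst p) (snd p)) p" for p
  proof (rule continuous_at_sequentiallyI)
    fix u assume u: "u \<longlonglongrightarrow> p"
    show "(\<lambda>m. rew n z (fst (u m)) (snd (u m))) \<longlonglongrightarrow> rew n z (fst p) (snd p)"
      unfolding rew_def set_lebesgue_integral_def
    proof (rule integral_dominated_convergence[where w = "\<lambda>t. indicator ?A t *\<^sub>R (M * kk t)"])
      have b: "?f p \<in> borel_measurable lborel" for p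
        using flow_kk_integrable[of n z "fst p" "snd p"] unfolding set_integrable_def by (rule borel_measurable_integrable)
      show "(\<lambda>t. ?f p t) \<in> borel_measurable lborel"
        by (rule b)
      show "(\<lambda>t. ?f (u m) t) \<in> borel_measurable lborel" for m
        by (rule b)
      show "integrable lborel (\<lambda>t. indicat_real ?A t *\<^sub>R (M * kk t))"
        using set_integrable_mult_right[OF kk_integrable'[of n], of M] by (simp add: set_integrable_def)
      have "(\<lambda>m. flow h z (fst (u m)) (snd (u m))) \<longlonglongrightarrow> flow h z (fst p) (snd p)" for h
        by (rule continuous_on_tendsto_compose[OF flow_cont2 u]) auto
      then show "AE t in lborel. (\<lambda>m. ?f (u m) t) \<longlonglongrightarrow> ?f p t"
        by (intro AE_I2 tendsto_intros)
      show "AE t in lborel. norm (?f (u m) t) \<le> indicat_real ?A t *\<^sub>R (M * kk t)" for m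
        using flow_kk_bound[of n] by (intro AE_I2) (auto simp: indicator_def)
    qed
  qed
  then show ?thesis by (simp add: split_beta' continuous_at_imp_continuous_on)
qed

section \<open>The Shapley recursion and its limit from finitely many stages\<close>

abbreviation step :: "nat \<Rightarrow> real" where "step n \<equiv> \<pi> (Suc n) - \<pi> n"

lemma step_nonneg: "0 \<le> step n"
  using pi_less_Suc[of n] by simp

definition stagef :: "nat \<Rightarrow> 'w \<Rightarrow> ('w \<Rightarrow> real) \<Rightarrow> 'i \<Rightarrow> 'j \<Rightarrow> real" where
  "stagef n z a i j = rew n z i j + (\<Sum>z'\<in>UNIV. tm (step n) i j z z' * a z')"

definition shapley :: "nat \<Rightarrow> ('w \<Rightarrow> real) \<Rightarrow> 'w \<Rightarrow> real" where
  "shapley n a z = cval (stagef n z a)"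

lemma stagef_cont2: "cont2 (stagef n z a)"
  using rew_cont2[of n z] tm_cont2[of "step n" z]
  unfolding stagef_def[abs_def] split_beta'
  by (intro continuous_on_add continuous_on_sum continuous_on_mult continuous_on_const)

lemma shapley_nonexpansive:
  assumes "\<And>w. \<bar>a w - b w\<bar> \<le> d" shows "\<bar>shapley n a z - shapley n b z\<bar> \<le> d"
  unfolding shapley_def
proof (rule cval_abs_diff_le[OF stagef_cont2 stagef_cont2])
  fix i j
  show "\<bar>stagef n z a i j - stagef n z b i j\<bar> \<le> d"
    using tm_avg_le[of "step n" "\<lambda>w. a w - b w" d i j z, OF step_nonneg assms]
    by (simp add: stagef_def right_diff_distrib sum_subtractf)
qed

lemma shapley_bound:
  assumes "\<And>w. \<bar>a w\<bar> \<le> d" shows "\<bar>shapley n a z\<bar> \<le> M * (K (\<pi> n) - K (\<pi> (Suc n))) + d"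
  unfolding shapley_def
proof (rule cval_abs_le[OF stagef_cont2])
  fix i j
  show "\<bar>stagef n z a i j\<bar> \<le> M * (K (\<pi> n) - K (\<pi> (Suc n))) + d"
    using tm_avg_le[of "step n" a d i j z, OF step_nonneg assms] rew_bound[of n z i j]
    by (simp add: stagef_def abs_le_iff)
qed

text \<open>The value from node \<open>n\<close> when the payoff stops after \<open>l\<close>
  stages. The backward recursion has no last stage to start from, so its solution \<open>W\<close>
  is obtained as the limit of these truncations.\<close>

fun finite_val :: "nat \<Rightarrow> nat \<Rightarrow> 'w \<Rightarrow> real" where
  "finite_val 0 n z = 0"
| "finite_val (Suc l) n z = shapley n (finite_val l (Suc n)) z"

lemma finite_val_bound: "\<bar>finite_val l n z\<bar> \<le> M * (K (\<pi> n) - K (\<pi> (n + l)))"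
proof (induction l arbitrary: n z)
  case (Suc l)
  then have "\<bar>finite_val l (Suc n) w\<bar> \<le> M * (K (\<pi> (Suc n)) - K (\<pi> (n + Suc l)))" for w
    using Suc[of "Suc n" w] by simp
  from shapley_bound[of "finite_val l (Suc n)", OF this, of n z] show ?case by (simp add: algebra_simps)
qed simp

text \<open>One more stage at the far end changes the value there by at most \<open>M\<close> times
  the mass of \<open>k\<close> on that stage, and nonexpansiveness carries this back unchanged. The
  bounds telescope in \<open>K\<close>, whence summability in \<open>W_lim\<close>.\<close>

lemma finite_val_diff: "\<bar>finite_val (Suc l) n z - finite_val l n z\<bar> \<le> M * (K (\<pi> (n + l)) - K (\<pi> (Suc (n + l))))"
proof (induction l arbitrary: n z)
  case 0 show ?case using finite_val_bound[of "Suc 0" n z] by simp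
next
  case (Suc l)
  have "\<bar>finite_val (Suc l) (Suc n) w - finite_val l (Suc n) w\<bar> \<le> M * (K (\<pi> (n + Suc l)) - K (\<pi> (Suc (n + Suc l))))" for w
    using Suc[of "Suc n" w] by simp
  from shapley_nonexpansive[of "finite_val (Suc l) (Suc n)" "finite_val l (Suc n)", OF this, of n z]
  show ?case by simp
qed

definition W :: "nat \<Rightarrow> 'w \<Rightarrow> real" where
  "W n z = lim (\<lambda>l. finite_val l n z)"

lemma W_lim: "(\<lambda>l. finite_val l n z) \<longlonglongrightarrow> W n z"
proof -
  have "summable (\<lambda>l. M * (K (\<pi> (n + l)) - K (\<pi> (Suc (n + l)))))"
    using telescope_summable'[of "\<lambda>l. K (\<pi> (n + l))" 0] K_pi_lim[of n] by (intro summable_mult) (simp add: add.commute)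
  then have "summable (\<lambda>l. finite_val (Suc l) n z - finite_val l n z)"
    by (rule summable_comparison_test'[of _ 0]) (simp only: real_norm_def finite_val_diff)
  then have "convergent (\<lambda>m. \<Sum>l<m. finite_val (Suc l) n z - finite_val l n z)"
    by (simp add: summable_iff_convergent)
  then have "convergent (\<lambda>l. finite_val l n z)"
    unfolding sum_lessThan_telescope[of "\<lambda>l. finite_val l n z"] by simp
  then show ?thesis unfolding W_def by (simp add: convergent_LIMSEQ_iff)
qed

lemma W_bound: "\<bar>W n z\<bar> \<le> M * K (\<pi> n)"
proof (rule LIMSEQ_le_const2[OF tendsto_rabs[OF W_lim]])
  have "\<bar>finite_val l n z\<bar> \<le> M * K (\<pi> n)" for l
    by (rule order_trans[OF finite_val_bound mult_left_mono]) (simp_all add: M_nonneg K_nonneg)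
  then show "\<exists>N. \<forall>l\<ge>N. \<bar>finite_val l n z\<bar> \<le> M * K (\<pi> n)" by blast
qed

lemma W_shapley: "W n z = shapley n (W (Suc n)) z"
proof -
  let ?d = "\<lambda>l. \<Sum>y\<in>UNIV. \<bar>finite_val l (Suc n) y - W (Suc n) y\<bar>"
  have "(\<lambda>l. shapley n (finite_val l (Suc n)) z) \<longlonglongrightarrow> shapley n (W (Suc n)) z"
  proof (rule LIM_zero_cancel, rule Lim_null_comparison)
    have "\<bar>finite_val l (Suc n) y - W (Suc n) y\<bar> \<le> ?d l" for l y
      by (rule member_le_sum) auto
    from shapley_nonexpansive[OF this]
    show "\<forall>\<^sub>F l in sequentially. norm (shapley n (finite_val l (Suc n)) z - shapley n (W (Suc n)) z) \<le> ?d l"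
      by (auto intro!: always_eventually)
    have "?d \<longlonglongrightarrow> (\<Sum>y\<in>UNIV. \<bar>W (Suc n) y - W (Suc n) y\<bar>)"
      by (intro tendsto_intros W_lim)
    then show "?d \<longlonglongrightarrow> 0" by simp
  qed
  then have "(\<lambda>l. finite_val (Suc l) n z) \<longlonglongrightarrow> shapley n (W (Suc n)) z" by simp
  then show ?thesis using LIMSEQ_Suc[OF W_lim[of n z]] LIMSEQ_unique by blast
qed

lemma W_approx_value: "approx_value Delta Delta (mixed_ext (stagef n z (W (Suc n)))) (W n z)"
  using cval_approx[OF stagef_cont2] W_shapley by (simp add: shapley_def)

section \<open>The payoff of a play\<close>

definition rew_play :: "nat \<Rightarrow> 'w \<times> 'i \<times> 'j \<Rightarrow> real" where
  "rew_play n s = rew n (fst s) (fst (snd s)) (snd (snd s))"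

definition tail_payoff :: "nat \<Rightarrow> (nat \<Rightarrow> 'w \<times> 'i \<times> 'j) \<Rightarrow> nat \<Rightarrow> real" where
  "tail_payoff n p m = (LINT t:{\<pi> (n + m)..}|lborel. payoff_rate g \<pi> q n p t * k t)"

lemma payoff_rate_eq:
  assumes "\<pi> N \<le> t" "t < \<pi> (Suc N)" "p (N - n) = (z, i, j)"
  shows "payoff_rate g \<pi> q n p t = flow (t - \<pi> N) z i j"
  unfolding payoff_rate_def stage_at_eqI[OF assms(1,2)] flow_def
  using assms by (simp add: integral_state_law[OF q_rate])

lemma payoff_rate_bound:
  assumes "0 \<le> t" shows "\<bar>payoff_rate g \<pi> q n p t\<bar> \<le> M"
proof -
  obtain z i j where p: "p (stage_at \<pi> t - n) = (z, i, j)" using prod_cases3 by blast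
  show ?thesis
    using payoff_rate_eq[where p = p and n = n, OF stage_at[OF assms] p] flow_bound stage_at(1)[OF assms] by simp
qed

lemma payoff_integrable: "set_integrable lborel {\<pi> n'..} (\<lambda>t. payoff_rate g \<pi> q n p t * k t)"
proof -
  \<comment> \<open>At negative times no stage exists and \<open>stage_at\<close> is an unspecified
    number; the value 0 makes the stage index measurable on the whole line without changing anything
    on \<open>{\<pi> n'..}\<close>.\<close>
  define st where "st t = (if t < 0 then 0 else stage_at \<pi> t)" for t
  define F where "F N t = flow (t - \<pi> N) (fst (p (N - n))) (fst (snd (p (N - n)))) (snd (snd (p (N - n)))) * kk t" for N t
  have eq: "payoff_rate g \<pi> q n p t * k t = F (st t) t" if "0 \<le> t" for t
    using that payoff_rate_eq[OF stage_at[OF that], of p n "fst (p (stage_at \<pi> t - n))"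
        "fst (snd (p (stage_at \<pi> t - n)))" "snd (snd (p (stage_at \<pi> t - n)))"]
    by (simp add: F_def st_def kk_def)
  have "st \<in> measurable borel (count_space UNIV)"
    unfolding measurable_count_space_eq2_countable
  proof (intro conjI ballI)
    fix N
    have "st -` {N} \<inter> space borel = {\<pi> N..<\<pi> (Suc N)} \<union> (if N = 0 then {..<0} else {})"
    proof -
      have "stage_at \<pi> t = N \<longleftrightarrow> \<pi> N \<le> t \<and> t < \<pi> (Suc N)" if "0 \<le> t" for t
        using stage_at[OF that] stage_at_eqI by metis
      then show ?thesis using pi_nonneg[of N] stage_at by (auto simp: st_def not_less split: if_splits)
    qed
    then show "st -` {N} \<inter> space borel \<in> sets borel" by simp
  qed simp
  moreover have "F N \<in> borel_measurable borel" for N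
    unfolding F_def by (intro borel_measurable_continuous_onI continuous_intros flow_cont_time kk_cont)
  ultimately have m: "(\<lambda>t. F (st t) t) \<in> borel_measurable borel"
    using measurable_compose_countable[of F borel borel st] by simp
  have "set_integrable lborel {\<pi> n'..} (\<lambda>t. F (st t) t)"
  proof (rule set_integrable_bound[OF set_integrable_mult_right[OF kk_integrable[of "\<pi> n'"], of M]])
    show "set_borel_measurable lborel {\<pi> n'..} (\<lambda>t. F (st t) t)" using m by (simp add: set_borel_measurable_def)
    show "AE t in lborel. t \<in> {\<pi> n'..} \<longrightarrow> norm (F (st t) t) \<le> norm (M * kk t)"
    proof (intro AE_I2 impI)
      fix t assume "t \<in> {\<pi> n'..}"
      then have "0 \<le> t" using pi_nonneg[of n'] by simp
      then show "norm (F (st t) t) \<le> norm (M * kk t)"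
        using payoff_rate_bound[of t n p] k_nonneg[of t]
        by (simp add: abs_mult M_nonneg kk_def mult_right_mono flip: eq)
    qed
  qed
  moreover have "set_integrable lborel {\<pi> n'..} (\<lambda>t. F (st t) t) \<longleftrightarrow>
      set_integrable lborel {\<pi> n'..} (\<lambda>t. payoff_rate g \<pi> q n p t * k t)"
    using pi_nonneg[of n'] by (intro set_integrable_cong) (auto simp: eq)
  ultimately show ?thesis by simp
qed

lemma tail_payoff_rec: "tail_payoff n p m = rew_play (n + m) (p m) + tail_payoff n p (Suc m)"
proof -
  obtain z i j where p: "p m = (z, i, j)" using prod_cases3 by blast
  have "(LINT t:{\<pi> (n + m)..<\<pi> (Suc (n + m))}|lborel. payoff_rate g \<pi> q n p t * k t) =
      (LINT t:{\<pi> (n + m)..<\<pi> (Suc (n + m))}|lborel. flow (t - \<pi> (n + m)) z i j * kk t)"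
    using pi_nonneg[of "n + m"]
    by (intro set_lebesgue_integral_cong) (auto simp: payoff_rate_eq[of "n + m" _ p n, simplified, OF _ _ p] kk_def)
  then show ?thesis
    using interval_split[OF payoff_integrable[of "n + m" n p]] by (simp add: tail_payoff_def rew_play_def rew_def p)
qed

lemma tail_payoff_bound: "\<bar>tail_payoff n p m\<bar> \<le> M * K (\<pi> (n + m))"
proof -
  have "norm (tail_payoff n p m) \<le> (LINT t:{\<pi> (n + m)..}|lborel. norm (payoff_rate g \<pi> q n p t * k t))"
    unfolding tail_payoff_def by (rule set_integral_norm_bound[OF payoff_integrable])
  also have "\<dots> \<le> (LINT t:{\<pi> (n + m)..}|lborel. M * kk t)"
  proof (intro set_integral_mono set_integrable_norm payoff_integrable set_integrable_mult_right kk_integrable)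
    fix t assume "t \<in> {\<pi> (n + m)..}"
    then have "0 \<le> t" using pi_nonneg[of "n + m"] by simp
    then show "norm (payoff_rate g \<pi> q n p t * k t) \<le> M * kk t"
      using payoff_rate_bound[of t n p] k_nonneg[of t] by (simp add: abs_mult kk_def mult_right_mono)
  qed
  finally show ?thesis by (simp add: K_def)
qed

lemma tail_payoff_expand: "tail_payoff n p 0 = (\<Sum>l<m. rew_play (n + l) (p l)) + tail_payoff n p m"
proof (induction m)
  case (Suc m) then show ?case using tail_payoff_rec[of n p m] by simp
qed simp

lemma expected_payoff_eq: "expected_payoff g k q \<pi> n \<omega> \<sigma> \<tau> = (\<integral>p. tail_payoff n p 0 \<partial>play_law \<pi> q n \<omega> \<sigma> \<tau>)"
  by (simp add: expected_payoff_def tail_payoff_def)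

end

section \<open>The law of a play\<close>

lemma stage_space_space [simp]: "space stage_space = UNIV"
  by (simp add: stage_space_def space_pair_measure)

lemma stage_space_measurableI:
  fixes f :: "'w::finite \<times> 'i::topological_space \<times> 'j::topological_space \<Rightarrow> 'b"
  assumes "\<And>z. (\<lambda>y. f (z, y)) \<in> measurable (borel \<Otimes>\<^sub>M borel) N"
  shows "f \<in> measurable stage_space N"
  unfolding stage_space_def using assms by (intro measurable_pair_measure_countable1) auto

lemma Pair_stage_measurable: "Pair z \<in> measurable (borel \<Otimes>\<^sub>M borel) stage_space"
  by (simp add: stage_space_def)

lemma finite_prob_integrable:
  fixes f :: "'w::finite \<Rightarrow> real"
  assumes N: "N \<in> space (prob_algebra (count_space UNIV))"
  shows "integrable N f"
proof -
  interpret prob_space N using N by (simp add: space_prob_algebra)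
  have s: "sets N = sets (count_space UNIV)" using N by (simp add: space_prob_algebra)
  have "f \<in> borel_measurable N" by (simp add: measurable_cong_sets[OF s])
  moreover have "\<bar>f z\<bar> \<le> (\<Sum>z\<in>UNIV. \<bar>f z\<bar>)" for z by (rule member_le_sum) auto
  ultimately show ?thesis by (intro integrable_const_bound[of _ "\<Sum>z\<in>UNIV. \<bar>f z\<bar>"]) auto
qed

locale play = partition_game TI TJ g k q M lam L \<pi>
  for TI :: "'i::metric_space itself" and TJ :: "'j::metric_space itself"
    and g :: "'w::finite \<Rightarrow> 'i \<Rightarrow> 'j \<Rightarrow> real" and k q M lam L \<pi> +
  fixes n :: nat and \<omega> :: 'w and \<sigma> :: "('w, 'i, 'j, 'i) strategy" and \<tau> :: "('w, 'i, 'j, 'j) strategy"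
  assumes strat: "\<sigma> \<in> strategies" "\<tau> \<in> strategies"
begin

abbreviation hist :: "nat \<Rightarrow> (nat \<Rightarrow> 'w \<times> 'i \<times> 'j) measure" where
  "hist m \<equiv> PiM {0..<m} (\<lambda>_. stage_space)"

abbreviation next_law :: "nat \<Rightarrow> (nat \<Rightarrow> 'w \<times> 'i \<times> 'j) \<Rightarrow> 'w measure" where
  "next_law m \<equiv> next_state_law \<pi> q n \<omega> m"

abbreviation kernel :: "nat \<Rightarrow> (nat \<Rightarrow> 'w \<times> 'i \<times> 'j) \<Rightarrow> ('w \<times> 'i \<times> 'j) measure" where
  "kernel m \<equiv> stage_kernel \<pi> q n \<omega> \<sigma> \<tau> m"

lemma strat_measurable:
  "\<sigma> m \<in> hist m \<Otimes>\<^sub>M count_space UNIV \<rightarrow>\<^sub>M prob_algebra borel"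
  "\<tau> m \<in> hist m \<Otimes>\<^sub>M count_space UNIV \<rightarrow>\<^sub>M prob_algebra borel"
  using strat by (auto simp: strategies_def)

lemma strat_Delta: "h \<in> space (hist m) \<Longrightarrow> \<sigma> m (h, z) \<in> Delta" "h \<in> space (hist m) \<Longrightarrow> \<tau> m (h, z) \<in> Delta"
  using measurable_space[OF strat_measurable(1), of "(h, z)" m] measurable_space[OF strat_measurable(2), of "(h, z)" m]
  by (auto simp: Delta_def space_pair_measure)

lemma state_law_measurable:
  assumes "0 \<le> d"
  shows "(\<lambda>s. state_law q d (fst (snd s)) (snd (snd s)) (fst s)) \<in> stage_space \<rightarrow>\<^sub>M prob_algebra (count_space UNIV)"
proof (rule stage_space_measurableI)
  fix z :: 'w
  have "(\<lambda>y. state_law q d (fst y) (snd y) z) \<in> borel \<Otimes>\<^sub>M borel \<rightarrow>\<^sub>M prob_algebra (count_space UNIV)"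
  proof (rule measurable_prob_algebraI[OF prob_space_state_law[OF q_rate assms]], rule measurable_subprob_algebra)
    show "subprob_space (state_law q d (fst y) (snd y) z)" for y
      by (intro prob_space_imp_subprob_space prob_space_state_law[OF q_rate assms])
    show "sets (state_law q d (fst y) (snd y) z) = sets (count_space UNIV)" for y
      by (simp add: state_law_def sets_point_measure)
    fix A :: "'w set"
    have "(\<lambda>y. \<Sum>z'\<in>A. ennreal (tm d (fst y) (snd y) z z')) \<in> borel_measurable (borel \<Otimes>\<^sub>M borel)"
      by (intro borel_measurable_sum measurable_compose[OF cont2_measurable[OF tm_cont2] measurable_ennreal])
    then show "(\<lambda>y. emeasure (state_law q d (fst y) (snd y) z) A) \<in> borel_measurable (borel \<Otimes>\<^sub>M borel)"
      by (simp add: state_law_def emeasure_point_measure_finite)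
  qed
  then show "(\<lambda>y. state_law q d (fst (snd (z, y))) (snd (snd (z, y))) (fst (z, y))) \<in> borel \<Otimes>\<^sub>M borel \<rightarrow>\<^sub>M prob_algebra (count_space UNIV)"
    by simp
qed

lemma next_law_measurable: "next_law m \<in> hist m \<rightarrow>\<^sub>M prob_algebra (count_space UNIV)"
proof (cases m)
  case 0
  have "return (count_space UNIV) \<omega> \<in> space (prob_algebra (count_space UNIV))"
    by (simp add: space_prob_algebra prob_space_return)
  then show ?thesis using 0 by (simp add: next_state_law_def[abs_def])
next
  case (Suc l)
  have d: "0 \<le> \<pi> (n + m) - \<pi> (n + l)" using pi_mono[of "n + l" "n + m"] Suc by simp
  have "(\<lambda>h. h l) \<in> hist m \<rightarrow>\<^sub>M stage_space" using Suc by (intro measurable_component_singleton) simp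
  from measurable_compose[OF this state_law_measurable[OF d]] show ?thesis
    by (simp add: next_state_law_def[abs_def] Suc split_beta')
qed

lemma next_law_prob: "h \<in> space (hist m) \<Longrightarrow> next_law m h \<in> space (prob_algebra (count_space UNIV))"
  using measurable_space[OF next_law_measurable] .

abbreviation action_law :: "nat \<Rightarrow> (nat \<Rightarrow> 'w \<times> 'i \<times> 'j) \<Rightarrow> 'w \<Rightarrow> ('w \<times> 'i \<times> 'j) measure" where
  "action_law m h z \<equiv> distr (\<sigma> m (h, z) \<Otimes>\<^sub>M \<tau> m (h, z)) stage_space (Pair z)"

lemma action_law_measurable:
  "(\<lambda>(h, z). action_law m h z) \<in> hist m \<Otimes>\<^sub>M count_space UNIV \<rightarrow>\<^sub>M prob_algebra stage_space"
proof -
  have "(\<lambda>x. \<sigma> m x \<Otimes>\<^sub>M \<tau> m x) \<in> hist m \<Otimes>\<^sub>M count_space UNIV \<rightarrow>\<^sub>M prob_algebra (borel \<Otimes>\<^sub>M borel)"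
    by (rule measurable_pair_prob[OF strat_measurable])
  moreover have "(\<lambda>(x, y). (snd x, y)) \<in> (hist m \<Otimes>\<^sub>M count_space UNIV) \<Otimes>\<^sub>M (borel \<Otimes>\<^sub>M borel) \<rightarrow>\<^sub>M stage_space"
    unfolding stage_space_def by measurable
  ultimately have "(\<lambda>x. distr (\<sigma> m x \<Otimes>\<^sub>M \<tau> m x) stage_space (\<lambda>y. (snd x, y))) \<in>
      hist m \<Otimes>\<^sub>M count_space UNIV \<rightarrow>\<^sub>M prob_algebra stage_space"
    by (rule measurable_distr_prob_space2)
  then show ?thesis by (simp add: split_beta')
qed

lemma kernel_measurable: "kernel m \<in> hist m \<rightarrow>\<^sub>M prob_algebra stage_space"
  unfolding stage_kernel_def[abs_def]
  by (rule measurable_bind_prob_space2[OF next_law_measurable action_law_measurable])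

sublocale IT: Ionescu_Tulcea kernel "\<lambda>_. stage_space"
proof (rule Ionescu_Tulcea.intro)
  show "kernel i \<in> hist i \<rightarrow>\<^sub>M subprob_algebra stage_space" for i
    by (rule measurable_prob_algebraD[OF kernel_measurable])
  show "prob_space (kernel i h)" if "h \<in> space (hist i)" for i h
    using measurable_space[OF kernel_measurable that] by (simp add: space_prob_algebra)
qed

lemma kernel_integral:
  assumes h: "h \<in> space (hist m)" and f: "f \<in> borel_measurable stage_space" and B: "\<And>s. \<bar>f s\<bar> \<le> (B::real)"
  shows "(\<integral>s. f s \<partial>kernel m h) =
    (\<integral>z. mixed_ext (\<lambda>i j. f (z, i, j)) (\<sigma> m (h, z)) (\<tau> m (h, z)) \<partial>next_law m h)"
proof -
  have N: "prob_space (next_law m h)" "sets (next_law m h) = sets (count_space UNIV)"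
    using next_law_prob[OF h] by (auto simp: space_prob_algebra)
  have a: "action_law m h z \<in> space (prob_algebra stage_space)" for z
    using measurable_space[OF action_law_measurable, of "(h, z)"] h by (simp add: space_pair_measure)
  have am: "action_law m h \<in> measurable (next_law m h) (subprob_algebra stage_space)"
    using a by (auto simp: measurable_cong_sets[OF N(2) refl] space_subprob_algebra space_prob_algebra prob_space_imp_subprob_space)
  have "(\<integral>s. f s \<partial>kernel m h) = (\<integral>z. \<integral>s. f s \<partial>action_law m h z \<partial>next_law m h)"
    unfolding stage_kernel_def
  proof (rule integral_bind[where K = stage_space and B = B and B' = 1])
    show "finite_measure (next_law m h)" using N(1) by (rule prob_space.finite_measure)
    show "AE z in next_law m h. emeasure (action_law m h z) (space (action_law m h z)) \<le> ennreal 1"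
      using a by (intro AE_I2) (auto simp: space_prob_algebra prob_space.measure_le_1)
  qed (use B f am in auto)
  also have "(\<lambda>z. \<integral>s. f s \<partial>action_law m h z) = (\<lambda>z. mixed_ext (\<lambda>i j. f (z, i, j)) (\<sigma> m (h, z)) (\<tau> m (h, z)))"
  proof
    fix z
    have "Pair z \<in> measurable (\<sigma> m (h, z) \<Otimes>\<^sub>M \<tau> m (h, z)) stage_space"
      using Pair_stage_measurable
      by (simp add: measurable_cong_sets[OF sets_pair_measure_cong[OF DeltaD(2)[OF strat_Delta(1)[OF h]] DeltaD(2)[OF strat_Delta(2)[OF h]]] refl])
    then show "(\<integral>s. f s \<partial>action_law m h z) = mixed_ext (\<lambda>i j. f (z, i, j)) (\<sigma> m (h, z)) (\<tau> m (h, z))"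
      using f by (simp add: integral_distr mixed_ext_def)
  qed
  finally show ?thesis .
qed

text \<open>The iterated kernels start from the empty history: the constant function with value
  \<open>undefined\<close> is the only point of \<open>hist 0\<close>.\<close>

abbreviation law :: "nat \<Rightarrow> (nat \<Rightarrow> 'w \<times> 'i \<times> 'j) measure" where
  "law m \<equiv> IT.C 0 m (\<lambda>_. undefined)"

lemma law_prob: "prob_space (law m)" and law_sets: "sets (law m) = sets (hist m)" and law_space: "space (law m) = space (hist m)"
proof -
  have u: "(\<lambda>_. undefined) \<in> space (hist 0)" by (simp add: space_PiM)
  show "prob_space (law m)" by (rule IT.prob_space_C[OF u])
  show "sets (law m) = sets (hist m)" using IT.sets_C[OF u, of m] by simp
  show "space (law m) = space (hist m)" using IT.space_C[OF u, of m] by simp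
qed

lemma fun_upd_hist: "h \<in> space (hist m) \<Longrightarrow> fun_upd h m \<in> stage_space \<rightarrow>\<^sub>M hist (Suc m)"
  by (rule measurable_fun_upd[where J = "{0..<m}"]) auto

lemma law_integrable:
  assumes "f \<in> borel_measurable (hist m)" "\<And>h. h \<in> space (hist m) \<Longrightarrow> \<bar>f h\<bar> \<le> (B::real)"
  shows "integrable (law m) f"
proof -
  interpret prob_space "law m" by (rule law_prob)
  show ?thesis
    using assms by (intro integrable_const_bound[of _ B]) (auto simp: law_space measurable_cong_sets[OF law_sets])
qed

lemma
  assumes f: "f \<in> borel_measurable (hist (Suc m))" and B: "\<And>h. h \<in> space (hist (Suc m)) \<Longrightarrow> \<bar>f h\<bar> \<le> (B::real)"
  shows law_Suc_integral: "(\<integral>h. f h \<partial>law (Suc m)) = (\<integral>h. \<integral>s. f (h(m := s)) \<partial>kernel m h \<partial>law m)"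
    and law_Suc_integrable: "integrable (law m) (\<lambda>h. \<integral>s. f (h(m := s)) \<partial>kernel m h)"
proof -
  interpret prob_space "law m" by (rule law_prob)
  have e: "(\<integral>h'. f h' \<partial>IT.eP m h) = (\<integral>s. f (h(m := s)) \<partial>kernel m h)" if h: "h \<in> space (hist m)" for h
    unfolding IT.eP_def
    using f fun_upd_hist[OF h] by (intro integral_distr) (auto simp: measurable_cong_sets[OF IT.sets_P[OF h]])
  have em: "IT.eP m \<in> measurable (law m) (subprob_algebra (hist (Suc m)))"
    using IT.measurable_eP by (simp add: measurable_cong_sets[OF law_sets])
  have "(\<integral>h. f h \<partial>law (Suc m)) = (\<integral>h. \<integral>h'. f h' \<partial>IT.eP m h \<partial>law m)"
    unfolding IT.C.simps add_0
  proof (rule integral_bind[where K = "hist (Suc m)" and B = B and B' = 1])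
    show "AE h in law m. emeasure (IT.eP m h) (space (IT.eP m h)) \<le> ennreal 1"
      by (intro AE_I2) (simp add: law_space IT.prob_space_eP prob_space.emeasure_space_1)
  qed (use B f em in \<open>auto intro: finite_measure\<close>)
  also have "\<dots> = (\<integral>h. \<integral>s. f (h(m := s)) \<partial>kernel m h \<partial>law m)"
    by (intro Bochner_Integration.integral_cong refl e) (simp add: law_space)
  finally show "(\<integral>h. f h \<partial>law (Suc m)) = (\<integral>h. \<integral>s. f (h(m := s)) \<partial>kernel m h \<partial>law m)" .
  have "integrable (law m) (\<lambda>h. \<integral>h'. f h' \<partial>IT.eP m h)"
  proof (rule law_integrable)
    show "(\<lambda>h. \<integral>h'. f h' \<partial>IT.eP m h) \<in> borel_measurable (hist m)"
      using f by (intro measurable_compose[OF IT.measurable_eP integral_measurable_subprob_algebra])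
    fix h assume h: "h \<in> space (hist m)"
    interpret P: prob_space "IT.eP m h" by (rule IT.prob_space_eP[OF h])
    have "integrable (IT.eP m h) f"
      using f B by (intro P.integrable_const_bound[of _ B]) (auto simp: IT.space_eP[OF h] measurable_cong_sets[OF IT.sets_eP[OF h]])
    then have "norm (\<integral>h'. f h' \<partial>IT.eP m h) \<le> (\<integral>h'. B \<partial>IT.eP m h)"
      using B by (intro order_trans[OF integral_norm_bound] integral_mono integrable_norm) (auto simp: IT.space_eP[OF h])
    then show "\<bar>\<integral>h'. f h' \<partial>IT.eP m h\<bar> \<le> B" by (simp add: P.prob_space)
  qed
  then show "integrable (law m) (\<lambda>h. \<integral>s. f (h(m := s)) \<partial>kernel m h)"
    by (rule Bochner_Integration.integrable_cong[THEN iffD1, rotated -1]) (auto simp: e law_space)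
qed

abbreviation plays :: "(nat \<Rightarrow> 'w \<times> 'i \<times> 'j) measure" where
  "plays \<equiv> play_law \<pi> q n \<omega> \<sigma> \<tau>"

abbreviation payoff :: real where
  "payoff \<equiv> expected_payoff g k q \<pi> n \<omega> \<sigma> \<tau>"

lemma plays_eq: "plays = IT.PF.lim"
  by (simp add: play_law_def)

lemma plays_sets: "sets plays = sets (PiM UNIV (\<lambda>_. stage_space))"
  unfolding plays_eq by (rule IT.PF.sets_lim)

lemma plays_prob: "prob_space plays"
proof (rule prob_space_distrD)
  show "(\<lambda>p. restrict p {0..<m}) \<in> measurable plays (hist m)" for m
    unfolding measurable_cong_sets[OF plays_sets refl] by (intro measurable_restrict_subset) auto
  show "prob_space (distr plays (hist 0) (\<lambda>p. restrict p {0..<0}))"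
    unfolding plays_eq using IT.distr_lim[of "{0..<0}"] IT.PF.prob_space_P[of "{0..<0}"] by simp
qed

lemma plays_integral:
  assumes f: "f \<in> borel_measurable (hist m)"
  shows "(\<integral>p. (f (restrict p {0..<m}) :: real) \<partial>plays) = (\<integral>h. f h \<partial>law m)"
proof -
  \<comment> \<open>\<open>CI\<close> on a finite index set is a projection of the law of the
    shortest initial segment covering it; for an initial segment nothing is projected away.\<close>
  have up: "IT.up_to {0..<m} = m"
    by (intro antisym) (auto simp: IT.up_to_iff, metis IT.up_to atLeastLessThan_empty_iff finite_atLeastLessThan ivl_subset le_zero_eq nat_le_linear not_less)
  have r: "(\<lambda>p. restrict p {0..<m}) \<in> measurable plays (hist m)"
    unfolding measurable_cong_sets[OF plays_sets refl] by (intro measurable_restrict_subset) auto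
  have "(\<integral>p. f (restrict p {0..<m}) \<partial>plays) = (\<integral>h. f h \<partial>distr plays (hist m) (\<lambda>p. restrict p {0..<m}))"
    by (rule integral_distr[OF r f, symmetric])
  also have "distr plays (hist m) (\<lambda>p. restrict p {0..<m}) = IT.CI {0..<m}"
    unfolding plays_eq by (rule IT.distr_lim) simp
  also have "\<dots> = distr (law m) (hist m) (\<lambda>h. restrict h {0..<m})"
    unfolding IT.CI_def up ..
  also have "(\<integral>h. f h \<partial>distr (law m) (hist m) (\<lambda>h. restrict h {0..<m})) = (\<integral>h. f (restrict h {0..<m}) \<partial>law m)"
    by (rule integral_distr[OF _ f]) (simp add: measurable_cong_sets[OF law_sets] measurable_restrict_subset)
  also have "\<dots> = (\<integral>h. f h \<partial>law m)"
    by (intro Bochner_Integration.integral_cong refl arg_cong[of _ _ f])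
       (auto simp: law_space space_PiM PiE_restrict)
  finally show ?thesis .
qed

lemma rew_play_measurable: "rew_play N \<in> borel_measurable stage_space"
  by (rule stage_space_measurableI) (simp add: rew_play_def cont2_measurable[OF rew_cont2])

lemma rew_play_component_measurable:
  "l \<in> J \<Longrightarrow> (\<lambda>h. rew_play N (h l)) \<in> borel_measurable (PiM J (\<lambda>_. stage_space))"
  by (rule measurable_compose[where f = "\<lambda>h. h l" and N = stage_space, OF _ rew_play_measurable])
     (rule measurable_component_singleton)

lemma rew_play_bound: "\<bar>rew_play N s\<bar> \<le> M * K 0"
proof -
  have "K (\<pi> N) - K (\<pi> (Suc N)) \<le> K 0" using K_antimono[OF pi_nonneg[of N]] K_nonneg[of "\<pi> (Suc N)"] by linarith
  then show ?thesis
    unfolding rew_play_def by (rule order_trans[OF rew_bound mult_left_mono]) (rule M_nonneg)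
qed

section \<open>Comparing the payoff of a play with the solution of the recursion\<close>

definition past :: "nat \<Rightarrow> (nat \<Rightarrow> 'w \<times> 'i \<times> 'j) \<Rightarrow> real" where
  "past m h = (\<Sum>l<m. rew_play (n + l) (h l))"

definition future :: "nat \<Rightarrow> (nat \<Rightarrow> 'w \<times> 'i \<times> 'j) \<Rightarrow> real" where
  "future m h = (\<integral>z. W (n + m) z \<partial>next_law m h)"

text \<open>Its expectation is \<open>W n \<omega>\<close> at \<open>m = 0\<close> and tends to the
  payoff as \<open>m\<close> grows. The history before stage \<open>m\<close> does not contain the
  state at stage \<open>m\<close>, hence the average over \<open>next_law m\<close> in
  \<open>future\<close>.\<close>

definition pot :: "nat \<Rightarrow> (nat \<Rightarrow> 'w \<times> 'i \<times> 'j) \<Rightarrow> real" where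
  "pot m h = past m h + future m h"

lemma past_measurable: "past m \<in> borel_measurable (hist m)"
  unfolding past_def[abs_def]
  by (intro borel_measurable_sum rew_play_component_measurable) auto

lemma future_measurable: "future m \<in> borel_measurable (hist m)"
  unfolding future_def[abs_def]
  by (intro measurable_compose[OF measurable_prob_algebraD[OF next_law_measurable] integral_measurable_subprob_algebra]) auto

lemma future_bound:
  assumes h: "h \<in> space (hist m)" shows "\<bar>future m h\<bar> \<le> M * K (\<pi> (n + m))"
proof -
  interpret prob_space "next_law m h" using next_law_prob[OF h] by (simp add: space_prob_algebra)
  have "norm (future m h) \<le> (\<integral>z. M * K (\<pi> (n + m)) \<partial>next_law m h)"
    unfolding future_def
    by (intro order_trans[OF integral_norm_bound] integral_mono finite_prob_integrable next_law_prob[OF h]) (simp add: W_bound)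
  then show ?thesis by (simp add: prob_space)
qed

lemma pot_measurable: "pot m \<in> borel_measurable (hist m)"
  unfolding pot_def[abs_def] by (intro borel_measurable_add past_measurable future_measurable)

lemma past_bound: "\<bar>past m h\<bar> \<le> real m * (M * K 0)"
  unfolding past_def using sum_abs[of "\<lambda>l. rew_play (n + l) (h l)" "{..<m}"] rew_play_bound
  by (intro order_trans[OF sum_abs sum_bounded_above[of "{..<m}" _ "M * K 0", simplified]]) auto

lemma pot_bound: "h \<in> space (hist m) \<Longrightarrow> \<bar>pot m h\<bar> \<le> real m * (M * K 0) + M * K (\<pi> (n + m))"
  using past_bound[of m h] future_bound[of h m] unfolding pot_def by linarith

text \<open>Averaging the continuation over the transition matrix reproduces the one-stage payoff of
  the Shapley operator. The factor \<open>1\<close> gives the right-hand side the shape of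
  \<open>mixed_ext_affine\<close>.\<close>

lemma pot_Suc:
  "pot (Suc m) (h(m := (z, i, j))) = past m h + 1 * stagef (n + m) z (W (Suc (n + m))) i j"
proof -
  have "past (Suc m) (h(m := (z, i, j))) = past m h + rew (n + m) z i j"
    by (simp add: past_def rew_play_def)
  moreover have "future (Suc m) (h(m := (z, i, j))) = (\<Sum>z'\<in>UNIV. tm (step (n + m)) i j z z' * W (Suc (n + m)) z')"
    using integral_state_law[OF q_rate step_nonneg, where f = "W (Suc (n + m))"]
    by (simp add: future_def next_state_law_def)
  ultimately show ?thesis by (simp add: pot_def stagef_def)
qed

text \<open>When one player's actions are \<open>e\<close>-optimal in each stage game, \<open>pot\<close> is a sub- or supermartingale
  up to \<open>e\<close>; \<open>s = 1\<close> stands for the maximizing and \<open>s = -1\<close> for the minimizing player.\<close>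

lemma pot_step:
  assumes hyp: "\<And>h z. h \<in> space (hist m) \<Longrightarrow>
      - e \<le> s * (mixed_ext (stagef (n + m) z (W (Suc (n + m)))) (\<sigma> m (h, z)) (\<tau> m (h, z)) - W (n + m) z)"
  shows "s * (\<integral>h. pot m h \<partial>law m) - e \<le> s * (\<integral>h. pot (Suc m) h \<partial>law (Suc m))"
proof -
  interpret prob_space "law m" by (rule law_prob)
  let ?B = "real (Suc m) * (M * K 0) + M * K (\<pi> (n + Suc m))"
  let ?f = "\<lambda>h. \<integral>x. pot (Suc m) (h(m := x)) \<partial>kernel m h"
  have le: "s * pot m h - e \<le> s * ?f h" if h: "h \<in> space (hist m)" for h
  proof -
    interpret N: prob_space "next_law m h" using next_law_prob[OF h] by (simp add: space_prob_algebra)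
    have up: "h(m := x) \<in> space (hist (Suc m))" for x using measurable_space[OF fun_upd_hist[OF h], of x] by simp
    let ?g = "\<lambda>z. mixed_ext (stagef (n + m) z (W (Suc (n + m)))) (\<sigma> m (h, z)) (\<tau> m (h, z))"
    have "?f h = (\<integral>z. mixed_ext (\<lambda>i j. pot (Suc m) (h(m := (z, i, j)))) (\<sigma> m (h, z)) (\<tau> m (h, z)) \<partial>next_law m h)"
      using pot_bound[OF up] by (intro kernel_integral[OF h, of _ ?B] measurable_compose[OF fun_upd_hist[OF h] pot_measurable])
    also have "\<dots> = (\<integral>z. past m h + ?g z \<partial>next_law m h)"
      unfolding pot_Suc mixed_ext_affine[OF stagef_cont2 strat_Delta[OF h]] by simp
    finally have f: "?f h = (\<integral>z. past m h + ?g z \<partial>next_law m h)" .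
    have "s * pot m h - e = (\<integral>z. s * past m h + s * W (n + m) z - e \<partial>next_law m h)"
      using finite_prob_integrable[OF next_law_prob[OF h]]
      by (simp add: pot_def future_def N.prob_space distrib_left)
    also have "\<dots> \<le> (\<integral>z. s * (past m h + ?g z) \<partial>next_law m h)"
      using hyp[OF h] by (intro integral_mono finite_prob_integrable[OF next_law_prob[OF h]]) (simp add: algebra_simps)
    finally show ?thesis using finite_prob_integrable[OF next_law_prob[OF h]] by (simp add: f)
  qed
  have i1: "integrable (law m) (pot m)" by (rule law_integrable[OF pot_measurable pot_bound])
  have i2: "integrable (law m) ?f" by (rule law_Suc_integrable[OF pot_measurable pot_bound])
  have "s * (\<integral>h. pot m h \<partial>law m) - e = (\<integral>h. s * pot m h - e \<partial>law m)"
    using i1 by (simp add: prob_space)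
  also have "\<dots> \<le> (\<integral>h. s * ?f h \<partial>law m)"
    using i1 i2 le by (intro integral_mono) (auto simp: law_space)
  also have "\<dots> = s * (\<integral>h. pot (Suc m) h \<partial>law (Suc m))"
    using i2 law_Suc_integral[OF pot_measurable pot_bound, of m] by (simp del: IT.C.simps)
  finally show ?thesis .
qed

lemma pot_0: "(\<integral>h. pot 0 h \<partial>law 0) = W n \<omega>"
proof -
  have "(\<integral>h. pot 0 h \<partial>law 0) = pot 0 (\<lambda>_. undefined)"
    using pot_measurable[of 0] by (simp add: integral_return space_PiM)
  also have "\<dots> = W n \<omega>" by (simp add: pot_def past_def future_def next_state_law_def integral_return)
  finally show ?thesis .
qed

text \<open>The first \<open>m\<close> stage rewards cancel; what remains is the true tail against
  its estimate \<open>future\<close>, each at most \<open>M * K (\<pi> (n + m))\<close>.\<close>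

lemma payoff_pot_diff:
  "p \<in> space plays \<Longrightarrow> \<bar>tail_payoff n p 0 - pot m (restrict p {0..<m})\<bar> \<le> 2 * (M * K (\<pi> (n + m)))"
proof -
  assume p: "p \<in> space plays"
  have "restrict p {0..<m} \<in> space (hist m)" by (auto simp: space_PiM)
  moreover have "past m (restrict p {0..<m}) = (\<Sum>l<m. rew_play (n + l) (p l))" by (simp add: past_def)
  ultimately show ?thesis
    using tail_payoff_expand[of n p m] tail_payoff_bound[of n p m] future_bound[of "restrict p {0..<m}" m]
    unfolding pot_def by linarith
qed

text \<open>The payoff is the pointwise limit of finite sums of stage rewards, so joint
  measurability of \<open>payoff_rate\<close> in play and time is never called upon.\<close>

lemma tail_payoff_measurable: "(\<lambda>p. tail_payoff n p 0) \<in> borel_measurable plays"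
  unfolding measurable_cong_sets[OF plays_sets refl]
proof (rule borel_measurable_LIMSEQ_real)
  show "(\<lambda>p. \<Sum>l<m. rew_play (n + l) (p l)) \<in> borel_measurable (PiM UNIV (\<lambda>_. stage_space))" for m
    by (intro borel_measurable_sum rew_play_component_measurable) auto
  fix p
  show "(\<lambda>m. \<Sum>l<m. rew_play (n + l) (p l)) \<longlonglongrightarrow> tail_payoff n p 0"
  proof (rule LIM_zero_cancel, rule Lim_null_comparison)
    show "\<forall>\<^sub>F m in sequentially. norm ((\<Sum>l<m. rew_play (n + l) (p l)) - tail_payoff n p 0) \<le> M * K (\<pi> (m + n))"
    proof (intro always_eventually allI)
      fix m show "norm ((\<Sum>l<m. rew_play (n + l) (p l)) - tail_payoff n p 0) \<le> M * K (\<pi> (m + n))"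
        using tail_payoff_bound[of n p m] tail_payoff_expand[of n p m] by (simp add: add.commute)
    qed
    show "(\<lambda>m. M * K (\<pi> (m + n))) \<longlonglongrightarrow> 0" using tendsto_mult_right_zero[OF K_pi_lim[of n], of M] .
  qed
qed

lemma tail_payoff_integrable: "integrable plays (\<lambda>p. tail_payoff n p 0)"
proof -
  interpret prob_space plays by (rule plays_prob)
  show ?thesis
    using tail_payoff_bound[of n _ 0] by (intro integrable_const_bound[of _ "M * K (\<pi> n)"] tail_payoff_measurable) simp
qed

lemma expected_payoff_bound: "\<bar>payoff\<bar> \<le> M * K (\<pi> n)"
proof -
  interpret prob_space plays by (rule plays_prob)
  have "norm (\<integral>p. tail_payoff n p 0 \<partial>plays) \<le> (\<integral>p. M * K (\<pi> n) \<partial>plays)"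
    using tail_payoff_bound[of n _ 0]
    by (intro order_trans[OF integral_norm_bound] integral_mono integrable_norm tail_payoff_integrable) auto
  then show ?thesis by (simp add: expected_payoff_eq prob_space)
qed

text \<open>The allowed stage errors \<open>e / 2 ^ Suc m\<close> form a geometric series with sum
  \<open>e\<close>; the first \<open>m\<close> of them add up to \<open>e * (1 - 1 / 2 ^ m)\<close>.
  Replacing the payoff by \<open>pot m\<close> costs a multiple of the tail mass, which disappears
  as \<open>m\<close> tends to infinity.\<close>

lemma expected_payoff_ge:
  assumes s: "\<bar>s\<bar> = 1" and e: "0 < e"
    and hyp: "\<And>m h z. h \<in> space (hist m) \<Longrightarrow>
      - (e / 2 ^ Suc m) \<le> s * (mixed_ext (stagef (n + m) z (W (Suc (n + m)))) (\<sigma> m (h, z)) (\<tau> m (h, z)) - W (n + m) z)"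
  shows "s * W n \<omega> - e \<le> s * payoff"
proof -
  interpret prob_space plays by (rule plays_prob)
  have 1: "s * W n \<omega> - e * (1 - 1 / 2 ^ m) \<le> s * (\<integral>h. pot m h \<partial>law m)" for m
  proof (induction m)
    case 0 show ?case unfolding pot_0 by simp
  next
    case (Suc m) then show ?case using pot_step[of m "e / 2 ^ Suc m" s, OF hyp] by (simp add: field_simps)
  qed
  have 2: "\<bar>payoff - (\<integral>h. pot m h \<partial>law m)\<bar> \<le> 2 * (M * K (\<pi> (n + m)))" for m
  proof -
    have r: "(\<lambda>p. restrict p {0..<m}) \<in> measurable plays (hist m)"
      unfolding measurable_cong_sets[OF plays_sets refl] by (intro measurable_restrict_subset) auto
    have i: "integrable plays (\<lambda>p. pot m (restrict p {0..<m}))"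
      using pot_bound[of _ m] measurable_space[OF r]
      by (intro integrable_const_bound[of _ "real m * (M * K 0) + M * K (\<pi> (n + m))"] measurable_compose[OF r pot_measurable]) auto
    have "payoff - (\<integral>h. pot m h \<partial>law m) =
        (\<integral>p. tail_payoff n p 0 - pot m (restrict p {0..<m}) \<partial>plays)"
      using i by (simp add: expected_payoff_eq plays_integral[OF pot_measurable] tail_payoff_integrable)
    also have "norm \<dots> \<le> (\<integral>p. 2 * (M * K (\<pi> (n + m))) \<partial>plays)"
      using i payoff_pot_diff
      by (intro order_trans[OF integral_norm_bound] integral_mono integrable_norm Bochner_Integration.integrable_diff tail_payoff_integrable) auto
    finally show ?thesis by (simp add: prob_space)
  qed
  have 3: "s * W n \<omega> - e - 2 * (M * K (\<pi> (m + n))) \<le> s * payoff" for m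
  proof -
    let ?x = "payoff" and ?y = "\<integral>h. pot m h \<partial>law m"
    have "\<bar>s * (?x - ?y)\<bar> \<le> 2 * (M * K (\<pi> (n + m)))" using 2[of m] s by (simp add: abs_mult)
    moreover have "e * (1 - 1 / 2 ^ m) \<le> e" using e by (simp add: field_simps)
    ultimately show ?thesis using 1[of m] by (simp add: right_diff_distrib add.commute abs_le_iff)
  qed
  have "(\<lambda>m. s * W n \<omega> - e - 2 * (M * K (\<pi> (m + n)))) \<longlonglongrightarrow> s * W n \<omega> - e - 2 * (M * 0)"
    by (intro tendsto_intros K_pi_lim)
  then show ?thesis using 3 by (intro LIMSEQ_le_const2[of _ "s * W n \<omega> - e"]) auto
qed

end

section \<open>The value of the game on a partition\<close>

context partition_game
begin

text \<open>The states carry the discrete sigma-algebra, so every choice of mixed actions by stage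
  and current state is measurable and no measurable selection has to be made.\<close>

lemma markov_strategy:
  assumes "\<And>m z. x m z \<in> Delta" shows "(\<lambda>m hz. x m (snd hz)) \<in> strategies"
  unfolding strategies_def
proof (intro CollectI allI)
  fix m
  have "x m \<in> count_space UNIV \<rightarrow>\<^sub>M prob_algebra borel" using assms by (auto simp: Delta_def)
  then show "(\<lambda>hz. x m (snd hz)) \<in> PiM {0..<m} (\<lambda>_. stage_space) \<Otimes>\<^sub>M count_space UNIV \<rightarrow>\<^sub>M prob_algebra borel"
    by (rule measurable_compose[OF measurable_snd])
qed

text \<open>Stagewise \<epsilon>-optimal actions in the one-shot games with continuation
  \<open>W\<close> form a Markov strategy that is good against every history-dependent opponent.
  \<open>s = 1\<close> yields the guarantee of the first player; \<open>s = -1\<close> reverses the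
  inequality for the second.\<close>

lemma approx_value_game: "approx_value strategies strategies (expected_payoff g k q \<pi> n \<omega>) (W n \<omega>)"
  unfolding approx_value_def
proof (intro conjI allI impI)
  fix e :: real assume e: "e > 0"
  have e': "0 < e / 2 ^ Suc m" for m using e by simp
  let ?F = "\<lambda>m z. mixed_ext (stagef (n + m) z (W (Suc (n + m))))"
  have "\<exists>x. x \<in> Delta \<and> (\<forall>y\<in>Delta. W (n + m) z - e / 2 ^ Suc m \<le> ?F m z x y)" for m z
    using W_approx_value[of "n + m" z] e'[of m] unfolding approx_value_def by blast
  then obtain x where x: "\<And>m z. x m z \<in> Delta" "\<And>m z y. y \<in> Delta \<Longrightarrow> W (n + m) z - e / 2 ^ Suc m \<le> ?F m z (x m z) y"
    by metis
  show "\<exists>\<sigma>\<in>strategies. \<forall>\<tau>\<in>strategies. W n \<omega> - e \<le> expected_payoff g k q \<pi> n \<omega> \<sigma> \<tau>"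
  proof (intro bexI[OF _ markov_strategy[of x, OF x(1)]] ballI)
    fix \<tau> :: "('w, 'i, 'j, 'j) strategy" assume "\<tau> \<in> strategies"
    then interpret play TI TJ g k q M lam L \<pi> n \<omega> "\<lambda>m hz. x m (snd hz)" \<tau>
      using markov_strategy[of x, OF x(1)] by unfold_locales
    show "W n \<omega> - e \<le> expected_payoff g k q \<pi> n \<omega> (\<lambda>m hz. x m (snd hz)) \<tau>"
      using expected_payoff_ge[of 1 e] e x(2)[OF strat_Delta(2)] by (simp add: algebra_simps)
  qed
  have "\<exists>y. y \<in> Delta \<and> (\<forall>x\<in>Delta. ?F m z x y \<le> W (n + m) z + e / 2 ^ Suc m)" for m z
    using W_approx_value[of "n + m" z] e'[of m] unfolding approx_value_def by blast
  then obtain y where y: "\<And>m z. y m z \<in> Delta" "\<And>m z x. x \<in> Delta \<Longrightarrow> ?F m z x (y m z) \<le> W (n + m) z + e / 2 ^ Suc m"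
    by metis
  show "\<exists>\<tau>\<in>strategies. \<forall>\<sigma>\<in>strategies. expected_payoff g k q \<pi> n \<omega> \<sigma> \<tau> \<le> W n \<omega> + e"
  proof (intro bexI[OF _ markov_strategy[of y, OF y(1)]] ballI)
    fix \<sigma> :: "('w, 'i, 'j, 'i) strategy" assume "\<sigma> \<in> strategies"
    then interpret play TI TJ g k q M lam L \<pi> n \<omega> \<sigma> "\<lambda>m hz. y m (snd hz)"
      using markov_strategy[of y, OF y(1)] by unfold_locales
    show "expected_payoff g k q \<pi> n \<omega> \<sigma> (\<lambda>m hz. y m (snd hz)) \<le> W n \<omega> + e"
      using expected_payoff_ge[of "-1" e] e y(2)[OF strat_Delta(1)] by (simp add: algebra_simps)
  qed
qed

lemma expected_payoff_bounded:
  assumes "\<sigma> \<in> strategies" "\<tau> \<in> strategies"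
  shows "\<bar>expected_payoff g k q \<pi> n \<omega> \<sigma> \<tau>\<bar> \<le> M * K (\<pi> n)"
proof -
  interpret play TI TJ g k q M lam L \<pi> n \<omega> \<sigma> \<tau> using assms by unfold_locales
  show ?thesis by (rule expected_payoff_bound)
qed

lemma v_node_eq: "v_node g k q \<pi> n \<omega> = W n \<omega>"
  unfolding v_node_def by (rule game_val_eqI[OF approx_value_game expected_payoff_bounded])

lemma is_value_v_node: "is_value strategies strategies (expected_payoff g k q \<pi> n \<omega>) (v_node g k q \<pi> n \<omega>)"
  unfolding v_node_eq by (rule approx_value_imp_is_value[OF approx_value_game expected_payoff_bounded])

end

section \<open>Convergence of the values\<close>

lemma DERIV_dominated_diff:
  fixes f F :: "real \<Rightarrow> real"
  assumes "a \<le> b" and f: "\<And>s. (f has_real_derivative f' s) (at s)" and F: "\<And>s. (F has_real_derivative F' s) (at s)"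
    and le: "\<And>s. a \<le> s \<Longrightarrow> s \<le> b \<Longrightarrow> \<bar>f' s\<bar> \<le> F' s"
  shows "\<bar>f b - f a\<bar> \<le> F b - F a"
proof -
  have "F a - f a \<le> F b - f b"
    by (rule DERIV_nonneg_imp_nondecreasing[OF \<open>a \<le> b\<close>])
       (use le in \<open>force intro!: derivative_eq_intros f F simp: abs_le_iff\<close>)
  moreover have "F a + f a \<le> F b + f b"
    by (rule DERIV_nonneg_imp_nondecreasing[OF \<open>a \<le> b\<close>])
       (use le in \<open>force intro!: derivative_eq_intros f F simp: abs_le_iff\<close>)
  ultimately show ?thesis by linarith
qed

context markov_game
begin

lemma Ham_bound:
  assumes "\<And>w. \<bar>a w\<bar> \<le> d" shows "\<bar>Ham \<kappa> z a\<bar> \<le> M * \<bar>\<kappa>\<bar> + 2 * lam * d"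
proof -
  have "\<bar>lam * a z\<bar> \<le> lam * d" using assms[of z] lam_pos by (simp add: abs_mult)
  moreover have "\<bar>Gen \<kappa> z a\<bar> \<le> M * \<bar>\<kappa>\<bar> + lam * d" by (rule Gen_bound) (rule assms)
  ultimately show ?thesis unfolding Gen_eq by linarith
qed

lemma sol_bound_0: "0 \<le> t \<Longrightarrow> \<bar>sol t z\<bar> \<le> M * K 0"
  by (rule order_trans[OF sol_bound mult_left_mono[OF K_antimono M_nonneg]])

text \<open>The bound of \<open>Ham_bound\<close> for the generator part of the derivative of
  \<open>sol\<close>. The payoff part is integrated to \<open>M * (K s - K t)\<close> instead of
  being bounded by a constant, since such terms telescope along a partition.\<close>

definition c0 :: real where "c0 = 2 * lam * (M * K 0)"

lemma c0_nonneg: "0 \<le> c0"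
  using lam_pos by (simp add: c0_def M_nonneg K_nonneg)

lemma sol_diff:
  assumes "0 \<le> s" "s \<le> t"
  shows "\<bar>sol t z - sol s z\<bar> \<le> M * (K s - K t) + c0 * (t - s)"
proof -
  have "\<bar>sol t z - sol s z\<bar> \<le> (- M * K t + c0 * t) - (- M * K s + c0 * s)"
  proof (rule DERIV_dominated_diff[OF \<open>s \<le> t\<close> sol_deriv])
    show "((\<lambda>s. - M * K s + c0 * s) has_real_derivative M * kk r + c0) (at r)" for r
      by (auto intro!: derivative_eq_intros K_deriv)
    fix r assume "s \<le> r"
    then have "\<bar>sol r w\<bar> \<le> M * K 0" for w using assms by (intro sol_bound_0) simp
    then have "\<bar>Ham (kk r) z (sol r)\<bar> \<le> M * \<bar>kk r\<bar> + 2 * lam * (M * K 0)" by (rule Ham_bound)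
    then show "\<bar>- Ham (kk r) z (sol r)\<bar> \<le> M * kk r + c0" by (simp add: kk_nonneg c0_def)
  qed
  then show ?thesis by (simp add: algebra_simps)
qed

lemma L_nonneg: "0 \<le> L"
  using k_lipschitz by (simp add: lipschitz_on_def)

lemma kk_lipschitz: "\<bar>kk s - kk t\<bar> \<le> L * \<bar>s - t\<bar>"
proof -
  have "\<bar>kk s - kk t\<bar> \<le> L * \<bar>max 0 s - max 0 t\<bar>"
    using k_lipschitz unfolding lipschitz_on_def kk_def dist_real_def by simp
  also have "\<dots> \<le> L * \<bar>s - t\<bar>" by (intro mult_left_mono L_nonneg) (simp add: max_def)
  finally show ?thesis .
qed

text \<open>By the mean value theorem the exact increment has the slope at some intermediate
  \<open>r\<close>. The Euler step takes the density at the left end and the solution at the right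
  end, as the backward recursion does; replacing \<open>r\<close> by these ends costs the Lipschitz
  terms.\<close>

lemma sol_local_error:
  assumes "0 \<le> s" "s < t"
  shows "\<bar>sol s z - (sol t z + (t - s) * Ham (kk s) z (sol t))\<bar> \<le>
    (t - s) * (M * L * (t - s) + 2 * lam * (M * (K s - K t) + c0 * (t - s)))"
proof -
  obtain r where r: "s < r" "r < t" "sol t z - sol s z = (t - s) * - Ham (kk r) z (sol r)"
    using MVT2[OF \<open>s < t\<close> sol_deriv, of z] by blast
  have d: "\<bar>sol r w - sol t w\<bar> \<le> M * (K s - K t) + c0 * (t - s)" for w
  proof -
    have "\<bar>sol r w - sol t w\<bar> \<le> M * (K r - K t) + c0 * (t - r)"
      using sol_diff[of r t w] assms r by (simp add: abs_minus_commute)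
    also have "\<dots> \<le> M * (K s - K t) + c0 * (t - s)"
      using r K_antimono[of s r] by (intro add_mono mult_left_mono M_nonneg c0_nonneg) auto
    finally show ?thesis .
  qed
  have "\<bar>Ham (kk r) z (sol r) - Ham (kk s) z (sol t)\<bar> \<le> M * \<bar>kk r - kk s\<bar> + 2 * lam * (M * (K s - K t) + c0 * (t - s))"
    by (rule Ham_lipschitz[OF d])
  also have "M * \<bar>kk r - kk s\<bar> \<le> M * (L * (t - s))"
    using r by (intro mult_left_mono M_nonneg order_trans[OF kk_lipschitz] mult_left_mono L_nonneg) auto
  finally have "(t - s) * \<bar>Ham (kk r) z (sol r) - Ham (kk s) z (sol t)\<bar> \<le>
    (t - s) * (M * L * (t - s) + 2 * lam * (M * (K s - K t) + c0 * (t - s)))"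
    using assms by (intro mult_left_mono) (auto simp: mult.assoc)
  moreover have "sol s z - (sol t z + (t - s) * Ham (kk s) z (sol t)) = (t - s) * (Ham (kk r) z (sol r) - Ham (kk s) z (sol t))"
    using r(3) by (simp add: algebra_simps)
  ultimately show ?thesis using assms by (simp add: abs_mult)
qed

lemma row_bounded_scaled: "0 \<le> h \<Longrightarrow> row_bounded (h * lam) (h *\<^sub>R q i j)"
  using q_bound[of i j] unfolding row_bounded_def
  by (simp add: abs_mult mult_left_mono flip: sum_distrib_left)

lemma flow_diff:
  assumes "0 \<le> h" "h \<le> 1"
  shows "\<bar>flow h z i j - g z i j\<bar> \<le> h * lam * exp lam * M"
proof -
  have "\<bar>flow h z i j - g z i j\<bar> \<le> h * lam * exp (h * lam) * M"
    unfolding flow_def by (rule matrix_exp_first_order[OF row_bounded_scaled[OF assms(1)] g_bound])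
  also have "\<dots> \<le> h * lam * exp lam * M"
    using assms lam_pos by (intro mult_right_mono mult_left_mono M_nonneg) auto
  finally show ?thesis .
qed

lemma tm_second_order:
  assumes "0 \<le> h" "h \<le> 1" "\<And>w. \<bar>a w\<bar> \<le> A"
  shows "\<bar>(\<Sum>z'\<in>UNIV. tm h i j z z' * a z') - (a z + h * (\<Sum>z'\<in>UNIV. q i j $ z $ z' * a z'))\<bar> \<le>
    (h * lam)\<^sup>2 * exp lam * A"
proof -
  have "\<bar>(\<Sum>z'\<in>UNIV. tm h i j z z' * a z') - (a z + (\<Sum>z'\<in>UNIV. (h *\<^sub>R q i j) $ z $ z' * a z'))\<bar> \<le>
      (h * lam)\<^sup>2 * exp (h * lam) * A"
    by (rule matrix_exp_second_order[OF row_bounded_scaled[OF assms(1)] assms(3)])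
  also have "\<dots> \<le> (h * lam)\<^sup>2 * exp lam * A"
    using assms lam_pos order_trans[OF abs_ge_zero assms(3)] by (intro mult_right_mono mult_left_mono) auto
  finally show ?thesis by (simp add: sum_distrib_left mult.assoc)
qed

text \<open>\<open>c1\<close> collects the errors of the form step times mass of the stage, from the
  drift of the state during a stage and from the variation of \<open>sol\<close>. \<open>c2\<close>
  collects those quadratic in the step: the two uses of the Lipschitz constant of \<open>k\<close>,
  the second-order term of the matrix exponential, and the \<open>c0\<close> part of the variation
  of \<open>sol\<close>.\<close>

definition c1 :: real where "c1 = (lam * exp lam * M) + 2 * lam * M"

definition c2 :: real where
  "c2 = M * L + (lam\<^sup>2 * exp lam * (M * K 0)) + (M * L + 2 * lam * c0)"

lemma c1_nonneg: "0 \<le> c1" and c2_nonneg: "0 \<le> c2"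
  using lam_pos by (auto simp: c1_def c2_def M_nonneg L_nonneg K_nonneg c0_nonneg)

end

section \<open>Local error of the Shapley operator and its propagation along the partition\<close>

context partition_game
begin

text \<open>Two replacements under the integral: \<open>flow\<close> by \<open>g\<close>, with an
  error proportional to the step and still weighted by \<open>kk\<close>, hence the mass of the
  stage; and \<open>kk t\<close> by its value at the node, with an error
  \<open>L * step n\<close>.\<close>

lemma rew_first_order:
  assumes "step n \<le> 1"
  shows "\<bar>rew n z i j - step n * (g z i j * kk (\<pi> n))\<bar> \<le>
    (step n * lam * exp lam * M) * (K (\<pi> n) - K (\<pi> (Suc n))) + M * L * (step n)\<^sup>2"
proof -
  let ?A = "{\<pi> n..<\<pi> (Suc n)}"
  let ?c = "(step n * lam * exp lam * M)"
  have ic: "set_integrable lborel ?A (\<lambda>_. c :: real)" for c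
    by (rule set_integrable_subset[OF borel_integrable_atLeastAtMost'[of "\<pi> n" "\<pi> (Suc n)" "\<lambda>_. c"]]) auto
  have const: "(LINT t:?A|lborel. c) = step n * c" for c :: real
    using pi_less_Suc[of n] by (simp add: set_lebesgue_integral_def)
  have eq: "rew n z i j - step n * (g z i j * kk (\<pi> n)) =
      (LINT t:?A|lborel. flow (t - \<pi> n) z i j * kk t - g z i j * kk (\<pi> n))"
    unfolding rew_def const[symmetric] by (rule set_integral_diff(2)[OF flow_kk_integrable ic, symmetric])
  have "norm (rew n z i j - step n * (g z i j * kk (\<pi> n))) \<le> (LINT t:?A|lborel. norm (flow (t - \<pi> n) z i j * kk t - g z i j * kk (\<pi> n)))"
    unfolding eq by (rule set_integral_norm_bound[OF set_integral_diff(1)[OF flow_kk_integrable ic]])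
  also have "\<dots> \<le> (LINT t:?A|lborel. ?c * kk t + M * (L * step n))"
  proof (intro set_integral_mono set_integrable_norm set_integral_diff(1) set_integral_add(1) flow_kk_integrable ic
      set_integrable_mult_right kk_integrable')
    fix t assume t: "t \<in> ?A"
    have "\<bar>flow (t - \<pi> n) z i j - g z i j\<bar> \<le> ((t - \<pi> n) * lam * exp lam * M)"
      using t assms by (intro flow_diff) auto
    also have "\<dots> \<le> ?c"
      using t lam_pos by (intro mult_left_mono mult_right_mono M_nonneg) auto
    finally have "\<bar>(flow (t - \<pi> n) z i j - g z i j) * kk t\<bar> \<le> ?c * kk t"
      unfolding abs_mult by (simp add: kk_nonneg mult_right_mono)
    moreover have "\<bar>g z i j * (kk t - kk (\<pi> n))\<bar> \<le> M * (L * step n)"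
    proof -
      have "\<bar>kk t - kk (\<pi> n)\<bar> \<le> L * step n"
        using t by (intro order_trans[OF kk_lipschitz] mult_left_mono L_nonneg) auto
      then show ?thesis unfolding abs_mult by (intro mult_mono g_bound M_nonneg) auto
    qed
    ultimately show "norm (flow (t - \<pi> n) z i j * kk t - g z i j * kk (\<pi> n)) \<le> ?c * kk t + M * (L * step n)"
      unfolding real_norm_def by (simp add: algebra_simps abs_le_iff)
  qed
  also have "\<dots> = ?c * (K (\<pi> n) - K (\<pi> (Suc n))) + step n * (M * (L * step n))"
    by (subst set_integral_add(2)) (auto intro: ic set_integrable_mult_right kk_integrable' simp: const K_step)
  finally show ?thesis by (simp add: power2_eq_square algebra_simps)
qed

text \<open>Values are nonexpansive in the payoff, so it suffices to compare the stage payoff,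
  uniformly in the actions, with an affine function of \<open>Lag\<close>. By
  \<open>cval_affine\<close> the value of the latter is exactly the Euler step.\<close>

lemma shapley_sol_error:
  assumes "step n \<le> 1"
  shows "\<bar>sol (\<pi> n) z - shapley n (sol (\<pi> (Suc n))) z\<bar> \<le>
    step n * (c1 * (K (\<pi> n) - K (\<pi> (Suc n))) + c2 * step n)"
proof -
  let ?a = "sol (\<pi> (Suc n))" and ?h = "step n" and ?D = "K (\<pi> n) - K (\<pi> (Suc n))"
  have "\<bar>shapley n ?a z - cval (\<lambda>i j. ?a z + ?h * Lag (kk (\<pi> n)) z ?a i j)\<bar> \<le>
      ((?h * lam * exp lam * M) * ?D + M * L * ?h\<^sup>2) + ((?h * lam)\<^sup>2 * exp lam * (M * K 0))"
    unfolding shapley_def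
  proof (rule cval_abs_diff_le[OF stagef_cont2])
    show "cont2 (\<lambda>i j. ?a z + ?h * Lag (kk (\<pi> n)) z ?a i j)"
      by (rule cont2_lift[OF _ Lag_cont]) (intro continuous_intros)
    fix i j
    have 1: "\<bar>(\<Sum>z'\<in>UNIV. tm ?h i j z z' * ?a z') - (?a z + ?h * (\<Sum>z'\<in>UNIV. q i j $ z $ z' * ?a z'))\<bar> \<le>
        ((?h * lam)\<^sup>2 * exp lam * (M * K 0))"
      by (rule tm_second_order[OF step_nonneg assms sol_bound_0[OF pi_nonneg]])
    show "\<bar>stagef n z ?a i j - (?a z + ?h * Lag (kk (\<pi> n)) z ?a i j)\<bar> \<le>
        ((?h * lam * exp lam * M) * ?D + M * L * ?h\<^sup>2) + ((?h * lam)\<^sup>2 * exp lam * (M * K 0))"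
      using abs_triangle_ineq[of "rew n z i j - ?h * (g z i j * kk (\<pi> n))"
          "(\<Sum>z'\<in>UNIV. tm ?h i j z z' * ?a z') - (?a z + ?h * (\<Sum>z'\<in>UNIV. q i j $ z $ z' * ?a z'))"]
        add_mono[OF rew_first_order[OF assms, of z i j] 1]
      by (simp add: stagef_def Lag_def distrib_left)
  qed
  moreover have "cval (\<lambda>i j. ?a z + ?h * Lag (kk (\<pi> n)) z ?a i j) = ?a z + ?h * Ham (kk (\<pi> n)) z ?a"
    unfolding Ham_def using pi_less_Suc[of n] by (intro cval_affine Lag_cont) simp
  moreover note sol_local_error[OF pi_nonneg pi_less_Suc, of n z]
  ultimately have "\<bar>sol (\<pi> n) z - shapley n ?a z\<bar> \<le>
      (((?h * lam * exp lam * M) * ?D + M * L * ?h\<^sup>2) + ((?h * lam)\<^sup>2 * exp lam * (M * K 0))) +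
      ?h * (M * L * ?h + 2 * lam * (M * ?D + c0 * ?h))"
    by linarith
  also have "\<dots> = ?h * (c1 * ?D + c2 * ?h)"
    unfolding c1_def c2_def power2_eq_square by (simp add: algebra_simps)
  finally show ?thesis .
qed

text \<open>At the far node both functions are below \<open>M * K\<close>, which gives the factor 2
  and starts the induction. Going back, nonexpansiveness passes errors on without amplification;
  bounding one factor \<open>step n\<close> by \<open>d\<close> leaves sums that telescope in
  \<open>K\<close> and in the nodes.\<close>

lemma W_sol_diff_step:
  assumes d: "\<And>n. step n \<le> d" "d \<le> 1"
  shows "\<bar>W n z - sol (\<pi> n) z\<bar> \<le>
    d * (c1 * (K (\<pi> n) - K (\<pi> (n + m))) + c2 * (\<pi> (n + m) - \<pi> n)) + 2 * (M * K (\<pi> (n + m)))"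
proof (induction m arbitrary: n z)
  case 0
  show ?case using W_bound[of n z] sol_bound[of "\<pi> n" z] by simp
next
  case (Suc m)
  let ?h = "step n" and ?D = "K (\<pi> n) - K (\<pi> (Suc n))"
  let ?E = "d * (c1 * (K (\<pi> (Suc n)) - K (\<pi> (n + Suc m))) + c2 * (\<pi> (n + Suc m) - \<pi> (Suc n))) + 2 * (M * K (\<pi> (n + Suc m)))"
  have "\<bar>W (Suc n) w - sol (\<pi> (Suc n)) w\<bar> \<le> ?E" for w using Suc[of "Suc n" w] by simp
  then have 1: "\<bar>shapley n (W (Suc n)) z - shapley n (sol (\<pi> (Suc n))) z\<bar> \<le> ?E"
    by (rule shapley_nonexpansive)
  have "?h * (c1 * ?D + c2 * ?h) \<le> d * (c1 * ?D + c2 * ?h)"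
    using d(1)[of n] pi_less_Suc[of n] K_antimono[of "\<pi> n" "\<pi> (Suc n)"]
    by (intro mult_right_mono add_nonneg_nonneg mult_nonneg_nonneg c1_nonneg c2_nonneg) auto
  then have 2: "\<bar>sol (\<pi> n) z - shapley n (sol (\<pi> (Suc n))) z\<bar> \<le> d * (c1 * ?D + c2 * ?h)"
    using shapley_sol_error[of n z] d(1)[of n] d(2) by linarith
  have "\<bar>W n z - sol (\<pi> n) z\<bar> \<le> ?E + d * (c1 * ?D + c2 * ?h)"
    using 1 2 unfolding W_shapley[of n z] by linarith
  also have "\<dots> = d * (c1 * (K (\<pi> n) - K (\<pi> (n + Suc m))) + c2 * (\<pi> (n + Suc m) - \<pi> n)) + 2 * (M * K (\<pi> (n + Suc m)))"
    by (simp add: algebra_simps)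
  finally show ?case .
qed

lemma W_sol_diff:
  assumes d: "\<And>n. step n \<le> d" "d \<le> 1" and T: "0 \<le> T"
  shows "\<bar>W n z - sol (\<pi> n) z\<bar> \<le> d * (c1 * K 0 + c2 * (T + 1)) + 2 * (M * K T)"
proof -
  have d0: "0 \<le> d" using d(1)[of 0] step_nonneg[of 0] by linarith
  \<comment> \<open>The far node is the first one beyond \<open>T\<close>; it lies below
    \<open>T + 1\<close> because steps are at most 1. If node \<open>n\<close> is already beyond
    \<open>T\<close>, \<open>m = 0\<close> is taken and the elapsed time is 0, so the bound is
    uniform in \<open>n\<close>.\<close>
  have "\<exists>m. T \<le> \<pi> (n + m) \<and> (m = 0 \<or> \<pi> (n + m) \<le> T + 1)"
  proof (cases "T \<le> \<pi> n")
    case False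
    define l where "l = stage_at \<pi> T"
    have l: "\<pi> l \<le> T" "T < \<pi> (Suc l)" using stage_at[OF T] by (auto simp: l_def)
    have "n \<le> Suc l" using l False strict_mono_less[OF pi_strict, of n "Suc l"] by simp
    then obtain m where "Suc l = n + m" using le_Suc_ex by blast
    then show ?thesis using l d(1)[of l] d(2) by (intro exI[of _ m]) auto
  qed (auto intro: exI[of _ 0])
  then obtain m where m: "T \<le> \<pi> (n + m)" "m = 0 \<or> \<pi> (n + m) \<le> T + 1" by blast
  have "c1 * (K (\<pi> n) - K (\<pi> (n + m))) \<le> c1 * K 0"
    using K_antimono[OF pi_nonneg[of n]] K_nonneg[of "\<pi> (n + m)"] by (intro mult_left_mono c1_nonneg) simp
  moreover have "c2 * (\<pi> (n + m) - \<pi> n) \<le> c2 * (T + 1)"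
    using m T pi_nonneg[of n] by (intro mult_left_mono c2_nonneg) auto
  ultimately have "d * (c1 * (K (\<pi> n) - K (\<pi> (n + m))) + c2 * (\<pi> (n + m) - \<pi> n)) \<le> d * (c1 * K 0 + c2 * (T + 1))"
    by (intro mult_left_mono d0) simp
  moreover have "M * K (\<pi> (n + m)) \<le> M * K T" by (intro mult_left_mono M_nonneg K_antimono m)
  ultimately show ?thesis using W_sol_diff_step[OF d, of n z m] by linarith
qed

lemma v_part_diff:
  assumes e1: "\<And>n. \<bar>W n z - sol (\<pi> n) z\<bar> \<le> e1"
    and e2: "\<And>s. 0 \<le> s \<Longrightarrow> \<bar>s - t\<bar> \<le> d \<Longrightarrow> \<bar>sol s z - sol t z\<bar> \<le> e2"
    and d: "\<And>n. step n \<le> d" and t: "0 \<le> t"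
  shows "\<bar>v_part g k q \<pi> t z - sol t z\<bar> \<le> e1 + e2"
proof -
  define n where "n = stage_at \<pi> t"
  define \<theta> where "\<theta> = (t - \<pi> n) / step n"
  have n: "\<pi> n \<le> t" "t < \<pi> (Suc n)" using stage_at[OF t] by (auto simp: n_def)
  have \<theta>: "0 \<le> \<theta>" "\<theta> \<le> 1" using n by (auto simp: \<theta>_def)
  have W: "\<bar>W n z - sol t z\<bar> \<le> e1 + e2" "\<bar>W (Suc n) z - sol t z\<bar> \<le> e1 + e2"
    using e1[of n] e1[of "Suc n"] e2[OF pi_nonneg, of n] e2[OF pi_nonneg, of "Suc n"] n d[of n] by auto
  have "v_part g k q \<pi> t z = W n z + \<theta> * (W (Suc n) z - W n z)"
    by (simp add: v_part_def Let_def v_node_eq n_def \<theta>_def)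
  then have "v_part g k q \<pi> t z - sol t z = (1 - \<theta>) * (W n z - sol t z) + \<theta> * (W (Suc n) z - sol t z)"
    by (simp add: algebra_simps)
  also have "\<bar>\<dots>\<bar> \<le> (1 - \<theta>) * (e1 + e2) + \<theta> * (e1 + e2)"
    using W \<theta> by (intro order_trans[OF abs_triangle_ineq] add_mono) (simp_all add: abs_mult mult_left_mono)
  finally show ?thesis by (simp add: algebra_simps)
qed

end

section \<open>Small mesh and uniform convergence\<close>

lemma eventually_mesh_to_0:
  assumes "0 < d" "\<And>\<pi>. is_partition \<pi> \<Longrightarrow> (\<And>n. \<pi> (Suc n) - \<pi> n \<le> d) \<Longrightarrow> P \<pi>"
  shows "eventually P mesh_to_0"
  unfolding mesh_to_0_def eventually_inf_principal eventually_filtercomap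
proof (intro exI[of _ "\<lambda>x. x < ereal d"] conjI allI impI)
  show "\<forall>\<^sub>F x in nhds 0. x < ereal d"
    using assms(1) by (intro eventually_nhds[THEN iffD2] exI[of _ "{..<ereal d}"]) auto
  fix \<pi> assume m: "mesh \<pi> < ereal d" and "\<pi> \<in> {\<pi>. is_partition \<pi>}"
  have "\<pi> (Suc n) - \<pi> n \<le> d" for n
  proof -
    have "ereal (\<pi> (Suc n) - \<pi> n) \<le> mesh \<pi>" unfolding mesh_def by (rule SUP_upper) simp
    with m have "ereal (\<pi> (Suc n) - \<pi> n) < ereal d" by (rule order_le_less_trans[rotated])
    then show ?thesis by simp
  qed
  then show "P \<pi>" using \<open>\<pi> \<in> _\<close> by (intro assms(2)) auto
qed

context markov_game
begin

lemma v_part_converges: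
  assumes "e > 0"
  shows "\<forall>\<^sub>F \<pi> in mesh_to_0. \<forall>t\<in>{0..T0}. \<forall>z. \<bar>v_part g k q \<pi> t z - sol t z\<bar> \<le> e"
proof -
  have "((\<lambda>t. M * K t) \<longlongrightarrow> M * 0) at_top" by (intro tendsto_intros K_tendsto_0)
  then have "eventually (\<lambda>t. M * K t < e / 6 \<and> 0 \<le> t) at_top"
    using \<open>e > 0\<close> by (intro eventually_conj order_tendstoD(2)[of _ 0] eventually_ge_at_top) auto
  then obtain T where T: "M * K T < e / 6" "0 \<le> T" using eventually_happens'[OF trivial_limit_at_top_linorder] by blast
  \<comment> \<open>The nodes next to a time \<open>t\<close> below \<open>T0\<close> may lie beyond
    \<open>T0\<close>, but by at most the step, which will not exceed 1.\<close>
  have "uniformly_continuous_on {0..T0 + 1} K"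
    by (intro compact_uniformly_continuous continuous_on_subset[OF K_cont]) auto
  then obtain d1 where d1: "d1 > 0" "\<And>s t. s \<in> {0..T0 + 1} \<Longrightarrow> t \<in> {0..T0 + 1} \<Longrightarrow> \<bar>s - t\<bar> < d1 \<Longrightarrow> \<bar>K s - K t\<bar> < e / (6 * (M + 1))"
    using \<open>e > 0\<close> M_nonneg unfolding uniformly_continuous_on_def dist_real_def
    by (metis add_nonneg_pos divide_pos_pos mult_pos_pos zero_less_numeral zero_less_one)
  define Q where "Q = c1 * K 0 + c2 * (T + 1)"
  have Q: "0 \<le> Q" unfolding Q_def using T by (intro add_nonneg_nonneg mult_nonneg_nonneg c1_nonneg c2_nonneg K_nonneg) auto
  \<comment> \<open>The error \<open>e\<close> is split into thirds: the tail beyond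
    \<open>T\<close>, the accumulated local errors \<open>d * Q\<close>, and the oscillation of
    \<open>sol\<close> between a node and \<open>t\<close>. The last third is halved between the
    \<open>K\<close> part, controlled by \<open>d1\<close>, and the \<open>c0\<close> part.\<close>
  define d where "d = min (min 1 (d1 / 2)) (min (e / (3 * (Q + 1))) (e / (6 * (c0 + 1))))"
  have d: "0 < d" "d \<le> 1" "d < d1" using d1 Q c0_nonneg \<open>e > 0\<close> by (auto simp: d_def)
  have dQ: "d * Q \<le> e / 3"
  proof -
    have "d * Q \<le> e / (3 * (Q + 1)) * (Q + 1)" using Q d by (intro mult_mono) (auto simp: d_def)
    also have "\<dots> = e / 3" using Q by (simp add: divide_simps)
    finally show ?thesis .
  qed
  have dc: "c0 * d \<le> e / 6"
  proof -
    have "c0 * d \<le> (c0 + 1) * (e / (6 * (c0 + 1)))" using c0_nonneg d by (intro mult_mono) (auto simp: d_def)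
    also have "\<dots> = e / 6" using c0_nonneg by (simp add: divide_simps)
    finally show ?thesis .
  qed
  have mod: "\<bar>sol s z - sol t z\<bar> \<le> e / 3" if "0 \<le> s" "\<bar>s - t\<bar> \<le> d" "t \<in> {0..T0}" for s t z
  proof -
    have *: "\<bar>sol s z - sol t z\<bar> \<le> M * \<bar>K s - K t\<bar> + c0 * \<bar>s - t\<bar>"
      using that sol_diff[of s t z] sol_diff[of t s z] K_antimono[of s t] K_antimono[of t s]
      by (cases "s \<le> t") (auto simp: abs_minus_commute)
    have "\<bar>K s - K t\<bar> \<le> e / (6 * (M + 1))" using that d by (intro less_imp_le d1(2)) auto
    then have "M * \<bar>K s - K t\<bar> \<le> (M + 1) * (e / (6 * (M + 1)))" using M_nonneg by (intro mult_mono) auto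
    also have "\<dots> = e / 6" using M_nonneg by (simp add: divide_simps)
    finally have "M * \<bar>K s - K t\<bar> \<le> e / 6" .
    moreover have "c0 * \<bar>s - t\<bar> \<le> c0 * d" using that by (intro mult_left_mono c0_nonneg)
    ultimately show ?thesis using * dc by linarith
  qed
  show ?thesis
  proof (rule eventually_mesh_to_0[OF d(1)], intro ballI allI)
    fix \<pi> :: "nat \<Rightarrow> real" and t z
    assume p: "is_partition \<pi>" and st: "\<And>n. \<pi> (Suc n) - \<pi> n \<le> d" and t: "t \<in> {0..T0}"
    interpret partition_game TI TJ g k q M lam L \<pi> using p by unfold_locales
    have "\<bar>W n z - sol (\<pi> n) z\<bar> \<le> 2 * e / 3" for n
      using W_sol_diff[OF st d(2) T(2), of n z] dQ T(1) unfolding Q_def[symmetric] by linarith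
    then have "\<bar>v_part g k q \<pi> t z - sol t z\<bar> \<le> 2 * e / 3 + e / 3"
      using mod t by (intro v_part_diff[OF _ _ st]) auto
    then show "\<bar>v_part g k q \<pi> t z - sol t z\<bar> \<le> e" by simp
  qed
qed

lemma v_part_uniform_limit:
  assumes "compact S" "S \<subseteq> {0..}"
  shows "uniform_limit (S \<times> UNIV) (\<lambda>\<pi> (t, \<omega>). v_part g k q \<pi> t \<omega>) (\<lambda>(t, \<omega>). sol t \<omega>) mesh_to_0"
proof (rule uniform_limitI)
  fix e :: real assume e: "e > 0"
  obtain T0 where T0: "\<And>t. t \<in> S \<Longrightarrow> t \<le> T0"
    using compact_imp_bounded[OF assms(1)] by (meson abs_le_D1 bounded_real)
  have "\<forall>\<^sub>F \<pi> in mesh_to_0. \<forall>t\<in>{0..T0}. \<forall>z. \<bar>v_part g k q \<pi> t z - sol t z\<bar> \<le> e / 2"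
    using e by (intro v_part_converges) simp
  then show "\<forall>\<^sub>F \<pi> in mesh_to_0. \<forall>x\<in>S \<times> UNIV. dist (case x of (t, \<omega>) \<Rightarrow> v_part g k q \<pi> t \<omega>) (case x of (t, \<omega>) \<Rightarrow> sol t \<omega>) < e"
  proof eventually_elim
    case (elim \<pi>)
    show ?case
    proof
      fix x assume "x \<in> S \<times> (UNIV :: 'w set)"
      then have "\<bar>v_part g k q \<pi> (fst x) (snd x) - sol (fst x) (snd x)\<bar> \<le> e / 2"
        using elim T0 assms(2) by (auto simp: subset_iff)
      then show "dist (case x of (t, \<omega>) \<Rightarrow> v_part g k q \<pi> t \<omega>) (case x of (t, \<omega>) \<Rightarrow> sol t \<omega>) < e"
        using e by (simp add: dist_real_def split_beta)
    qed
  qed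
qed

definition solV :: "real \<Rightarrow> real^'w \<Rightarrow> real" where
  "solV t \<zeta> = (\<Sum>\<omega>\<in>UNIV. \<zeta> $ \<omega> * sol t \<omega>)"

lemma prob_simplex_avg_le:
  fixes \<zeta> :: "real^'w"
  assumes "\<zeta> \<in> prob_simplex" "\<And>\<omega>. \<bar>a \<omega>\<bar> \<le> e"
  shows "\<bar>\<Sum>\<omega>\<in>UNIV. \<zeta> $ \<omega> * a \<omega>\<bar> \<le> e"
proof -
  have "\<bar>\<Sum>\<omega>\<in>UNIV. \<zeta> $ \<omega> * a \<omega>\<bar> \<le> (\<Sum>\<omega>\<in>UNIV. \<zeta> $ \<omega> * e)"
    using assms by (intro order_trans[OF sum_abs] sum_mono) (simp add: abs_mult prob_simplex_def mult_left_mono)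
  then show ?thesis using assms(1) by (simp add: prob_simplex_def flip: sum_distrib_right)
qed

lemma V_part_uniform_limit:
  assumes "compact S" "S \<subseteq> {0..} \<times> prob_simplex"
  shows "uniform_limit S (\<lambda>\<pi> (t, \<zeta>). V_part g k q \<pi> t \<zeta>) (\<lambda>(t, \<zeta>). solV t \<zeta>) mesh_to_0"
proof (rule uniform_limitI)
  fix e :: real assume e: "e > 0"
  have "bounded (fst ` S)"
    by (intro compact_imp_bounded compact_continuous_image continuous_intros assms)
  then obtain T0 where T0: "\<And>x. x \<in> S \<Longrightarrow> fst x \<le> T0"
    unfolding bounded_real by (metis abs_le_D1 imageI)
  have "\<forall>\<^sub>F \<pi> in mesh_to_0. \<forall>t\<in>{0..T0}. \<forall>z. \<bar>v_part g k q \<pi> t z - sol t z\<bar> \<le> e / 2"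
    using e by (intro v_part_converges) simp
  then show "\<forall>\<^sub>F \<pi> in mesh_to_0. \<forall>x\<in>S. dist (case x of (t, \<zeta>) \<Rightarrow> V_part g k q \<pi> t \<zeta>) (case x of (t, \<zeta>) \<Rightarrow> solV t \<zeta>) < e"
  proof eventually_elim
    case (elim \<pi>)
    show ?case
    proof
      fix x assume x: "x \<in> S"
      then have "x \<in> {0..} \<times> prob_simplex" using assms(2) by blast
      then have "fst x \<in> {0..T0}" "snd x \<in> prob_simplex" using T0[OF x] by auto
      then have "\<bar>\<Sum>\<omega>\<in>UNIV. snd x $ \<omega> * (v_part g k q \<pi> (fst x) \<omega> - sol (fst x) \<omega>)\<bar> \<le> e / 2"
        using elim by (intro prob_simplex_avg_le) auto
      then show "dist (case x of (t, \<zeta>) \<Rightarrow> V_part g k q \<pi> t \<zeta>) (case x of (t, \<zeta>) \<Rightarrow> solV t \<zeta>) < e"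
        using e by (simp add: dist_real_def split_beta V_part_def solV_def right_diff_distrib sum_subtractf)
    qed
  qed
qed

section \<open>The limit as the viscosity solution\<close>

lemma Ham_sol_cont: "continuous_on UNIV (\<lambda>t. Ham (kk t) z (sol t))"
proof -
  have "continuous_on UNIV (\<lambda>t. exp (lam * t) * integrand sol z t - lam * sol t z)"
    by (intro continuous_intros integrand_cont sol_cont)
  moreover have "exp (lam * t) * integrand sol z t - lam * sol t z = Ham (kk t) z (sol t)" for t
    by (simp add: integrand_def Gen_eq exp_minus flip: mult.assoc)
  ultimately show ?thesis by simp
qed

lemma state_hamiltonian_kk: "0 \<le> t \<Longrightarrow> state_hamiltonian g k q t z a = Ham (kk t) z a"
  by (simp add: state_hamiltonian_eq kk_def)

lemma simplex_hamiltonian_kk: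
  "0 \<le> t \<Longrightarrow> \<zeta> \<in> prob_simplex \<Longrightarrow> simplex_hamiltonian g k q t \<zeta> a = (\<Sum>\<omega>\<in>UNIV. \<zeta> $ \<omega> * Ham (kk t) \<omega> (\<lambda>z. a $ z))"
  by (simp add: simplex_hamiltonian_eq kk_def)

lemma sol_deriv_states:
  assumes "0 \<le> t"
  shows "((\<lambda>s. sol s z) has_real_derivative - state_hamiltonian g k q t z (sol t)) (at t within {0..})"
    and "((\<lambda>s. - sol s z) has_real_derivative - dual_states (state_hamiltonian g k q) t z (\<lambda>w. - sol t w)) (at t within {0..})"
  unfolding dual_states_def using DERIV_minus[OF sol_deriv[of z t]] sol_deriv[of z t]
  by (auto simp: state_hamiltonian_kk[OF assms] intro: has_field_derivative_at_within)

lemma simplex_equation: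
  assumes "0 \<le> t" "\<zeta> \<in> prob_simplex"
  shows "(\<Sum>\<omega>\<in>UNIV. \<zeta> $ \<omega> * - Ham (kk t) \<omega> (sol t)) + simplex_hamiltonian g k q t \<zeta> (\<chi> \<omega>. sol t \<omega>) = 0"
    and "(\<Sum>\<omega>\<in>UNIV. \<zeta> $ \<omega> * Ham (kk t) \<omega> (sol t)) + dual_simplex (simplex_hamiltonian g k q) t \<zeta> (\<chi> \<omega>. - sol t \<omega>) = 0"
proof -
  have "($) (\<chi> \<omega>. sol t \<omega>) = sol t" "($) (- (\<chi> \<omega>. - sol t \<omega>)) = sol t" by auto
  then show "(\<Sum>\<omega>\<in>UNIV. \<zeta> $ \<omega> * - Ham (kk t) \<omega> (sol t)) + simplex_hamiltonian g k q t \<zeta> (\<chi> \<omega>. sol t \<omega>) = 0"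
    and "(\<Sum>\<omega>\<in>UNIV. \<zeta> $ \<omega> * Ham (kk t) \<omega> (sol t)) + dual_simplex (simplex_hamiltonian g k q) t \<zeta> (\<chi> \<omega>. - sol t \<omega>) = 0"
    unfolding dual_simplex_def simplex_hamiltonian_kk[OF assms] by (simp_all add: sum_negf)
qed

text \<open>Uniqueness is two comparisons: \<open>u'\<close> against \<open>sol\<close> for the
  Hamiltonian, and \<open>- u'\<close> against \<open>- sol\<close> for its dual, for which
  \<open>- sol\<close> is again a classical solution.\<close>

lemma vanishing_solution_states:
  "the_vanishing_solution UNIV (viscosity_solution_states (state_hamiltonian g k q)) sol"
  unfolding the_vanishing_solution_def
proof (intro conjI allI impI ballI)
  let ?H = "state_hamiltonian g k q"
  show "viscosity_solution_states ?H sol"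
    unfolding viscosity_solution_states_iff
    by (intro conjI allI continuous_on_subset[OF sol_cont] classical_subsolution_states
        elliptic_states_hamiltonian elliptic_dual_states sol_deriv_states) auto
  show "vanishes_at_infinity UNIV sol" by (rule sol_vanishes)
  have lip: "?H t z a \<le> ?H t z b + 2 * lam * d" "dual_states ?H t z a \<le> dual_states ?H t z b + 2 * lam * d"
    if ab: "\<And>w. \<bar>a w - b w\<bar> \<le> d" for t z a b d
  proof -
    show "?H t z a \<le> ?H t z b + 2 * lam * d"
      using Ham_lipschitz[where a = a and b = b and \<kappa> = "k t" and \<kappa>' = "k t" and z = z, OF ab] by (simp add: state_hamiltonian_eq)
    have "\<bar>- b w - - a w\<bar> \<le> d" for w using ab[of w] by simp
    from Ham_lipschitz[where a = "\<lambda>w. - b w" and b = "\<lambda>w. - a w" and \<kappa> = "k t" and \<kappa>' = "k t" and z = z, OF this]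
    show "dual_states ?H t z a \<le> dual_states ?H t z b + 2 * lam * d" by (simp add: state_hamiltonian_eq dual_states_def)
  qed
  have cont: "continuous_on {0..} (\<lambda>t. ?H t z (sol t))" for z
    by (rule continuous_on_eq[OF continuous_on_subset[OF Ham_sol_cont[of z]]]) (auto simp: state_hamiltonian_kk)
  then have cont': "continuous_on {0..} (\<lambda>t. dual_states ?H t z (\<lambda>w. - sol t w))" for z
    by (simp add: dual_states_def continuous_on_minus)
  fix u' and t :: real and z assume u: "viscosity_solution_states ?H u' \<and> vanishes_at_infinity UNIV u'" and t: "0 \<le> t"
  then have u': "\<And>z. continuous_on {0..} (\<lambda>t. u' t z)" "subsolution_states ?H u'"
    "subsolution_states (dual_states ?H) (\<lambda>t z. - u' t z)" "vanishes_at_infinity UNIV u'"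
    unfolding viscosity_solution_states_iff by auto
  have "u' t z \<le> sol t z"
    by (rule comparison_states[OF sol_deriv_states(1) cont elliptic_states_hamiltonian lip(1) u'(2,1,4) sol_vanishes t])
  moreover have "- u' t z \<le> - sol t z"
    by (rule comparison_states[where v = "\<lambda>t z. - sol t z" and H = "dual_states ?H" and u = "\<lambda>t z. - u' t z" and C = "2 * lam"])
       (auto intro!: sol_deriv_states cont' elliptic_dual_states elliptic_states_hamiltonian lip u' t
         vanishes_at_infinity_uminus sol_vanishes continuous_intros)
  ultimately show "u' t z = sol t z" by simp
qed

lemma solV_vanishes: "vanishes_at_infinity prob_simplex solV"
  unfolding vanishes_at_infinity_def
proof (intro allI impI)
  fix e :: real assume "e > 0"
  then obtain T where "T \<ge> 0" "\<forall>t\<ge>T. \<forall>a. \<bar>sol t a\<bar> \<le> e"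
    using sol_vanishes unfolding vanishes_at_infinity_def by auto
  then show "\<exists>T\<ge>0. \<forall>t\<ge>T. \<forall>a\<in>prob_simplex. \<bar>solV t a\<bar> \<le> e"
    unfolding solV_def by (intro exI[of _ T]) (auto intro: prob_simplex_avg_le)
qed

lemma vanishing_solution_simplex:
  "the_vanishing_solution prob_simplex (viscosity_solution_simplex (simplex_hamiltonian g k q)) solV"
  unfolding the_vanishing_solution_def
proof (intro conjI allI impI ballI)
  let ?H = "simplex_hamiltonian g k q"
  \<comment> \<open>Negation stays within bilinear extensions, so the lemmas for \<open>solV\<close>
    apply to \<open>- solV\<close> and the dual Hamiltonian as they stand.\<close>
  have uminus: "(\<lambda>t \<zeta>. - solV t \<zeta>) = (\<lambda>t \<zeta>. \<Sum>\<omega>\<in>UNIV. \<zeta> $ \<omega> * - sol t \<omega>)"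
    by (simp add: solV_def sum_negf)
  have dminus: "((\<lambda>s. - sol s z) has_real_derivative Ham (kk t) z (sol t)) (at t)" for t z
    using DERIV_minus[OF sol_deriv[of z t]] by simp
  note solV = solV_def[abs_def, symmetric]
  show "viscosity_solution_simplex ?H solV"
    unfolding viscosity_solution_simplex_iff
  proof (intro conjI)
    show "continuous_on ({0..} \<times> prob_simplex) (\<lambda>(t, \<zeta>). solV t \<zeta>)"
      unfolding solV_def split_beta' by (intro continuous_intros continuous_on_compose2[OF sol_cont]) auto
    show "subsolution_simplex ?H solV"
      using classical_subsolution_simplex[OF sol_deriv simplex_equation(1) elliptic_simplex_hamiltonian]
      unfolding solV .
    show "subsolution_simplex (dual_simplex ?H) (\<lambda>t \<zeta>. - solV t \<zeta>)"
      unfolding uminus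
      by (rule classical_subsolution_simplex[OF dminus simplex_equation(2) elliptic_dual_simplex[OF elliptic_simplex_hamiltonian]])
  qed
  show "vanishes_at_infinity prob_simplex solV" by (rule solV_vanishes)
  fix U :: "real \<Rightarrow> real^'w \<Rightarrow> real" and t :: real and \<zeta> :: "real^'w"
  assume U: "viscosity_solution_simplex ?H U \<and> vanishes_at_infinity prob_simplex U"
    and t: "0 \<le> t" "\<zeta> \<in> prob_simplex"
  then have U': "continuous_on ({0..} \<times> prob_simplex) (\<lambda>(t, \<zeta>). U t \<zeta>)" "subsolution_simplex ?H U"
    "subsolution_simplex (dual_simplex ?H) (\<lambda>t \<zeta>. - U t \<zeta>)" "vanishes_at_infinity prob_simplex U"
    unfolding viscosity_solution_simplex_iff by auto
  have "U t \<zeta> \<le> solV t \<zeta>"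
    unfolding solV_def
    by (rule comparison_simplex[OF sol_deriv continuous_on_minus[OF Ham_sol_cont] simplex_equation(1) U'(2,1,4) _ t])
       (use solV_vanishes in \<open>simp_all add: solV\<close>)
  moreover have "- U t \<zeta> \<le> (\<Sum>\<omega>\<in>UNIV. \<zeta> $ \<omega> * - sol t \<omega>)"
  proof (rule comparison_simplex[OF dminus Ham_sol_cont simplex_equation(2) U'(3) _ _ _ t])
    show "continuous_on ({0..} \<times> prob_simplex) (\<lambda>(t, \<zeta>). - U t \<zeta>)"
      using continuous_on_minus[OF U'(1)] by (simp add: split_beta')
  qed (use vanishes_at_infinity_uminus[OF U'(4)] vanishes_at_infinity_uminus[OF solV_vanishes] in \<open>simp_all add: uminus\<close>)
  ultimately show "U t \<zeta> = solV t \<zeta>" by (simp add: solV_def sum_negf)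
qed

end

text \<open>The density is normalized through a gauge integral. Nonnegativity makes it absolutely
  integrable, and continuity provides the Borel measurability needed to pass from the completed
  measure to \<open>lborel\<close>.\<close>

lemma lipschitz_density_integrable:
  fixes k :: "real \<Rightarrow> real"
  assumes "\<And>t. t \<ge> 0 \<Longrightarrow> k t \<ge> 0" "continuous_on {0..} k" "(k has_integral 1) {0..}"
  shows "set_integrable lborel {0..} k"
proof -
  have "k absolutely_integrable_on {0..}"
    using assms(1,3) by (intro nonnegative_absolutely_integrable_1) (auto simp: has_integral_integrable)
  moreover have "(\<lambda>t. indicator {0..} t *\<^sub>R k t) \<in> borel_measurable borel"
    by (rule borel_measurable_continuous_on_indicator[OF _ assms(2)]) simp
  ultimately show ?thesis
    unfolding set_integrable_def by (simp add: integrable_completion)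
qed

theorem corollary3p1:
  fixes g :: "'w::finite \<Rightarrow> 'i::metric_space \<Rightarrow> 'j::metric_space \<Rightarrow> real"
    and k :: "real \<Rightarrow> real"
    and q :: "'i \<Rightarrow> 'j \<Rightarrow> real^'w^'w"
  assumes "compact (UNIV :: 'i set)" and "compact (UNIV :: 'j set)"
    and "\<And>\<omega>. continuous_on UNIV (\<lambda>(i, j). g \<omega> i j)"
    and "\<And>t. t \<ge> 0 \<Longrightarrow> k t \<ge> 0" and "\<exists>L. L-lipschitz_on {0..} k" and "(k has_integral 1) {0..}"
    and "transition_rate q" and "bounded (range (\<lambda>(i, j). q i j))"
    and "continuous_on UNIV (\<lambda>(i, j). q i j)"
  shows "(\<forall>\<pi> n \<omega>. is_partition \<pi> \<longrightarrow>
            is_value strategies strategies (expected_payoff g k q \<pi> n \<omega>) (v_node g k q \<pi> n \<omega>)) \<and>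
         (\<exists>(V :: real \<Rightarrow> real^'w \<Rightarrow> real) (v :: real \<Rightarrow> 'w \<Rightarrow> real).
            (\<forall>K. compact K \<and> K \<subseteq> {0..} \<times> prob_simplex \<longrightarrow>
               uniform_limit K (\<lambda>\<pi> (t, \<zeta>). V_part g k q \<pi> t \<zeta>) (\<lambda>(t, \<zeta>). V t \<zeta>) mesh_to_0) \<and>
            (\<forall>K. compact K \<and> K \<subseteq> {0..} \<longrightarrow>
               uniform_limit (K \<times> UNIV) (\<lambda>\<pi> (t, \<omega>). v_part g k q \<pi> t \<omega>) (\<lambda>(t, \<omega>). v t \<omega>) mesh_to_0) \<and>
            (\<forall>t\<ge>0. \<forall>\<zeta>\<in>prob_simplex. V t \<zeta> = (\<Sum>\<omega>\<in>UNIV. \<zeta> $ \<omega> * v t \<omega>)) \<and>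
            the_vanishing_solution prob_simplex
              (viscosity_solution_simplex (simplex_hamiltonian g k q)) V \<and>
            the_vanishing_solution UNIV
              (viscosity_solution_states (state_hamiltonian g k q)) v)"
proof -
  have "\<exists>M. \<forall>i j. norm (g \<omega> i j) \<le> M" for \<omega>
    using continuous_compact_bounded[OF assms(1,2,3)] by metis
  then obtain Mf where Mf: "\<And>\<omega> i j. \<bar>g \<omega> i j\<bar> \<le> Mf \<omega>" by (metis real_norm_def)
  define M where "M = (\<Sum>\<omega>\<in>UNIV. \<bar>Mf \<omega>\<bar>)"
  have M: "\<bar>g \<omega> i j\<bar> \<le> M" for \<omega> i j
  proof -
    have "\<bar>g \<omega> i j\<bar> \<le> \<bar>Mf \<omega>\<bar>" using Mf[of \<omega> i j] by simp
    also have "\<dots> \<le> M" unfolding M_def by (rule member_le_sum) auto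
    finally show ?thesis .
  qed
  obtain B where B: "\<And>i j. norm (q i j) \<le> B" using assms(8) by (auto simp: bounded_iff)
  \<comment> \<open>The summand 1 keeps \<open>lam\<close> positive even when all rates vanish; the
    weight \<open>exp (- lam * s)\<close> has to decay.\<close>
  define lam where "lam = real CARD('w) * B + 1"
  have rb: "row_bounded lam (q i j)" for i j
  proof -
    have "real CARD('w) * norm (q i j) \<le> lam"
      using mult_left_mono[OF B[of i j] of_nat_0_le_iff[of "CARD('w)"]] unfolding lam_def by linarith
    then show ?thesis using row_bounded_norm[of "q i j"] unfolding row_bounded_def by (meson order_trans)
  qed
  have lam: "0 < lam"
    using order_trans[OF norm_ge_zero B] by (simp add: lam_def add_nonneg_pos)
  obtain L where L: "L-lipschitz_on {0..} k" using assms(5) by blast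
  interpret markov_game "TYPE('i)" "TYPE('j)" g k q M lam L
    using assms M rb lam L lipschitz_density_integrable[OF assms(4) lipschitz_on_continuous_on[OF L] assms(6)]
    by unfold_locales auto
  show ?thesis
  proof (intro conjI allI impI exI[of _ solV] exI[of _ sol] ballI)
    fix \<pi> n \<omega> assume "is_partition \<pi>"
    then interpret partition_game "TYPE('i)" "TYPE('j)" g k q M lam L \<pi> by unfold_locales
    show "is_value strategies strategies (expected_payoff g k q \<pi> n \<omega>) (v_node g k q \<pi> n \<omega>)"
      by (rule is_value_v_node)
  next
    show "solV t \<zeta> = (\<Sum>\<omega>\<in>UNIV. \<zeta> $ \<omega> * sol t \<omega>)" for t \<zeta> by (simp add: solV_def)
  qed (auto intro: V_part_uniform_limit v_part_uniform_limit vanishing_solution_simplex vanishing_solution_states)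
qed

end
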